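(* Fix one of the types $\mathrm{B}$, $\mathrm{C}$, $\mathrm{D}$, and let $R$, $W$, $I$, $\ell$, $\partial_i$, $\delta_i$ be as described in the context. There exists a unique family of elements $\mathfrak{S}_w=\mathfrak{S}_w(z,t;x)\in R$, $w\in W$, such that for all $i\in I$ and all $w\in W$: $$\partial_i\mathfrak{S}_w=\begin{cases}\mathfrak{S}_{ws_i}&\text{if }\ell(ws_i)<\ell(w),\\ 0&\text{otherwise},\end{cases}\qquad \delta_i\mathfrak{S}_w=\begin{cases}\mathfrak{S}_{s_iw}&\text{if }\ell(s_iw)<\ell(w),\\ 0&\text{otherwise},\end{cases}$$ and such that $\mathfrak{S}_e=1$ and $\mathfrak{S}_w$ has zero constant term for every $w\neq e$.
   Context: Let $t=(t_1,t_2,\dots)$, $z=(z_1,z_2,\dots)$, $x=(x_1,x_2,\dots)$ be indeterminates. Define $Q_k(x)$ by $\prod_{i\ge1}\frac{1+x_iu}{1-x_iu}=\sum_{k\ge0}Q_k(x)u^k$, and put $P_k(x)=\tfrac12 Q_k(x)$ for $k\ge1$. Let $\Gamma=\mathbb{Z}[Q_1(x),Q_2(x),\dots]$ and $\Gamma'=\mathbb{Z}[P_1(x),P_2(x),\dots]$. Put $R_\infty=\mathbb{Z}[t]\otimes\mathbb{Z}[z]\otimes\Gamma$ and $R'_\infty=\mathbb{Z}[t]\otimes\mathbb{Z}[z]\otimes\Gamma'$; graded by $\deg t_i=\deg z_i=1$, $\deg Q_k=\deg P_k=k$. The "constant term" is the degree-$0$ component. Let $W_\infty$ be the group of permutations $w$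 of $\{1,2,\dots\}\cup\{\bar1,\bar2,\dots\}$ with $w(i)=i$ for all but finitely many $i$ and $w(\bar i)=\overline{w(i)}$ (with $\bar{\bar i}=i$); it is a Coxeter group with generators $s_0=(1,\bar1)$ and $s_i=(i,i+1)(\bar i,\overline{i+1})$, $i\ge1$. Let $W'_\infty\subset W_\infty$ be the subgroup of elements with an even number of sign changes; it is a Coxeter group with generators $s_{\hat1}=s_0s_1s_0,s_1,s_2,\dots$. Type $\mathrm{C}$: $R=R_\infty$, $W=W_\infty$, $I=\{0,1,2,\dots\}$. Type $\mathrm{B}$: $R=R'_\infty$, $W=W_\infty$, $I=\{0,1,2,\dots\}$. Type $\mathrm{D}$: $R=R'_\infty$, $W=W'_\infty$, $I=\{\hat1,1,2,\dots\}$. $\ell$ is the Coxeter length in $W$ with respect to $\{s_i\}_{i\in I}$, and $e$ is the identity. Two actions of $W_\infty$ on $R'_\infty$ (preserving $R_\infty$) by ring automorphisms: for $i\ge1$, $s_i^z$ swaps $z_i,z_{i+1}$ and fixes all $t_j$ and $\Gamma'$; $s_0^z$ sends $z_1\mapsto -z_1$, fixes the other $z_j$ and all $t_j$, and sends $\varphi(x_1,x_2,\dots)\mapsto\varphi(z_1,x_1,x_2,\dots)$ for $\varphi\in\Gamma'$ (e.g. $Q_k(x)\mapsto Q_k(x)+2\sum_{j=1}^k z_1^jQ_{k-j}(x)$). Similarly $s_i^t$ ($i\ge1$) swaps $t_i,t_{i+1}$, and $s_0^t$ sends $t_1\mapsto -t_1$ and $\varphi(x)\mapsto\varphi(-t_1,x_1,x_2,\dots)$.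 Put $s_{\hat1}^z=s_0^zs_1^zs_0^z$, $s_{\hat1}^t=s_0^ts_1^ts_0^t$. Simple roots in $\mathbb{Z}[t]$: $\alpha_i=t_{i+1}-t_i$ ($i\ge1$); $\alpha_0=t_1$ (type B), $\alpha_0=2t_1$ (type C), $\alpha_{\hat1}=t_1+t_2$ (type D). Let $\omega$ be the ring involution of $R$ with $\omega(z_i)=-t_i$, $\omega(t_i)=-z_i$, $\omega$ fixing $\Gamma'$. For $i\in I$ and $f\in R$: $\partial_i f=\frac{f-s_i^zf}{\omega(\alpha_i)}$ and $\delta_i f=\frac{f-s_i^tf}{\alpha_i}$. *)

theory Defs
  imports
    "HOL-Library.Poly_Mapping"
    "HOL-Library.FuncSet"
    "HOL-Combinatorics.Transposition"
    "HOL-Computational_Algebra.Formal_Power_Series"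
begin

section \<open>Formal power series in arbitrarily many variables\<close>

text \<open>
  A monomial in variables of type \<open>'v\<close> is a finitely supported exponent vector;
  a power series is an arbitrary function from monomials to coefficients.
\<close>

type_synonym 'v monomial = "'v \<Rightarrow>\<^sub>0 nat"

abbreviation exponent :: "'v monomial \<Rightarrow> 'v \<Rightarrow> nat" where
  "exponent \<equiv> Poly_Mapping.lookup"

abbreviation variables :: "'v monomial \<Rightarrow> 'v set" where
  "variables \<equiv> Poly_Mapping.keys"

typedef ('v, 'a) mseries = "UNIV :: ('v monomial \<Rightarrow> 'a) set"
  morphisms coeff Series ..

lemma coeff_Series [simp]: "coeff (Series f) = f"
  by (simp add: Series_inverse)

lemma mseries_eqI: "(\<And>m. coeff f m = coeff g m) \<Longrightarrow> f = g"
  by (metis coeff_inject ext)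

lemma finite_monomials_below:
  fixes m :: "'v monomial"
  shows "finite {a. \<forall>v. exponent a v \<le> exponent m v}" (is "finite ?S")
proof -
  let ?k = "\<lambda>a :: 'v monomial. restrict (exponent a) (variables m)"
  have inj: "inj_on ?k ?S"
  proof (rule inj_onI)
    fix a b assume a: "a \<in> ?S" and b: "b \<in> ?S" and eq: "?k a = ?k b"
    show "a = b"
    proof (rule poly_mapping_eqI)
      fix v
      show "exponent a v = exponent b v"
      proof (cases "v \<in> variables m")
        case True
        with fun_cong[OF eq, of v] show ?thesis by simp
      next
        case False
        then have "exponent m v = 0" by (simp add: in_keys_iff)
        moreover from a b have "exponent a v \<le> exponent m v" "exponent b v \<le> exponent m v"
          by auto
        ultimately show ?thesis by simp
      qed
    qed
  qed
  have "?k ` ?S \<subseteq> (\<Pi>\<^sub>E v \<in> variables m. {..exponent m v})"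
    by auto
  moreover have "finite (\<Pi>\<^sub>E v \<in> variables m. {..exponent m v})"
    by (intro finite_PiE) auto
  ultimately have "finite (?k ` ?S)" by (rule finite_subset)
  then show ?thesis using inj by (rule finite_imageD)
qed

lemma finite_splittings [simp]:
  fixes m :: "'v monomial"
  shows "finite {(a, b). a + b = m}"
proof (rule finite_subset)
  let ?S = "{a. \<forall>v. exponent a v \<le> exponent m v}"
  show "{(a, b). a + b = m} \<subseteq> ?S \<times> ?S"
    by (auto simp: lookup_add)
  show "finite (?S \<times> ?S)"
    using finite_monomials_below by blast
qed

instantiation mseries :: (type, comm_ring_1) comm_ring_1
begin

definition zero_mseries :: "('a, 'b) mseries" where
  "0 = Series (\<lambda>m. 0)"

definition one_mseries :: "('a, 'b) mseries" where
  "1 = Series (\<lambda>m. if m = 0 then 1 else 0)"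

definition plus_mseries :: "('a, 'b) mseries \<Rightarrow> ('a, 'b) mseries \<Rightarrow> ('a, 'b) mseries" where
  "f + g = Series (\<lambda>m. coeff f m + coeff g m)"

definition uminus_mseries :: "('a, 'b) mseries \<Rightarrow> ('a, 'b) mseries" where
  "- f = Series (\<lambda>m. - coeff f m)"

definition minus_mseries :: "('a, 'b) mseries \<Rightarrow> ('a, 'b) mseries \<Rightarrow> ('a, 'b) mseries" where
  "f - g = Series (\<lambda>m. coeff f m - coeff g m)"

definition times_mseries :: "('a, 'b) mseries \<Rightarrow> ('a, 'b) mseries \<Rightarrow> ('a, 'b) mseries" where
  "f * g = Series (\<lambda>m. \<Sum>(a, b) | a + b = m. coeff f a * coeff g b)"

instance
proof
  fix f g h :: "('a, 'b) mseries"
  note defs = zero_mseries_def one_mseries_def plus_mseries_def uminus_mseries_def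
    minus_mseries_def times_mseries_def
  show "f + g + h = f + (g + h)" by (simp add: defs add.assoc)
  show "f + g = g + f" by (simp add: defs add.commute)
  show "0 + f = f" by (simp add: defs coeff_inverse)
  show "- f + f = 0" by (simp add: defs)
  show "f - g = f + - g" by (simp add: defs)
  show "(f + g) * h = f * h + g * h"
    by (simp add: defs distrib_right sum.distrib case_prod_unfold)
  show "(0 :: ('a, 'b) mseries) \<noteq> 1"
  proof
    assume "(0 :: ('a, 'b) mseries) = 1"
    then have "coeff (0 :: ('a, 'b) mseries) 0 = coeff 1 0" by simp
    then show False by (simp add: defs)
  qed
  show "f * g = g * f"
  proof (rule mseries_eqI)
    fix m
    have "(\<Sum>(a, b) | a + b = m. coeff f a * coeff g b)
        = (\<Sum>(a, b) | a + b = m. coeff g a * coeff f b)"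
      by (rule sum.reindex_bij_witness[where i = prod.swap and j = prod.swap])
        (auto simp: add.commute mult.commute)
    then show "coeff (f * g) m = coeff (g * f) m" by (simp add: defs)
  qed
  show "1 * f = f"
  proof (rule mseries_eqI)
    fix m
    have "(\<Sum>(a, b) | a + b = m. coeff 1 a * coeff f b)
        = (\<Sum>(a, b) \<in> {(0, m)}. coeff 1 a * coeff f b)"
      by (rule sum.mono_neutral_right) (auto simp: defs split: if_splits)
    then show "coeff (1 * f) m = coeff f m" by (simp add: defs)
  qed
  show "f * g * h = f * (g * h)"
  proof (rule mseries_eqI)
    fix m
    let ?F = "\<lambda>m :: 'a monomial. {(a, b). a + b = m}"
    have "coeff (f * g * h) m
        = (\<Sum>p \<in> ?F m. \<Sum>q \<in> ?F (fst p). coeff f (fst q) * coeff g (snd q) * coeff h (snd p))"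
      by (simp add: defs case_prod_unfold sum_distrib_right)
    also have "\<dots> = (\<Sum>(p, q) \<in> (SIGMA p : ?F m. ?F (fst p)).
        coeff f (fst q) * coeff g (snd q) * coeff h (snd p))"
      by (rule sum.Sigma) auto
    also have "\<dots> = (\<Sum>(p, q) \<in> (SIGMA p : ?F m. ?F (snd p)).
        coeff f (fst p) * (coeff g (fst q) * coeff h (snd q)))"
      by (rule sum.reindex_bij_witness[where
            i = "\<lambda>(p, q). ((fst p + fst q, snd q), (fst p, fst q))" and
            j = "\<lambda>(p, q). ((fst q, snd q + snd p), (snd q, snd p))"])
        (auto simp: add.assoc mult.assoc)
    also have "\<dots> = (\<Sum>p \<in> ?F m. \<Sum>q \<in> ?F (snd p).
        coeff f (fst p) * (coeff g (fst q) * coeff h (snd q)))"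
      by (rule sum.Sigma[symmetric]) auto
    also have "\<dots> = coeff (f * (g * h)) m"
      by (simp add: defs case_prod_unfold sum_distrib_left)
    finally show "coeff (f * g * h) m = coeff (f * (g * h)) m" .
  qed
qed

end

definition Var :: "'v \<Rightarrow> ('v, 'a :: comm_ring_1) mseries" where
  "Var v = Series (\<lambda>m. if m = Poly_Mapping.single v 1 then 1 else 0)"

text \<open>
  \<open>substitute \<sigma> \<epsilon>\<close> replaces every variable \<open>v\<close> by \<open>\<epsilon> v\<close> times the variable \<open>\<sigma> v\<close>:
  the monomial \<open>m'\<close> turns into \<open>\<Prod>v. \<epsilon> v ^ m' v\<close> times \<open>rename_monomial \<sigma> m'\<close>.  As renaming
  preserves the degree, the sum below is finite whenever \<open>\<sigma>\<close> has finite fibres,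
  which holds in all uses.
\<close>

definition rename_monomial :: "('v \<Rightarrow> 'w) \<Rightarrow> 'v monomial \<Rightarrow> 'w monomial" where
  "rename_monomial \<sigma> m = (\<Sum>v\<in>variables m. Poly_Mapping.single (\<sigma> v) (exponent m v))"

definition substitute ::
    "('v \<Rightarrow> 'w) \<Rightarrow> ('v \<Rightarrow> 'a) \<Rightarrow> ('v, 'a :: comm_ring_1) mseries \<Rightarrow> ('w, 'a) mseries" where
  "substitute \<sigma> \<epsilon> f =
    Series (\<lambda>m. \<Sum>m' | rename_monomial \<sigma> m' = m.
      (\<Prod>v\<in>variables m'. \<epsilon> v ^ exponent m' v) * coeff f m')"

text \<open>
  Every variable has degree 1; for the series \<open>Q\<^sub>k\<close>, \<open>P\<^sub>k\<close> below, homogeneous of degree \<open>k\<close>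
  in the \<open>x\<^sub>i\<close>, this gives the usual grading.
\<close>

definition monomial_degree :: "'v monomial \<Rightarrow> nat" where
  "monomial_degree m = (\<Sum>v\<in>variables m. exponent m v)"

definition homogeneous_component ::
    "nat \<Rightarrow> ('v, 'a :: comm_ring_1) mseries \<Rightarrow> ('v, 'a) mseries" where
  "homogeneous_component d f = Series (\<lambda>m. if monomial_degree m = d then coeff f m else 0)"

inductive_set generated_subring :: "'a :: comm_ring_1 set \<Rightarrow> 'a set" for G where
  generator: "g \<in> G \<Longrightarrow> g \<in> generated_subring G"
| one: "1 \<in> generated_subring G"
| diff: "a \<in> generated_subring G \<Longrightarrow> b \<in> generated_subring G \<Longrightarrow> a - b \<in> generated_subring G"
| mult: "a \<in> generated_subring G \<Longrightarrow> b \<in> generated_subring G \<Longrightarrow> a * b \<in> generated_subring G"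


section \<open>The rings \<open>R\<^sub>\<infinity>\<close> and \<open>R'\<^sub>\<infinity>\<close>\<close>

text \<open>
  All rings live inside the power series ring over \<open>\<int>\<close> in the variables \<open>t\<^sub>i, z\<^sub>i, x\<^sub>i\<close>.
  Indices start at 1; the variables of index 0 exist in the type but never occur in
  an element of the rings below.
\<close>

datatype var = T_var nat | Z_var nat | X_var nat

type_synonym series = "(var, int) mseries"

abbreviation tvar :: "nat \<Rightarrow> series" where "tvar i \<equiv> Var (T_var i)"
abbreviation zvar :: "nat \<Rightarrow> series" where "zvar i \<equiv> Var (Z_var i)"
abbreviation xvar :: "nat \<Rightarrow> series" where "xvar i \<equiv> Var (X_var i)"

text \<open>
  The partial product \<open>\<Prod>\<^sub>1\<^sub>\<le>\<^sub>i\<^sub>\<le>\<^sub>n (1 + x\<^sub>i u) / (1 - x\<^sub>i u)\<close> as a power series in \<open>u\<close>, where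
  \<open>1 / (1 - x\<^sub>i u)\<close> is the geometric series \<open>\<Sum>k. x\<^sub>i\<^sup>k u\<^sup>k\<close>.  The infinite product is its
  coefficientwise limit: every coefficient is eventually constant in \<open>n\<close>.
\<close>

definition Q_product :: "nat \<Rightarrow> series fps" where
  "Q_product n = (\<Prod>i = 1..n. (1 + fps_const (xvar i) * fps_X) * Abs_fps (\<lambda>k. xvar i ^ k))"

definition Q_fun :: "nat \<Rightarrow> series" where
  "Q_fun k = Series (\<lambda>m. THE c. \<forall>\<^sub>F n in sequentially. coeff (fps_nth (Q_product n) k) m = c)"

definition P_fun :: "nat \<Rightarrow> series" where
  "P_fun k = (THE p. 2 * p = Q_fun k)"

definition Gamma :: "series set" where
  "Gamma = generated_subring (Q_fun ` {1..})"

definition Gamma' :: "series set" where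
  "Gamma' = generated_subring (P_fun ` {1..})"

text \<open>
  Over \<open>Gamma\<close> and \<open>Gamma'\<close>, which only involve the \<open>x\<^sub>i\<close>, the \<open>t\<^sub>i\<close> and \<open>z\<^sub>i\<close> are algebraically
  independent, so the subrings generated are the tensor products with \<open>\<int>[t] \<otimes> \<int>[z]\<close>.
\<close>

definition R_inf :: "series set" where
  "R_inf = generated_subring (tvar ` {1..} \<union> zvar ` {1..} \<union> Gamma)"

definition R_inf' :: "series set" where
  "R_inf' = generated_subring (tvar ` {1..} \<union> zvar ` {1..} \<union> Gamma')"


section \<open>Types, index sets and Weyl groups\<close>

datatype lie_type = TypeB | TypeC | TypeD

datatype index = Idx nat | Hat1

fun index_set :: "lie_type \<Rightarrow> index set" where
  "index_set TypeB = range Idx"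
| "index_set TypeC = range Idx"
| "index_set TypeD = insert Hat1 (Idx ` {1..})"

text \<open>Extends a family \<open>s\<^sub>0, s\<^sub>1, \<dots>\<close> by \<open>s\<^sub>0 \<circ> s\<^sub>1 \<circ> s\<^sub>0\<close> at the index \<open>Hat1\<close>.\<close>

fun with_hat :: "(nat \<Rightarrow> 'a \<Rightarrow> 'a) \<Rightarrow> index \<Rightarrow> 'a \<Rightarrow> 'a" where
  "with_hat s (Idx i) = s i"
| "with_hat s Hat1 = s 0 \<circ> s 1 \<circ> s 0"

text \<open>
  The barred number \<open>i\<close> is represented by \<open>- i\<close>, so signed permutations are the odd
  permutations (in the sense of odd functions) of the integers; they fix 0.
\<close>

definition W_inf :: "(int \<Rightarrow> int) set" where
  "W_inf = {w. bij w \<and> (\<forall>i. w (- i) = - w i) \<and> finite {i. w i \<noteq> i}}"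

definition W_inf' :: "(int \<Rightarrow> int) set" where
  "W_inf' = {w \<in> W_inf. even (card {i. i > 0 \<and> w i < 0})}"

fun Weyl_group :: "lie_type \<Rightarrow> (int \<Rightarrow> int) set" where
  "Weyl_group TypeB = W_inf"
| "Weyl_group TypeC = W_inf"
| "Weyl_group TypeD = W_inf'"

definition s_perm :: "nat \<Rightarrow> int \<Rightarrow> int" where
  "s_perm i = (if i = 0 then transpose 1 (- 1)
     else transpose (int i) (int i + 1) \<circ> transpose (- int i) (- (int i + 1)))"

definition reflection :: "index \<Rightarrow> int \<Rightarrow> int" where
  "reflection = with_hat s_perm"

definition len :: "lie_type \<Rightarrow> (int \<Rightarrow> int) \<Rightarrow> nat" where
  "len Y w = (LEAST n. \<exists>is. length is = n \<and> set is \<subseteq> index_set Y \<and>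
     w = foldr (\<circ>) (map reflection is) id)"


section \<open>Actions on the rings and divided differences\<close>

fun ring_R :: "lie_type \<Rightarrow> series set" where
  "ring_R TypeB = R_inf'"
| "ring_R TypeC = R_inf"
| "ring_R TypeD = R_inf'"

fun shift_to_z :: "var \<Rightarrow> var" where
  "shift_to_z (T_var j) = T_var j"
| "shift_to_z (Z_var j) = Z_var j"
| "shift_to_z (X_var j) = (if j = 1 then Z_var 1 else X_var (j - 1))"

fun shift_to_t :: "var \<Rightarrow> var" where
  "shift_to_t (T_var j) = T_var j"
| "shift_to_t (Z_var j) = Z_var j"
| "shift_to_t (X_var j) = (if j = 1 then T_var 1 else X_var (j - 1))"

text \<open>
  \<open>s\<^sub>0\<^sup>z\<close> is \<open>z\<^sub>1 \<mapsto> - z\<^sub>1\<close>, \<open>x\<^sub>1 \<mapsto> z\<^sub>1\<close>, \<open>x\<^sub>j\<^sub>+\<^sub>1 \<mapsto> x\<^sub>j\<close>, and \<open>s\<^sub>0\<^sup>t\<close> is \<open>t\<^sub>1 \<mapsto> - t\<^sub>1\<close>, \<open>x\<^sub>1 \<mapsto> - t\<^sub>1\<close>,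
  \<open>x\<^sub>j\<^sub>+\<^sub>1 \<mapsto> x\<^sub>j\<close>.
\<close>

definition s_z :: "nat \<Rightarrow> series \<Rightarrow> series" where
  "s_z i = (if i = 0 then substitute shift_to_z (\<lambda>v. if v = Z_var 1 then - 1 else 1)
     else substitute (transpose (Z_var i) (Z_var (i + 1))) (\<lambda>_. 1))"

definition s_t :: "nat \<Rightarrow> series \<Rightarrow> series" where
  "s_t i = (if i = 0 then substitute shift_to_t (\<lambda>v. if v = T_var 1 \<or> v = X_var 1 then - 1 else 1)
     else substitute (transpose (T_var i) (T_var (i + 1))) (\<lambda>_. 1))"

definition act_z :: "index \<Rightarrow> series \<Rightarrow> series" where
  "act_z = with_hat s_z"

definition act_t :: "index \<Rightarrow> series \<Rightarrow> series" where
  "act_t = with_hat s_t"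

fun simple_root :: "lie_type \<Rightarrow> index \<Rightarrow> series" where
  "simple_root Y (Idx i) =
     (if i = 0 then (if Y = TypeC then 2 * tvar 1 else tvar 1) else tvar (i + 1) - tvar i)"
| "simple_root Y Hat1 = tvar 1 + tvar 2"

fun swap_tz :: "var \<Rightarrow> var" where
  "swap_tz (T_var j) = Z_var j"
| "swap_tz (Z_var j) = T_var j"
| "swap_tz (X_var j) = X_var j"

fun sign_tz :: "var \<Rightarrow> int" where
  "sign_tz (T_var j) = - 1"
| "sign_tz (Z_var j) = - 1"
| "sign_tz (X_var j) = 1"

definition omega :: "series \<Rightarrow> series" where
  "omega = substitute swap_tz sign_tz"

text \<open>The quotient is unique, as the power series ring over \<open>\<int>\<close> is a domain.\<close>

definition quotient_in :: "'a :: comm_ring_1 set \<Rightarrow> 'a \<Rightarrow> 'a \<Rightarrow> 'a" where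
  "quotient_in A f a = (THE g. g \<in> A \<and> a * g = f)"

definition del :: "lie_type \<Rightarrow> index \<Rightarrow> series \<Rightarrow> series" where
  "del Y i f = quotient_in (ring_R Y) (f - act_z i f) (omega (simple_root Y i))"

definition delta :: "lie_type \<Rightarrow> index \<Rightarrow> series \<Rightarrow> series" where
  "delta Y i f = quotient_in (ring_R Y) (f - act_t i f) (simple_root Y i)"

end

theory Submission
  imports Defs
begin

text \<open>
  Following Fomin--Kirillov, the Schubert polynomials are the coefficients of one element of the
  completed nilCoxeter ring with generators \<open>u\<^sub>i\<close>, a product \<open>\<SS> = B(t) F(x) A(z)\<close>.  With
  \<open>h\<^sub>i(a) = 1 + a u\<^sub>i\<close>, the relations for the \<open>\<partial>\<^sub>i\<close> say that \<open>s\<^sub>i\<^sup>z\<close> acts on \<open>\<SS>\<close> as right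
  multiplication by \<open>h\<^sub>i(- \<omega>(\<alpha>\<^sub>i))\<close>.  For \<open>i \<ge> 1\<close> this is the Yang--Baxter equation in the type A factor
  \<open>A(z)\<close>.  For the other reflections one needs \<open>F(z\<^sub>1, x) = F(x) C(z\<^sub>1)\<close>, where the
  \<open>C(z) = \<Sum>\<^sub>k c\<^sub>k z\<^sup>k\<close> commute by the reflection equation and satisfy \<open>C(z) C(- z) = 1\<close>.

  The coefficients of \<open>F\<close> are built inside \<open>\<Gamma>\<close> (or \<open>\<Gamma>'\<close>) by induction on the length.  If
  \<open>f(z\<^sub>1, x) = \<Sum>\<^sub>k z\<^sub>1\<^sup>k D\<^sub>k f\<close>, the condition on \<open>F\<close> prescribes all \<open>D\<^sub>k F\<^sub>w\<close> with \<open>k \<ge> 1\<close>; the two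
  properties of \<open>C\<close> are exactly the integrability conditions, and the system is integrated with
  the vertex operators of the Schur \<open>Q\<close>-functions, which stay in the ring and need no division.

  The relations for the \<open>\<delta>\<^sub>i\<close> follow from \<open>\<SS>\<^sub>v = \<omega>(\<SS>\<^sub>w)\<close> for \<open>v = w\<^sup>-\<^sup>1\<close>.  Uniqueness holds because an element
  of \<open>R\<close> invariant under both actions is constant.
\<close>

section \<open>Words in the Weyl groups\<close>

text \<open>Defining \<open>F\<close> as an infinite product of factors \<open>C(x_j)\<close> would
  leave the decisive point open: that its coefficients are integral polynomials in the
  \<open>Q_k\<close> (or \<open>P_k\<close>). Prescribing the \<open>D_k\<close> and integrating
  keeps every coefficient in the ring from the start. The price is integrality. For k >= 1,
  \<open>D_k\<close> of a ring generator is 0 or \<open>kappa\<close> times some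
  \<open>Q_fun\<close>, with \<open>kappa\<close> equal to 2 in type C and 1 otherwise, so each
  integration step divides by \<open>kappa\<close>; the root of \<open>s_0\<close> in type C carries
  the same 2. What pays for this is that \<open>kappa\<close> divides every coefficient of
  \<open>C(1)\<close> except the one at the identity.

  The rank is infinite, so neither \<open>A(z)\<close> nor \<open>C(z)\<close> is a finite product.
  The factorization identities are proved for finitely many letters and read modulo the elements
  that have a reduced word with a letter of level at least \<open>n\<close>. Of the length only
  subadditivity and invariance under inversion enter, with no exchange condition, because a monomial
  in the \<open>u_i\<close> is determined by its group element, its letters and their
  number.\<close>

fun level :: "index \<Rightarrow> nat" where
  "level (Idx i) = i"
| "level Hat1 = 1"

definition wprod :: "index list \<Rightarrow> int \<Rightarrow> int" where
  "wprod is = foldr (\<circ>) (map reflection is) id"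

lemma wprod_Nil [simp]: "wprod [] = id"
  by (simp add: wprod_def)

lemma wprod_Cons [simp]: "wprod (i # is) = reflection i \<circ> wprod is"
  by (simp add: wprod_def)

lemma wprod_append: "wprod (is @ js) = wprod is \<circ> wprod js"
  by (induction "is") (simp_all add: comp_assoc)

lemma s_perm_0: "s_perm 0 x = (if x = 1 then -1 else if x = -1 then 1 else x)"
  by (simp add: s_perm_def transpose_def)

lemma s_perm_pos:
  "i \<noteq> 0 \<Longrightarrow> s_perm i x =
    (if x = int i then int i + 1 else if x = int i + 1 then int i
     else if x = - int i then - (int i + 1) else if x = - (int i + 1) then - int i else x)"
  by (auto simp: s_perm_def transpose_def)

lemma reflection_0 [simp]:
  "reflection (Idx 0) x = (if x = 1 then -1 else if x = -1 then 1 else x)"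
  by (simp add: reflection_def s_perm_0)

lemma reflection_pos [simp]:
  "i \<noteq> 0 \<Longrightarrow> reflection (Idx i) x =
    (if x = int i then int i + 1 else if x = int i + 1 then int i
     else if x = - int i then - (int i + 1) else if x = - (int i + 1) then - int i else x)"
  by (simp add: reflection_def s_perm_pos)

lemma reflection_Hat1 [simp]:
  "reflection Hat1 x = (if x = 1 then -2 else if x = 2 then -1
     else if x = -1 then 2 else if x = -2 then 1 else x)"
  by (auto simp: reflection_def s_perm_0 s_perm_pos)

lemma reflection_invol [simp]: "reflection i (reflection i x) = x"
proof (cases i)
  case (Idx j)
  then show ?thesis by (cases "j = 0") auto
qed auto

lemma reflection_comp_self [simp]: "reflection i \<circ> reflection i = id"
  by (rule ext) simp

lemma reflection_neq_id [simp]: "reflection i \<noteq> id"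
proof
  assume "reflection i = id"
  then have "reflection i (int (level i)) = int (level i)" "reflection i 1 = 1" by simp_all
  then show False by (cases i; cases "level i = 0") auto
qed

lemma bij_reflection: "bij (reflection i)"
  by (metis reflection_comp_self o_bij)

lemma reflection_odd: "reflection i (- x) = - reflection i x"
proof (cases i)
  case (Idx j)
  then show ?thesis by (cases "j = 0") auto
qed auto

lemma reflection_id_above: "level i < g \<Longrightarrow> \<bar>x\<bar> > int g \<Longrightarrow> reflection i x = x"
proof (cases i)
  case (Idx j)
  then show "level i < g \<Longrightarrow> \<bar>x\<bar> > int g \<Longrightarrow> ?thesis" by (cases "j = 0") auto
qed auto

lemma reflection_le: "level i < g \<Longrightarrow> \<bar>x\<bar> \<le> int g \<Longrightarrow> \<bar>reflection i x\<bar> \<le> int g"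
proof (cases i)
  case (Idx j)
  then show "level i < g \<Longrightarrow> \<bar>x\<bar> \<le> int g \<Longrightarrow> ?thesis" by (cases "j = 0") auto
qed auto

lemma reflection_id_below: "1 \<le> g \<Longrightarrow> g < level i \<Longrightarrow> \<bar>x\<bar> \<le> int g \<Longrightarrow> reflection i x = x"
proof (cases i)
  case (Idx j)
  then show "1 \<le> g \<Longrightarrow> g < level i \<Longrightarrow> \<bar>x\<bar> \<le> int g \<Longrightarrow> ?thesis" by (cases "j = 0") auto
qed auto

lemma wprod_rev_left: "wprod (rev is) \<circ> wprod is = id"
proof (induction "is")
  case (Cons i "is")
  have "wprod (rev (i # is)) \<circ> wprod (i # is)
      = wprod (rev is) \<circ> (reflection i \<circ> reflection i) \<circ> wprod is"
    by (simp only: rev.simps wprod_append wprod_Cons wprod_Nil comp_id comp_assoc)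
  then show ?case using Cons.IH by (simp only: reflection_comp_self comp_id)
qed simp

lemma wprod_rev_right: "wprod is \<circ> wprod (rev is) = id"
  using wprod_rev_left[of "rev is"] by simp

lemma inv_wprod: "inv (wprod is) = wprod (rev is)"
  using inv_unique_comp wprod_rev_left wprod_rev_right by blast

lemma bij_wprod: "bij (wprod is)"
  using wprod_rev_left wprod_rev_right o_bij by blast

subsection \<open>The simple reflections generate\<close>

lemma W_inf_comp_reflection:
  assumes "w \<in> W_inf" shows "w \<circ> reflection i \<in> W_inf"
proof -
  from assms have w: "bij w" "\<And>i. w (- i) = - w i" "finite {i. w i \<noteq> i}" by (auto simp: W_inf_def)
  have "{x. reflection i x \<noteq> x} \<subseteq> {- int (level i) - 2 .. int (level i) + 2}"
    by (cases i; cases "level i = 0") auto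
  then have "finite {x. reflection i x \<noteq> x}"
    by (rule finite_subset) simp
  then have "finite ({j. w j \<noteq> j} \<union> {x. reflection i x \<noteq> x})" using w by simp
  then have "finite {j. (w \<circ> reflection i) j \<noteq> j}"
    by (rule rev_finite_subset) auto
  then show ?thesis
    using w bij_reflection by (auto simp: W_inf_def reflection_odd intro: bij_comp)
qed

lemma wprod_in_W_inf: "wprod is \<in> W_inf"
proof (induction "is" rule: rev_induct)
  case (snoc i "is")
  then show ?case by (simp only: wprod_append wprod_Cons wprod_Nil comp_id W_inf_comp_reflection)
qed (use bij_id in \<open>simp add: W_inf_def id_def\<close>)

text \<open>Consecutive entries of the chain -n, ..., -1, 1, ..., n are exchanged by a simple
  reflection: \<open>s_0\<close> crosses the gap at 0, and \<open>s_i\<close> with i > 0 serves both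
  j = i and j = -i - 1.\<close>

lemma reflection_moves_up_prod:
  assumes "j < int n" "j \<ge> - int n" "j \<noteq> 0" "n \<ge> 1"
  obtains i where "reflection (Idx i) j > j" "reflection (Idx i) j \<le> int n"
    "reflection (Idx i) j \<noteq> 0"
    "\<And>x. \<bar>x\<bar> > int n \<Longrightarrow> reflection (Idx i) x = x"
proof (cases "j > 0")
  case True
  with assms show ?thesis by (intro that[of "nat j"]) auto
next
  case False
  show ?thesis
  proof (cases "j = -1")
    case True
    with assms show ?thesis by (intro that[of 0]) auto
  next
    case False
    with \<open>\<not> j > 0\<close> assms have "nat (- j - 1) \<noteq> 0" "int (nat (- j - 1)) = - j - 1" by auto
    with \<open>\<not> j > 0\<close> False assms show ?thesis by (intro that[of "nat (- j - 1)"]) auto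
  qed
qed

text \<open>Right multiplication by simple reflections carries the preimage of \<open>n\<close> up
  to \<open>n\<close> itself; by oddness \<open>-n\<close> is then fixed too, so the support shrinks
  and induction on \<open>n\<close> can take over.\<close>

lemma W_inf_sort:
  assumes "w \<in> W_inf" "\<And>x. \<bar>x\<bar> > int n \<Longrightarrow> w x = x" "n \<ge> 1" "w j = int n"
  shows "\<exists>is. \<exists>v \<in> W_inf. w = v \<circ> wprod (map Idx is) \<and> (\<forall>x. \<bar>x\<bar> \<ge> int n \<longrightarrow> v x = x)"
  using assms
proof (induction "nat (int n - j)" arbitrary: w j rule: less_induct)
  case less
  have bij: "bij w" and odd: "\<And>i. w (- i) = - w i" using less.prems by (auto simp: W_inf_def)
  have inj: "w x = w y \<longleftrightarrow> x = y" for x y using bij by (auto simp: bij_def inj_def)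
  have "\<not> \<bar>j\<bar> > int n"
  proof
    assume "\<bar>j\<bar> > int n"
    then have "w j = j" using less.prems by blast
    with less.prems \<open>\<bar>j\<bar> > int n\<close> show False by simp
  qed
  moreover have "j \<noteq> 0" using odd[of 0] less.prems by (auto)
  ultimately have j: "j \<ge> - int n" "j \<noteq> 0" "j \<le> int n" by auto
  show ?case
  proof (cases "j = int n")
    case True
    have "w x = x" if "\<bar>x\<bar> \<ge> int n" for x
    proof (cases "\<bar>x\<bar> = int n")
      case True
      then have "x = int n \<or> x = - int n" by linarith
      then show ?thesis using \<open>j = int n\<close> less.prems(4) odd[of "int n"] by auto
    next
      case False
      then show ?thesis using that less.prems(2) by force
    qed
    then show ?thesis using less.prems(1) by (intro exI[of _ "[]"] bexI[of _ w]) auto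
  next
    case False
    then have "j < int n" using j by simp
    with j less.prems(3) obtain i where i: "reflection (Idx i) j > j" "reflection (Idx i) j \<le> int n"
      "reflection (Idx i) j \<noteq> 0" "\<And>x. \<bar>x\<bar> > int n \<Longrightarrow> reflection (Idx i) x = x"
      using reflection_moves_up_prod[of j n] by metis
    let ?w = "w \<circ> reflection (Idx i)"
    have "\<exists>is. \<exists>v\<in>W_inf. ?w = v \<circ> wprod (map Idx is) \<and> (\<forall>x. int n \<le> \<bar>x\<bar> \<longrightarrow> v x = x)"
    proof (rule less.hyps[of "reflection (Idx i) j"])
      show "nat (int n - reflection (Idx i) j) < nat (int n - j)" using i \<open>j < int n\<close> by simp
      show "?w x = x" if "\<bar>x\<bar> > int n" for x using i(4)[OF that] less.prems(2)[OF that] by simp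
      show "?w (reflection (Idx i) j) = int n" unfolding comp_def reflection_invol by (rule less.prems)
    qed (use less.prems W_inf_comp_reflection in auto)
    then obtain "is" v where v: "v \<in> W_inf" "?w = v \<circ> wprod (map Idx is)" "\<forall>x. int n \<le> \<bar>x\<bar> \<longrightarrow> v x = x"
      by blast
    have "w = ?w \<circ> reflection (Idx i)" by (simp add: comp_assoc)
    also have "\<dots> = v \<circ> wprod (map Idx (is @ [i]))" unfolding v(2) by (simp add: wprod_append comp_assoc)
    finally show ?thesis using v by blast
  qed
qed

lemma W_inf_generated:
  assumes "w \<in> W_inf" "\<And>x. \<bar>x\<bar> > int n \<Longrightarrow> w x = x"
  shows "\<exists>is. w = wprod (map Idx is)"
  using assms
proof (induction n arbitrary: w)
  case 0
  have "w 0 = 0" using 0(1) by (auto simp: W_inf_def dest: spec[of _ 0])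
  have "w = wprod (map Idx [])"
  proof
    fix x show "w x = wprod (map Idx []) x" using 0(2)[of x] \<open>w 0 = 0\<close> by (cases "x = 0") auto
  qed
  then show ?case by blast
next
  case (Suc n)
  obtain j where "w j = int (Suc n)" using Suc.prems(1) by (auto simp: W_inf_def bij_def) (metis surjD)
  with Suc.prems obtain "is" v where v: "v \<in> W_inf" "w = v \<circ> wprod (map Idx is)"
      "\<forall>x. \<bar>x\<bar> \<ge> int (Suc n) \<longrightarrow> v x = x"
    using W_inf_sort[of w "Suc n" j] by auto
  with Suc.IH[of v] obtain js where "v = wprod (map Idx js)" by auto
  with v have "w = wprod (map Idx (js @ is))" by (simp add: wprod_append)
  then show ?case by blast
qed

lemma W_inf_bound:
  assumes "w \<in> W_inf" obtains n where "\<And>x. \<bar>x\<bar> > int n \<Longrightarrow> w x = x"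
proof -
  have "finite {i. w i \<noteq> i}" using assms by (simp add: W_inf_def)
  then have "finite (abs ` {i. w i \<noteq> i})" by simp
  then obtain b where b: "\<forall>x \<in> abs ` {i. w i \<noteq> i}. x \<le> b"
    by (meson bdd_above_finite bdd_above_def)
  show ?thesis
  proof (rule that[of "nat b"])
    fix x assume "\<bar>x\<bar> > int (nat b)"
    then have "\<bar>x\<bar> > b" by linarith
    then show "w x = x" using b by force
  qed
qed

lemma W_inf_words: "W_inf = wprod ` lists (range Idx)"
proof
  show "W_inf \<subseteq> wprod ` lists (range Idx)"
  proof
    fix w assume w: "w \<in> W_inf"
    then obtain n where "\<And>x. \<bar>x\<bar> > int n \<Longrightarrow> w x = x" using W_inf_bound by blast
    with w obtain "is" where "w = wprod (map Idx is)" using W_inf_generated by blast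
    moreover have "map Idx is \<in> lists (range Idx)" by auto
    ultimately show "w \<in> wprod ` lists (range Idx)" by blast
  qed
qed (use wprod_in_W_inf in auto)

text \<open>For i > 0 the reflection permutes the positive numbers and only relabels the set that is
  counted; \<open>s_0\<close> flips the membership of the single number 1.\<close>

lemma negative_count_parity:
  assumes "w \<in> W_inf"
  shows "even (card {x. x > 0 \<and> w (reflection (Idx i) x) < 0}) \<longleftrightarrow>
    (if i = 0 then odd (card {x. x > 0 \<and> w x < 0}) else even (card {x. x > 0 \<and> w x < 0}))"
proof (cases "i = 0")
  case False
  have "{x. x > 0 \<and> w (reflection (Idx i) x) < 0} = reflection (Idx i) ` {x. x > 0 \<and> w x < 0}"
    (is "?L = ?R")
  proof
    show "?L \<subseteq> ?R"
    proof
      fix x assume x: "x \<in> ?L"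
      then have "reflection (Idx i) x > 0" using False by auto
      then have "reflection (Idx i) x \<in> {x. x > 0 \<and> w x < 0}" using x by simp
      then show "x \<in> ?R" by (metis imageI reflection_invol)
    qed
    show "?R \<subseteq> ?L"
    proof
      fix x assume "x \<in> ?R"
      then obtain y where y: "y > 0" "w y < 0" "x = reflection (Idx i) y" by auto
      then have "x > 0" using False by auto
      then show "x \<in> ?L" using y by (simp add: y(3) del: reflection_pos)
    qed
  qed
  moreover have "card (reflection (Idx i) ` {x. x > 0 \<and> w x < 0}) = card {x. x > 0 \<and> w x < 0}"
    by (intro card_image inj_on_subset[OF bij_is_inj[OF bij_reflection]]) simp
  ultimately show ?thesis using False by (simp del: reflection_pos)
next
  case True
  have w: "w (- 1) = - w 1" "bij w" "w 0 = 0" using assms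
    by (auto simp: W_inf_def dest: spec[of _ 0])
  have "w 1 \<noteq> 0" using bij_is_inj[OF w(2)] w(3) by (metis injD zero_neq_one)
  have "finite {x. w x \<noteq> x}" using assms by (simp add: W_inf_def)
  then have fin: "finite {x. x > 1 \<and> w x < 0}" by (rule rev_finite_subset) auto
  have a: "{x. x > 0 \<and> w (reflection (Idx i) x) < 0}
      = (if w 1 > 0 then insert 1 {x. x > 1 \<and> w x < 0} else {x. x > 1 \<and> w x < 0})"
    using True w by (auto split: if_splits)
  have b: "{x. x > 0 \<and> w x < 0} = (if w 1 > 0 then {x. x > 1 \<and> w x < 0} else insert 1 {x. x > 1 \<and> w x < 0})"
  proof (rule set_eqI)
    fix x show "x \<in> {x. x > 0 \<and> w x < 0} \<longleftrightarrow> x \<in> (if w 1 > 0 then {x. x > 1 \<and> w x < 0} else insert 1 {x. x > 1 \<and> w x < 0})"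
      using \<open>w 1 \<noteq> 0\<close> by (cases "x = 1") auto
  qed
  show ?thesis unfolding a b using True fin by (auto simp: card_insert_if)
qed

lemma W_inf'_comp_Idx:
  assumes "w \<in> W_inf"
  shows "w \<circ> reflection (Idx i) \<in> W_inf' \<longleftrightarrow> (if i = 0 then w \<notin> W_inf' else w \<in> W_inf')"
  using negative_count_parity[OF assms, of i] assms W_inf_comp_reflection[OF assms, of "Idx i"]
  by (auto simp: W_inf'_def simp del: reflection_pos reflection_0)

lemma reflection_Hat1_eq:
  "reflection Hat1 = reflection (Idx 0) \<circ> reflection (Idx 1) \<circ> reflection (Idx 0)"
  by (simp add: reflection_def)

lemma W_inf'_comp_reflection:
  assumes "w \<in> W_inf'" "i \<in> index_set TypeD"
  shows "w \<circ> reflection i \<in> W_inf'"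
proof -
  have w: "w \<in> W_inf" using assms by (simp add: W_inf'_def)
  show ?thesis
  proof (cases i)
    case (Idx j)
    then show ?thesis using W_inf'_comp_Idx[OF w, of j] assms by auto
  next
    case Hat1
    let ?v = "w \<circ> reflection (Idx 0)"
    have v: "?v \<in> W_inf" "?v \<circ> reflection (Idx 1) \<in> W_inf"
      using w W_inf_comp_reflection by blast+
    have "?v \<circ> reflection (Idx 1) \<circ> reflection (Idx 0) \<in> W_inf'"
      using W_inf'_comp_Idx[OF w, of 0] W_inf'_comp_Idx[OF v(1), of 1] W_inf'_comp_Idx[OF v(2), of 0]
        assms(1) by simp
    then show ?thesis by (simp add: Hat1 reflection_Hat1_eq comp_assoc)
  qed
qed

lemma reflection_0_commute:
  "j \<ge> 2 \<Longrightarrow> reflection (Idx 0) \<circ> reflection (Idx j) = reflection (Idx j) \<circ> reflection (Idx 0)"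
  by (rule ext) auto

text \<open>A letter \<open>s_0\<close> is pushed to the right end: it passes \<open>s_j\<close> for
  j >= 2, turns \<open>s_1\<close> into \<open>Hat1\<close>, and cancels against another
  \<open>s_0\<close>. For elements of \<open>W_inf'\<close> the parity of sign changes then excludes
  a leftover \<open>s_0\<close>.\<close>

lemma words_B_to_D:
  "\<exists>js \<in> lists (index_set TypeD). wprod (map Idx is) = wprod js
     \<or> wprod (map Idx is) = wprod js \<circ> reflection (Idx 0)"
proof (induction "is" rule: rev_induct)
  case Nil
  then show ?case by (intro bexI[of _ "[]"]) auto
next
  case (snoc i "is")
  then obtain js where js: "js \<in> lists (index_set TypeD)" and
    disj: "wprod (map Idx is) = wprod js \<or> wprod (map Idx is) = wprod js \<circ> reflection (Idx 0)" by blast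
  have eq: "wprod (map Idx (is @ [i])) = wprod (map Idx is) \<circ> reflection (Idx i)"
    by (simp add: wprod_append)
  from disj show ?case
  proof
    assume a: "wprod (map Idx is) = wprod js"
    show ?thesis
    proof (cases "i = 0")
      case True
      then show ?thesis using js a eq by (intro bexI[of _ js]) auto
    next
      case False
      then show ?thesis using js a eq by (intro bexI[of _ "js @ [Idx i]"]) (auto simp: wprod_append)
    qed
  next
    assume a: "wprod (map Idx is) = wprod js \<circ> reflection (Idx 0)"
    consider "i = 0" | "i = 1" | "i \<ge> 2" by linarith
    then show ?thesis
    proof cases
      case 1
      then have "wprod (map Idx (is @ [i])) = wprod js \<circ> (reflection (Idx 0) \<circ> reflection (Idx 0))"
        unfolding eq a by (simp add: comp_assoc del: reflection_comp_self)
      then show ?thesis using js by (intro bexI[of _ js]) auto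
    next
      case 2
      have "wprod (js @ [Hat1]) \<circ> reflection (Idx 0) = wprod js \<circ> (reflection (Idx 0) \<circ> reflection (Idx 1)
          \<circ> (reflection (Idx 0) \<circ> reflection (Idx 0)))"
        by (simp add: wprod_append comp_assoc reflection_Hat1_eq del: reflection_comp_self)
      then have "wprod (map Idx (is @ [i])) = wprod (js @ [Hat1]) \<circ> reflection (Idx 0)"
        unfolding eq a by (simp add: 2 comp_assoc)
      then show ?thesis using js by (intro bexI[of _ "js @ [Hat1]"]) auto
    next
      case 3
      have "wprod (map Idx (is @ [i])) = wprod (js @ [Idx i]) \<circ> reflection (Idx 0)"
        unfolding eq a using reflection_0_commute[OF 3] by (simp add: wprod_append comp_assoc)
      then show ?thesis using js 3 by (intro bexI[of _ "js @ [Idx i]"]) auto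
    qed
  qed
qed

lemma wprod_in_W_inf': "is \<in> lists (index_set TypeD) \<Longrightarrow> wprod is \<in> W_inf'"
proof (induction "is" rule: rev_induct)
  case Nil
  have e: "{i::int. i > 0 \<and> id i < 0} = {}" by auto
  have "id \<in> W_inf" using wprod_in_W_inf[of "[]"] unfolding wprod_Nil .
  then show ?case unfolding wprod_Nil W_inf'_def mem_Collect_eq e by (intro conjI) simp_all
next
  case (snoc i "is")
  then have "is \<in> lists (index_set TypeD)" "i \<in> index_set TypeD" by simp_all
  then show ?case using snoc.IH W_inf'_comp_reflection
    by (simp only: wprod_append wprod_Cons wprod_Nil comp_id)
qed

lemma Weyl_group_words: "Weyl_group Y = wprod ` lists (index_set Y)"
proof (cases Y)
  case TypeD
  have "W_inf' \<subseteq> wprod ` lists (index_set TypeD)"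
  proof
    fix w assume w: "w \<in> W_inf'"
    then have "w \<in> W_inf" by (simp add: W_inf'_def)
    then obtain "is" where "w = wprod (map Idx is)"
      using W_inf_words by (metis (no_types, opaque_lifting) W_inf_bound W_inf_generated)
    with words_B_to_D[of "is"] obtain js where js: "js \<in> lists (index_set TypeD)"
      and disj: "w = wprod js \<or> w = wprod js \<circ> reflection (Idx 0)" by metis
    have "w \<noteq> wprod js \<circ> reflection (Idx 0)"
      using w W_inf'_comp_Idx[OF wprod_in_W_inf, of js 0] wprod_in_W_inf'[OF js] by auto
    with disj js show "w \<in> wprod ` lists (index_set TypeD)" by blast
  qed
  then show ?thesis using TypeD wprod_in_W_inf' by auto
qed (use W_inf_words in auto)

lemma wprod_in_Weyl: "set is \<subseteq> index_set Y \<Longrightarrow> wprod is \<in> Weyl_group Y"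
  unfolding Weyl_group_words by auto

lemma id_in_Weyl [simp]: "id \<in> Weyl_group Y"
  using wprod_in_Weyl[of "[]" Y] by simp

lemma reflection_in_Weyl [simp]: "i \<in> index_set Y \<Longrightarrow> reflection i \<in> Weyl_group Y"
  using wprod_in_Weyl[of "[i]" Y] by simp

lemma comp_in_Weyl: "u \<in> Weyl_group Y \<Longrightarrow> v \<in> Weyl_group Y \<Longrightarrow> u \<circ> v \<in> Weyl_group Y"
  unfolding Weyl_group_words
  by (elim imageE) (simp only: wprod_append[symmetric] imageI append_in_lists_conv)

lemma inv_in_Weyl: "u \<in> Weyl_group Y \<Longrightarrow> inv u \<in> Weyl_group Y"
  unfolding Weyl_group_words by (auto simp: inv_wprod)

lemma bij_Weyl: "u \<in> Weyl_group Y \<Longrightarrow> bij u"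
  unfolding Weyl_group_words using bij_wprod by auto

lemma Weyl_subset_W_inf: "u \<in> Weyl_group Y \<Longrightarrow> u \<in> W_inf"
  by (cases Y) (auto simp: W_inf'_def)

subsection \<open>Length\<close>

definition reduced :: "lie_type \<Rightarrow> index list \<Rightarrow> bool" where
  "reduced Y is \<longleftrightarrow> set is \<subseteq> index_set Y \<and> length is = len Y (wprod is)"

lemma len_alt: "len Y w = (LEAST n. \<exists>is. length is = n \<and> set is \<subseteq> index_set Y \<and> w = wprod is)"
  by (simp add: len_def wprod_def)

lemma len_wprod_le: "set is \<subseteq> index_set Y \<Longrightarrow> len Y (wprod is) \<le> length is"
  unfolding len_alt by (rule Least_le) blast

lemma reduced_word:
  assumes "w \<in> Weyl_group Y" obtains "is" where "reduced Y is" "wprod is = w"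
proof -
  let ?P = "\<lambda>n. \<exists>is. length is = n \<and> set is \<subseteq> index_set Y \<and> w = wprod is"
  obtain js where "set js \<subseteq> index_set Y" "w = wprod js"
    using assms unfolding Weyl_group_words by auto
  then have "?P (length js)" by blast
  then have "?P (len Y w)" unfolding len_alt by (rule LeastI)
  then show ?thesis using that unfolding reduced_def by metis
qed

lemma len_id [simp]: "len Y id = 0"
  using len_wprod_le[of "[]" Y] by simp

lemma len_eq_0_iff: "w \<in> Weyl_group Y \<Longrightarrow> len Y w = 0 \<longleftrightarrow> w = id"
  by (metis len_id length_0_conv reduced_def reduced_word wprod_Nil)

lemma len_comp_le:
  assumes "u \<in> Weyl_group Y" "v \<in> Weyl_group Y" shows "len Y (u \<circ> v) \<le> len Y u + len Y v"
proof -
  obtain "is" js where "reduced Y is" "wprod is = u" "reduced Y js" "wprod js = v"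
    using assms reduced_word by metis
  then show ?thesis using len_wprod_le[of "is @ js" Y] by (auto simp: reduced_def wprod_append)
qed

lemma len_reflection: "i \<in> index_set Y \<Longrightarrow> len Y (reflection i) = 1"
  using len_wprod_le[of "[i]" Y] len_eq_0_iff[of "reflection i" Y] by fastforce

lemma len_inv_le: "w \<in> Weyl_group Y \<Longrightarrow> len Y (inv w) \<le> len Y w"
  by (metis inv_wprod len_wprod_le length_rev reduced_def reduced_word set_rev)

lemma len_inv: "w \<in> Weyl_group Y \<Longrightarrow> len Y (inv w) = len Y w"
  by (metis bij_Weyl inv_in_Weyl inv_inv_eq le_antisym len_inv_le)

lemma comp_reflection_cancel: "w \<circ> reflection i \<circ> reflection i = w"
  "reflection i \<circ> (reflection i \<circ> w) = w"
  by (auto simp: fun_eq_iff)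

lemma len_comp_reflection_le:
  assumes "w \<in> Weyl_group Y" "i \<in> index_set Y"
  shows "len Y w \<le> len Y (w \<circ> reflection i) + 1" "len Y w \<le> len Y (reflection i \<circ> w) + 1"
  using len_comp_le[of "w \<circ> reflection i" Y "reflection i"] len_comp_le[of "reflection i" Y "reflection i \<circ> w"]
  by (simp_all add: assms comp_in_Weyl len_reflection comp_reflection_cancel)

subsection \<open>Parabolic subsets\<close>

lemma reduced_append:
  assumes "reduced Y is" "reduced Y js"
    "len Y (wprod is \<circ> wprod js) = len Y (wprod is) + len Y (wprod js)"
  shows "reduced Y (is @ js)"
  using assms by (auto simp: reduced_def wprod_append)

text \<open>Quantifying over all reduced words lets length-additive factors inherit the bound by
  mere concatenation, without knowing that all reduced words of an element use the same
  letters.\<close>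

definition parabolic :: "lie_type \<Rightarrow> nat \<Rightarrow> (int \<Rightarrow> int) set" where
  "parabolic Y n = {w \<in> Weyl_group Y. \<forall>is. reduced Y is \<and> wprod is = w \<longrightarrow> (\<forall>i \<in> set is. level i < n)}"

lemma parabolic_mono: "m \<le> n \<Longrightarrow> w \<in> parabolic Y m \<Longrightarrow> w \<in> parabolic Y n"
  unfolding parabolic_def by force

text \<open>
  A reduced word with a letter far out omits some letter \<open>g\<close> moved by neither side; deleting all
  letters above \<open>g\<close> then yields a shorter word for the same element.
\<close>

lemma letters_bounded:
  assumes w: "w \<in> Weyl_group Y" and n: "\<And>x. \<bar>x\<bar> > int n \<Longrightarrow> w x = x" and "n \<ge> 2"
  shows "w \<in> parabolic Y (n + len Y w)"
  unfolding parabolic_def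
proof (clarsimp simp: w)
  fix "is" i assume red: "reduced Y is" and i: "i \<in> set is" and w_def: "w = wprod is"
  show "level i < n + len Y (wprod is)"
  proof (rule ccontr)
    assume far: "\<not> ?thesis"
    let ?l = "len Y (wprod is)"
    have len: "length is = ?l" using red by (simp add: reduced_def)
    \<comment> \<open>Pigeonhole: if every level from \<open>n\<close> up to that of
      \<open>i\<close> occurred, the word would have more letters than its length allows.\<close>
    have "\<exists>g \<in> {n..<level i}. g \<notin> level ` set is"
    proof (rule ccontr)
      assume "\<not> ?thesis"
      then have "insert (level i) {n..<level i} \<subseteq> level ` set is" using i by auto
      then have "card (insert (level i) {n..<level i}) \<le> card (level ` set is)"
        by (intro card_mono) auto
      also have "\<dots> \<le> ?l" by (metis card_image_le card_length dual_order.trans finite_set len)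
      finally show False using far by simp
    qed
    then obtain g where g: "n \<le> g" "g < level i" "g \<notin> level ` set is" by auto
    let ?js = "filter (\<lambda>i. level i < g) is"
    have agree: "wprod js x = wprod (filter (\<lambda>i. level i < g) js) x \<and> \<bar>wprod js x\<bar> \<le> int g"
      if "\<bar>x\<bar> \<le> int g" "g \<notin> level ` set js" for x js
      using that(2)
    proof (induction js)
      case (Cons j js)
      then have "level j < g \<or> g < level j" by auto
      then show ?case
      proof
        assume "level j < g"
        then show ?thesis using Cons reflection_le[of j g "wprod js x"] by auto
      next
        assume "g < level j"
        then show ?thesis using Cons reflection_id_below[of g j "wprod js x"] g \<open>n \<ge> 2\<close> by auto
      qed
    qed (use that in auto)
    have above: "wprod (filter (\<lambda>i. level i < g) js) x = x" if "\<bar>x\<bar> > int g" for x js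
      using that by (induction js) (auto simp: reflection_id_above)
    have "wprod ?js = wprod is"
    proof
      fix x show "wprod ?js x = wprod is x"
      proof (cases "\<bar>x\<bar> \<le> int g")
        case True
        then show ?thesis using agree[of x "is"] g by simp
      next
        case False
        then show ?thesis using above[of x "is"] n[of x] g unfolding w_def by simp
      qed
    qed
    moreover have "set ?js \<subseteq> index_set Y" using red by (auto simp: reduced_def)
    ultimately have "?l \<le> length ?js" by (metis len_wprod_le)
    moreover have "length ?js < length is" using i g by (intro length_filter_less[of i]) auto
    ultimately show False using len by simp
  qed
qed

lemma parabolic_exhaust: "w \<in> Weyl_group Y \<Longrightarrow> \<exists>n. w \<in> parabolic Y n"
proof -
  assume w: "w \<in> Weyl_group Y"
  then obtain n where "\<And>x. \<bar>x\<bar> > int n \<Longrightarrow> w x = x"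
    using W_inf_bound Weyl_subset_W_inf by metis
  then have "w \<in> parabolic Y ((n + 2) + len Y w)" using w by (intro letters_bounded) auto
  then show ?thesis ..
qed

definition factorizations :: "lie_type \<Rightarrow> (int \<Rightarrow> int) \<Rightarrow> ((int \<Rightarrow> int) \<times> (int \<Rightarrow> int)) set" where
  "factorizations Y w = {(u, v). u \<in> Weyl_group Y \<and> v \<in> Weyl_group Y \<and> u \<circ> v = w \<and> len Y u + len Y v = len Y w}"

text \<open>Consequently the elements whose coefficients vanish on \<open>parabolic Y n\<close> form
  an ideal, which is what truncation needs.\<close>

lemma factorizations_parabolic:
  assumes "(u, v) \<in> factorizations Y w" "w \<in> parabolic Y n"
  shows "u \<in> parabolic Y n" "v \<in> parabolic Y n"
proof -
  have u: "u \<in> Weyl_group Y" and v: "v \<in> Weyl_group Y" and uv: "u \<circ> v = w"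
    "len Y u + len Y v = len Y w" using assms by (auto simp: factorizations_def)
  have *: "\<forall>i \<in> set is \<union> set js. level i < n" if "reduced Y is" "wprod is = u" "reduced Y js" "wprod js = v" for "is" js
  proof -
    have "reduced Y (is @ js)" using that uv by (intro reduced_append) auto
    moreover have "wprod (is @ js) = w" using that uv by (simp add: wprod_append)
    ultimately show ?thesis using assms(2) by (force simp: parabolic_def)
  qed
  show "u \<in> parabolic Y n" using * u reduced_word[OF v] by (auto simp: parabolic_def) (metis Un_iff)
  show "v \<in> parabolic Y n" using * v reduced_word[OF u] by (auto simp: parabolic_def) (metis Un_iff)
qed

text \<open>All factors are words of bounded length in an alphabet made finite by
  \<open>parabolic_exhaust\<close>.\<close>

lemma finite_factorizations [simp]: "finite (factorizations Y w)"
proof (cases "w \<in> Weyl_group Y")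
  case True
  then obtain n where n: "w \<in> parabolic Y n" using parabolic_exhaust by blast
  let ?L = "{is. set is \<subseteq> insert Hat1 (Idx ` {..<n}) \<and> length is \<le> len Y w}"
  have fin: "finite ?L" by (rule finite_lists_length_le) simp
  have "x \<in> wprod ` ?L" if "x \<in> parabolic Y n" "len Y x \<le> len Y w" for x
  proof -
    have "x \<in> Weyl_group Y" using that by (simp add: parabolic_def)
    then obtain "is" where "is": "reduced Y is" "wprod is = x" by (rule reduced_word)
    then have "\<forall>i \<in> set is. level i < n" using that by (auto simp: parabolic_def)
    then have "set is \<subseteq> insert Hat1 (Idx ` {..<n})" by (auto) (metis imageI level.elims lessThan_iff)
    moreover have "length is \<le> len Y w" using "is" that by (simp add: reduced_def)
    ultimately show ?thesis using "is" by blast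
  qed
  then have "factorizations Y w \<subseteq> (wprod ` ?L) \<times> (wprod ` ?L)"
    using factorizations_parabolic[OF _ n] by (force simp: factorizations_def)
  then show ?thesis using fin by (meson finite_SigmaI finite_imageI finite_subset)
next
  case False
  then have "factorizations Y w = {}" using comp_in_Weyl by (auto simp: factorizations_def)
  then show ?thesis by simp
qed

section \<open>The completed nilCoxeter ring\<close>

text \<open>
  One type serves all three Weyl groups: an element is a family of functions on \<open>W\<close>, one for each
  Lie type, so the ring is a product of three rings.  The product only involves length-additive
  factorizations, which is what makes it associative.
\<close>

typedef (overloaded) 'a nilcox =
  "{f :: lie_type \<Rightarrow> (int \<Rightarrow> int) \<Rightarrow> 'a :: zero. \<forall>Y w. w \<notin> Weyl_group Y \<longrightarrow> f Y w = 0}"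
  morphisms ncoeff Abs_nilcox
  by (rule exI[of _ "\<lambda>_ _. 0"]) simp

definition mk_nilcox :: "(lie_type \<Rightarrow> (int \<Rightarrow> int) \<Rightarrow> 'a) \<Rightarrow> 'a :: zero nilcox" where
  "mk_nilcox f = Abs_nilcox (\<lambda>Y w. if w \<in> Weyl_group Y then f Y w else 0)"

lemma ncoeff_mk_nilcox: "ncoeff (mk_nilcox f) Y w = (if w \<in> Weyl_group Y then f Y w else 0)"
  unfolding mk_nilcox_def by (subst Abs_nilcox_inverse) auto

lemma ncoeff_mk_nilcox_in [simp]: "w \<in> Weyl_group Y \<Longrightarrow> ncoeff (mk_nilcox f) Y w = f Y w"
  by (simp add: ncoeff_mk_nilcox)

lemma ncoeff_outside: "w \<notin> Weyl_group Y \<Longrightarrow> ncoeff F Y w = 0"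
  using ncoeff[of F] by simp

lemma nilcox_eqI: "(\<And>Y w. w \<in> Weyl_group Y \<Longrightarrow> ncoeff F Y w = ncoeff G Y w) \<Longrightarrow> F = G"
  by (metis ncoeff_inject ncoeff_outside ext)

lemma factsD:
  "(u, v) \<in> factorizations Y w \<Longrightarrow> u \<in> Weyl_group Y \<and> v \<in> Weyl_group Y \<and> u \<circ> v = w \<and> len Y u + len Y v = len Y w"
  by (simp add: factorizations_def)

text \<open>The lengths of a, b, c add up to that of \<open>w\<close>, so both uses of
  subadditivity, for b c and for a (b c), must be equalities.\<close>

lemma factorizations_assoc:
  assumes "(p, c) \<in> factorizations Y w" "(a, b) \<in> factorizations Y p"
  shows "(a, b \<circ> c) \<in> factorizations Y w" "(b, c) \<in> factorizations Y (b \<circ> c)"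
  using assms len_comp_le[of b Y c] len_comp_le[of a Y "b \<circ> c"] comp_in_Weyl[of b Y c]
  by (auto simp: factorizations_def comp_assoc)

lemma factorizations_assoc':
  assumes "(a, q) \<in> factorizations Y w" "(b, c) \<in> factorizations Y q"
  shows "(a \<circ> b, c) \<in> factorizations Y w" "(a, b) \<in> factorizations Y (a \<circ> b)"
  using assms len_comp_le[of a Y b] len_comp_le[of "a \<circ> b" Y c] comp_in_Weyl[of a Y b]
  by (auto simp: factorizations_def comp_assoc)

lemma factorizations_id: "factorizations Y id = {(id, id)}"
  by (auto simp: factorizations_def len_eq_0_iff)

text \<open>Both sides run over the triples (a, b, c) with product \<open>w\<close> and additive
  lengths, bracketed in the two possible ways.\<close>

lemma sum_factorizations_assoc:
  fixes f :: "_ \<Rightarrow> _ \<Rightarrow> _ \<Rightarrow> 'b :: comm_monoid_add"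
  shows "(\<Sum>(p, c) \<in> factorizations Y w. \<Sum>(a, b) \<in> factorizations Y p. f a b c)
    = (\<Sum>(a, q) \<in> factorizations Y w. \<Sum>(b, c) \<in> factorizations Y q. f a b c)"
proof -
  have "(\<Sum>(p, c) \<in> factorizations Y w. \<Sum>(a, b) \<in> factorizations Y p. f a b c)
      = (\<Sum>(p, q) \<in> (SIGMA p : factorizations Y w. factorizations Y (fst p)). f (fst q) (snd q) (snd p))"
    by (subst sum.Sigma[symmetric]) (auto simp: case_prod_unfold)
  also have "\<dots> = (\<Sum>(p, q) \<in> (SIGMA p : factorizations Y w. factorizations Y (snd p)). f (fst p) (fst q) (snd q))"
    by (rule sum.reindex_bij_witness[where
          i = "\<lambda>(p, q). ((fst p \<circ> fst q, snd q), (fst p, fst q))" and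
          j = "\<lambda>(p, q). ((fst q, snd q \<circ> snd p), (snd q, snd p))"])
      (auto simp: comp_assoc dest: factsD intro: factorizations_assoc factorizations_assoc')
  also have "\<dots> = (\<Sum>(a, q) \<in> factorizations Y w. \<Sum>(b, c) \<in> factorizations Y q. f a b c)"
    by (subst sum.Sigma[symmetric]) (auto simp: case_prod_unfold)
  finally show ?thesis .
qed

instantiation nilcox :: (comm_ring_1) ring_1
begin

definition zero_nilcox :: "'a nilcox" where "0 = mk_nilcox (\<lambda>_ _. 0)"

definition one_nilcox :: "'a nilcox" where "1 = mk_nilcox (\<lambda>_ w. if w = id then 1 else 0)"

definition plus_nilcox :: "'a nilcox \<Rightarrow> 'a nilcox \<Rightarrow> 'a nilcox" where
  "F + G = mk_nilcox (\<lambda>Y w. ncoeff F Y w + ncoeff G Y w)"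

definition uminus_nilcox :: "'a nilcox \<Rightarrow> 'a nilcox" where
  "- F = mk_nilcox (\<lambda>Y w. - ncoeff F Y w)"

definition minus_nilcox :: "'a nilcox \<Rightarrow> 'a nilcox \<Rightarrow> 'a nilcox" where
  "F - G = mk_nilcox (\<lambda>Y w. ncoeff F Y w - ncoeff G Y w)"

definition times_nilcox :: "'a nilcox \<Rightarrow> 'a nilcox \<Rightarrow> 'a nilcox" where
  "F * G = mk_nilcox (\<lambda>Y w. \<Sum>(u, v) \<in> factorizations Y w. ncoeff F Y u * ncoeff G Y v)"

instance
proof
  fix F G H :: "'a nilcox"
  note defs = zero_nilcox_def one_nilcox_def plus_nilcox_def uminus_nilcox_def
    minus_nilcox_def times_nilcox_def
  show "F + G + H = F + (G + H)" by (rule nilcox_eqI) (simp add: defs add.assoc)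
  show "F + G = G + F" by (simp add: defs add.commute)
  show "0 + F = F" by (rule nilcox_eqI) (simp add: defs)
  show "- F + F = 0" by (rule nilcox_eqI) (simp add: defs)
  show "F - G = F + - G" by (rule nilcox_eqI) (simp add: defs)
  have W: "(u, v) \<in> factorizations Y w \<Longrightarrow> u \<in> Weyl_group Y \<and> v \<in> Weyl_group Y" for u v w Y
    by (simp add: factorizations_def)
  show "(F + G) * H = F * H + G * H"
    by (rule nilcox_eqI)
      (auto simp: defs sum.distrib[symmetric] distrib_right case_prod_unfold dest: factsD intro!: sum.cong)
  show "F * (G + H) = F * G + F * H"
    by (rule nilcox_eqI)
      (auto simp: defs sum.distrib[symmetric] distrib_left case_prod_unfold dest: factsD intro!: sum.cong)
  show "(0 :: 'a nilcox) \<noteq> 1"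
  proof
    assume "(0 :: 'a nilcox) = 1"
    then have "ncoeff (0 :: 'a nilcox) TypeB id = ncoeff 1 TypeB id" by simp
    then show False by (simp add: defs del: Weyl_group.simps)
  qed
  show "1 * F = F"
  proof (rule nilcox_eqI)
    fix Y w assume w: "w \<in> Weyl_group Y"
    have "(\<Sum>(u, v) \<in> factorizations Y w. ncoeff 1 Y u * ncoeff F Y v) = (\<Sum>(u, v) \<in> {(id, w)}. ncoeff 1 Y u * ncoeff F Y v)"
      by (rule sum.mono_neutral_right) (use w in \<open>auto simp: defs len_eq_0_iff dest!: factsD split: if_splits\<close>, auto simp: factorizations_def w)
    then show "ncoeff (1 * F) Y w = ncoeff F Y w" using w by (simp add: defs)
  qed
  show "F * 1 = F"
  proof (rule nilcox_eqI)
    fix Y w assume w: "w \<in> Weyl_group Y"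
    have "(\<Sum>(u, v) \<in> factorizations Y w. ncoeff F Y u * ncoeff 1 Y v) = (\<Sum>(u, v) \<in> {(w, id)}. ncoeff F Y u * ncoeff 1 Y v)"
      by (rule sum.mono_neutral_right) (use w in \<open>auto simp: defs len_eq_0_iff dest!: factsD split: if_splits\<close>, auto simp: factorizations_def w)
    then show "ncoeff (F * 1) Y w = ncoeff F Y w" using w by (simp add: defs)
  qed
  show "F * G * H = F * (G * H)"
  proof (rule nilcox_eqI)
    fix Y w assume w: "w \<in> Weyl_group Y"
    have "ncoeff (F * G * H) Y w
        = (\<Sum>(p, c) \<in> factorizations Y w. \<Sum>(a, b) \<in> factorizations Y p. ncoeff F Y a * ncoeff G Y b * ncoeff H Y c)"
      using w by (auto simp: defs sum_distrib_right case_prod_unfold intro!: sum.cong dest: W)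
    also have "\<dots> = (\<Sum>(a, q) \<in> factorizations Y w. \<Sum>(b, c) \<in> factorizations Y q. ncoeff F Y a * ncoeff G Y b * ncoeff H Y c)"
      by (rule sum_factorizations_assoc)
    also have "\<dots> = ncoeff (F * (G * H)) Y w"
      using w by (auto simp: defs sum_distrib_left case_prod_unfold mult.assoc intro!: sum.cong dest: W)
    finally show "ncoeff (F * G * H) Y w = ncoeff (F * (G * H)) Y w" .
  qed
qed

end

lemma ncoeff_zero [simp]: "ncoeff 0 Y w = 0"
  by (simp add: zero_nilcox_def ncoeff_mk_nilcox)

lemma ncoeff_one: "ncoeff 1 Y w = (if w = id then 1 else 0)"
  by (simp add: one_nilcox_def ncoeff_mk_nilcox)

lemma ncoeff_plus [simp]: "ncoeff (F + G) Y w = ncoeff F Y w + ncoeff G Y w"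
  by (simp add: plus_nilcox_def ncoeff_mk_nilcox ncoeff_outside)

lemma ncoeff_times: "w \<in> Weyl_group Y \<Longrightarrow> ncoeff (F * G) Y w = (\<Sum>(u, v) \<in> factorizations Y w. ncoeff F Y u * ncoeff G Y v)"
  by (simp add: times_nilcox_def)

lemma ncoeff_times_id: "ncoeff (F * G) Y id = ncoeff F Y id * ncoeff G Y id"
  by (simp add: ncoeff_times factorizations_id)

lemma ncoeff_sum [simp]: "ncoeff (sum f A) Y w = (\<Sum>x\<in>A. ncoeff (f x) Y w)"
  by (induction A rule: infinite_finite_induct) simp_all

definition smul :: "'a :: comm_ring_1 \<Rightarrow> 'a nilcox \<Rightarrow> 'a nilcox" where
  "smul a F = mk_nilcox (\<lambda>Y w. a * ncoeff F Y w)"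

lemma ncoeff_smul [simp]: "ncoeff (smul a F) Y w = a * ncoeff F Y w"
  by (simp add: smul_def ncoeff_mk_nilcox ncoeff_outside)

lemma smul_mult_left [simp]: "smul a F * G = smul a (F * G)"
  by (rule nilcox_eqI) (simp add: ncoeff_times sum_distrib_left case_prod_unfold mult_ac)

lemma smul_mult_right [simp]: "F * smul a G = smul a (F * G)"
  by (rule nilcox_eqI) (simp add: ncoeff_times sum_distrib_left case_prod_unfold mult_ac)

lemma smul_smul [simp]: "smul a (smul b F) = smul (a * b) F"
  by (rule nilcox_eqI) (simp add: mult_ac)

lemma smul_zero [simp]: "smul a 0 = 0" "smul 0 F = 0"
  by (rule nilcox_eqI; simp)+

lemma smul_add_right: "smul a (F + G) = smul a F + smul a G"
  by (rule nilcox_eqI) (simp add: distrib_left)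

section \<open>The generators u_i and products along words\<close>

definition gen :: "index \<Rightarrow> 'a :: comm_ring_1 nilcox" where
  "gen i = mk_nilcox (\<lambda>Y w. if i \<in> index_set Y \<and> w = reflection i then 1 else 0)"

lemma ncoeff_gen: "ncoeff (gen i) Y w = (if i \<in> index_set Y \<and> w = reflection i then 1 else 0)"
  by (auto simp: gen_def ncoeff_mk_nilcox)

text \<open>\<open>len Y w\<close> exceeds the length of \<open>reflection i \<circ> w\<close> by at
  most one, so being shorter already makes the factorization length-additive. Left multiplication by
  \<open>u_i\<close> thus encodes the right-hand side of the recursion for \<delta>, case
  distinction included; its mirror image does the same for \<partial>.\<close>

lemma ncoeff_gen_mult:
  assumes w: "w \<in> Weyl_group Y"
  shows "ncoeff (gen i * F) Y w = (if i \<in> index_set Y \<and> len Y (reflection i \<circ> w) < len Y w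
    then ncoeff F Y (reflection i \<circ> w) else 0)"
proof -
  have "ncoeff (gen i * F) Y w = (\<Sum>(u, v) \<in> factorizations Y w \<inter> {(reflection i, reflection i \<circ> w)}. ncoeff (gen i) Y u * ncoeff F Y v)"
    unfolding ncoeff_times[OF w]
    by (rule sum.mono_neutral_right) (auto simp: ncoeff_gen comp_reflection_cancel comp_assoc[symmetric] dest: factsD split: if_splits)
  also have "\<dots> = (if i \<in> index_set Y \<and> len Y (reflection i \<circ> w) < len Y w
    then ncoeff F Y (reflection i \<circ> w) else 0)"
  proof (cases "i \<in> index_set Y")
    case True
    then have "(reflection i, reflection i \<circ> w) \<in> factorizations Y w \<longleftrightarrow> len Y (reflection i \<circ> w) < len Y w"
      using w len_comp_reflection_le(2)[OF w True]
      by (auto simp: factorizations_def comp_in_Weyl comp_reflection_cancel len_reflection)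
    with True show ?thesis by (auto simp: ncoeff_gen)
  next
    case False
    then show ?thesis by (intro trans[OF sum.neutral]) (auto simp: ncoeff_gen)
  qed
  finally show ?thesis .
qed

lemma ncoeff_mult_gen:
  assumes w: "w \<in> Weyl_group Y"
  shows "ncoeff (F * gen i) Y w = (if i \<in> index_set Y \<and> len Y (w \<circ> reflection i) < len Y w
    then ncoeff F Y (w \<circ> reflection i) else 0)"
proof -
  have "ncoeff (F * gen i) Y w = (\<Sum>(u, v) \<in> factorizations Y w \<inter> {(w \<circ> reflection i, reflection i)}. ncoeff F Y u * ncoeff (gen i) Y v)"
    unfolding ncoeff_times[OF w]
    by (rule sum.mono_neutral_right) (auto simp: ncoeff_gen comp_reflection_cancel comp_assoc[symmetric] dest: factsD split: if_splits)
  also have "\<dots> = (if i \<in> index_set Y \<and> len Y (w \<circ> reflection i) < len Y w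
    then ncoeff F Y (w \<circ> reflection i) else 0)"
  proof (cases "i \<in> index_set Y")
    case True
    then have "(w \<circ> reflection i, reflection i) \<in> factorizations Y w \<longleftrightarrow> len Y (w \<circ> reflection i) < len Y w"
      using w len_comp_reflection_le(1)[OF w True]
      by (auto simp: factorizations_def comp_in_Weyl comp_reflection_cancel len_reflection)
    with True show ?thesis by (auto simp: ncoeff_gen)
  next
    case False
    then show ?thesis by (intro trans[OF sum.neutral]) (auto simp: ncoeff_gen)
  qed
  finally show ?thesis .
qed

text \<open>Peel off the first letter: the bounds \<open>len Y v \<le> length is\<close>, for the
  product of the tail, and \<open>len Y w \<le> len Y v + 1\<close> are both equalities exactly when
  the longer word is reduced.\<close>

lemma ncoeff_gen_word:
  assumes "w \<in> Weyl_group Y"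
  shows "(ncoeff (prod_list (map gen is)) Y w :: 'a :: comm_ring_1) = (if set is \<subseteq> index_set Y \<and> w = wprod is \<and> len Y w = length is then 1 else 0)"
  using assms
proof (induction "is" arbitrary: w)
  case Nil
  then show ?case by (auto simp: ncoeff_one)
next
  case (Cons i "is")
  show ?case
  proof (cases "i \<in> index_set Y \<and> set is \<subseteq> index_set Y")
    case False
    show ?thesis
    proof (cases "i \<in> index_set Y")
      case True
      with False have "\<not> set is \<subseteq> index_set Y" by blast
      moreover have "reflection i \<circ> w \<in> Weyl_group Y" using True Cons.prems by (simp add: comp_in_Weyl)
      ultimately show ?thesis using Cons.IH[of "reflection i \<circ> w"] Cons.prems by (simp only: list.map prod_list.Cons ncoeff_gen_mult) simp
    next
      case False
      then show ?thesis using Cons.prems by (simp add: ncoeff_gen_mult)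
    qed
  next
    case True
    define v where "v = reflection i \<circ> w"
    have "v \<in> Weyl_group Y" unfolding v_def using True Cons.prems by (simp add: comp_in_Weyl)
    moreover have "w = wprod (i # is) \<longleftrightarrow> v = wprod is"
      unfolding v_def wprod_Cons by (metis comp_reflection_cancel(2))
    moreover have "len Y (wprod is) \<le> length is" using True by (simp add: len_wprod_le)
    moreover have "len Y w \<le> len Y v + 1"
      unfolding v_def using len_comp_reflection_le(2) True Cons.prems by blast
    moreover have "(ncoeff (prod_list (map gen (i # is))) Y w :: 'a) =
      (if i \<in> index_set Y \<and> len Y v < len Y w then ncoeff (prod_list (map gen is)) Y v else 0)"
      unfolding v_def by (simp only: list.map prod_list.Cons ncoeff_gen_mult[OF Cons.prems])
    ultimately show ?thesis using True Cons.IH[of v] by (auto simp del: wprod_Cons prod_list.Cons list.map)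
  qed
qed

text \<open>
  Equal group elements give equal monomials whether or not the words are reduced, so the braid
  relations need no knowledge of lengths.
\<close>

lemma gen_word_cong:
  assumes "wprod is = wprod js" "set is = set js" "length is = length js"
  shows "prod_list (map gen is) = (prod_list (map gen js) :: 'a :: comm_ring_1 nilcox)"
  by (rule nilcox_eqI) (simp add: ncoeff_gen_word assms)

lemma gen_sq [simp]: "gen i * gen i = (0 :: 'a :: comm_ring_1 nilcox)"
  proof (rule nilcox_eqI)
  fix Y w assume "w \<in> Weyl_group Y"
  then have "(ncoeff (gen i * gen i) Y w :: 'a) = (if i \<in> index_set Y \<and> w = id \<and> len Y w = Suc (Suc 0) then 1 else 0)"
    using ncoeff_gen_word[of w Y "[i, i]"] by simp
  then show "(ncoeff (gen i * gen i) Y w :: 'a) = ncoeff 0 Y w" by (cases "w = id") simp_all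
qed

section \<open>The elements 1 + a u_i and their Yang-Baxter equations\<close>

definition h_elem :: "index \<Rightarrow> 'a :: comm_ring_1 \<Rightarrow> 'a nilcox" where
  "h_elem i a = 1 + smul a (gen i)"

lemma h_elem_add: "h_elem i a * h_elem i b = h_elem i (a + b)"
  by (rule nilcox_eqI) (simp add: h_elem_def distrib_left distrib_right add_ac)

lemma h_elem_zero [simp]: "h_elem i 0 = 1"
  by (simp add: h_elem_def)

lemma h_elem_add_left: "h_elem i a * (h_elem i b * F) = h_elem i (a + b) * F"
  by (simp add: mult.assoc[symmetric] h_elem_add)

definition braid2 :: "index \<Rightarrow> index \<Rightarrow> bool" where
  "braid2 i j \<longleftrightarrow> reflection i \<circ> reflection j = reflection j \<circ> reflection i"

definition braid3 :: "index \<Rightarrow> index \<Rightarrow> bool" where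
  "braid3 i j \<longleftrightarrow> reflection i \<circ> reflection j \<circ> reflection i = reflection j \<circ> reflection i \<circ> reflection j"

lemma h_elem_commute:
  assumes "braid2 i j"
  shows "h_elem i a * h_elem j b = h_elem j b * (h_elem i a :: 'a :: comm_ring_1 nilcox)"
proof -
  have "gen i * gen j = (gen j * gen i :: 'a nilcox)"
    using gen_word_cong[of "[i, j]" "[j, i]"] assms by (auto simp: braid2_def)
  then show ?thesis
    by (intro nilcox_eqI) (simp add: h_elem_def distrib_left distrib_right algebra_simps)
qed

text \<open>The parameters are additive along the positive roots of A_2. As
  \<open>u_i^2 = 0\<close>, this additivity matches the linear and quadratic terms, and the braid
  relation matches the cubic one.\<close>

lemma h_elem_ybe:
  assumes "braid3 i j"
  shows "h_elem i a * h_elem j (a + b) * h_elem i b = h_elem j b * h_elem i (a + b) * (h_elem j a :: 'a :: comm_ring_1 nilcox)"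
proof -
  have "gen i * (gen j * gen i) = (gen j * (gen i * gen j) :: 'a nilcox)"
    using gen_word_cong[of "[i, j, i]" "[j, i, j]"] assms by (auto simp: braid3_def comp_assoc)
  then show ?thesis
    by (intro nilcox_eqI) (simp add: h_elem_def distrib_left distrib_right mult.assoc smul_add_right algebra_simps)
qed

text \<open>The B_2 analogue. The factor \<open>k\<close> is 1 in type B and 2 in type C, according
  to the root attached to \<open>s_0\<close>.\<close>

lemma h_elem_ybe4:
  assumes "reflection i \<circ> reflection j \<circ> reflection i \<circ> reflection j
    = reflection j \<circ> reflection i \<circ> reflection j \<circ> reflection i"
  shows "h_elem i (k * x) * h_elem j (x + y) * h_elem i (k * y) * h_elem j (y - x)
    = h_elem j (y - x) * h_elem i (k * y) * h_elem j (x + y) * (h_elem i (k * x) :: 'a :: comm_ring_1 nilcox)"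
proof -
  have "gen i * (gen j * (gen i * gen j)) = (gen j * (gen i * (gen j * gen i)) :: 'a nilcox)"
    using gen_word_cong[of "[i, j, i, j]" "[j, i, j, i]"] assms by (auto simp: comp_assoc)
  then show ?thesis
    by (intro nilcox_eqI) (simp add: h_elem_def distrib_left distrib_right mult.assoc smul_add_right algebra_simps)
qed

lemma braid2_sym: "braid2 i j \<longleftrightarrow> braid2 j i"
  unfolding braid2_def by auto

lemma braid2_Idx: "i + 2 \<le> j \<Longrightarrow> braid2 (Idx i) (Idx j)"
  unfolding braid2_def by (rule ext) (cases "i = 0"; auto)

lemma braid2_Hat1: "j \<ge> 3 \<Longrightarrow> braid2 Hat1 (Idx j)"
  unfolding braid2_def by (rule ext) auto

lemma braid2_Hat1_1: "braid2 Hat1 (Idx 1)"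
  unfolding braid2_def by (rule ext) auto

lemma braid3_Idx: "i \<ge> 1 \<Longrightarrow> braid3 (Idx i) (Idx (Suc i))"
  unfolding braid3_def
proof
  fix x assume "i \<ge> 1"
  consider "x = int i" | "x = int i + 1" | "x = int i + 2" | "x = - int i" | "x = - int i - 1"
    | "x = - int i - 2" | "x \<notin> {int i, int i + 1, int i + 2, - int i, - int i - 1, - int i - 2}"
    by blast
  then show "(reflection (Idx i) \<circ> reflection (Idx (Suc i)) \<circ> reflection (Idx i)) x
      = (reflection (Idx (Suc i)) \<circ> reflection (Idx i) \<circ> reflection (Idx (Suc i))) x"
    using \<open>i \<ge> 1\<close> by cases simp_all
qed

lemma braid3_Hat1: "braid3 Hat1 (Idx 2)"
  unfolding braid3_def by (rule ext) auto

lemma braid4_01: "reflection (Idx 0) \<circ> reflection (Idx 1) \<circ> reflection (Idx 0) \<circ> reflection (Idx 1)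
    = reflection (Idx 1) \<circ> reflection (Idx 0) \<circ> reflection (Idx 1) \<circ> reflection (Idx 0)"
proof
  fix x :: int
  consider "x = 1" | "x = 2" | "x = -1" | "x = -2" | "x \<notin> {1, 2, -1, -2}" by blast
  then show "(reflection (Idx 0) \<circ> reflection (Idx 1) \<circ> reflection (Idx 0) \<circ> reflection (Idx 1)) x
    = (reflection (Idx 1) \<circ> reflection (Idx 0) \<circ> reflection (Idx 1) \<circ> reflection (Idx 0)) x"
    by cases simp_all
qed

subsection \<open>Coefficientwise maps, scaling and reversal\<close>

definition ring_hom :: "('a :: ring_1 \<Rightarrow> 'b :: ring_1) \<Rightarrow> bool" where
  "ring_hom \<phi> \<longleftrightarrow> \<phi> 1 = 1 \<and> (\<forall>a b. \<phi> (a + b) = \<phi> a + \<phi> b) \<and> (\<forall>a b. \<phi> (a * b) = \<phi> a * \<phi> b)"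

lemma ring_hom_one: "ring_hom \<phi> \<Longrightarrow> \<phi> 1 = 1"
  and ring_hom_add: "ring_hom \<phi> \<Longrightarrow> \<phi> (a + b) = \<phi> a + \<phi> b"
  and ring_hom_mult: "ring_hom \<phi> \<Longrightarrow> \<phi> (a * b) = \<phi> a * \<phi> b"
  by (auto simp: ring_hom_def)

lemma ring_hom_zero: "ring_hom \<phi> \<Longrightarrow> \<phi> 0 = 0"
  using ring_hom_add[of \<phi> 0 0] by simp

lemma ring_hom_minus: "ring_hom \<phi> \<Longrightarrow> \<phi> (a - b) = \<phi> a - \<phi> b"
  using ring_hom_add[of \<phi> "a - b" b] by (simp add: eq_diff_eq)

lemma ring_hom_uminus: "ring_hom \<phi> \<Longrightarrow> \<phi> (- b) = - \<phi> b"
  using ring_hom_minus[of \<phi> 0 b] by (simp add: ring_hom_zero)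

lemma ring_hom_sum: "ring_hom \<phi> \<Longrightarrow> \<phi> (sum f A) = (\<Sum>x\<in>A. \<phi> (f x))"
  by (induction A rule: infinite_finite_induct) (simp_all add: ring_hom_zero ring_hom_add)

lemma ring_hom_power: "ring_hom \<phi> \<Longrightarrow> \<phi> (a ^ n) = \<phi> a ^ n"
  by (induction n) (simp_all add: ring_hom_one ring_hom_mult)

lemma ring_hom_of_nat: "ring_hom \<phi> \<Longrightarrow> \<phi> (of_nat n) = of_nat n"
  by (induction n) (simp_all add: ring_hom_zero ring_hom_one ring_hom_add)

lemma ring_hom_of_int: "ring_hom \<phi> \<Longrightarrow> \<phi> (of_int n) = of_int n"
  by (cases n) (simp_all add: ring_hom_of_nat ring_hom_uminus ring_hom_minus ring_hom_one)

lemma ring_hom_numeral: "ring_hom \<phi> \<Longrightarrow> \<phi> (numeral n) = numeral n"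
  using ring_hom_of_int[of \<phi> "numeral n"] by simp

lemma ring_hom_prod_list: "ring_hom \<phi> \<Longrightarrow> \<phi> (prod_list xs) = prod_list (map \<phi> xs)"
  by (induction xs) (simp_all add: ring_hom_one ring_hom_mult)

lemma ring_hom_comp: "ring_hom \<phi> \<Longrightarrow> ring_hom \<psi> \<Longrightarrow> ring_hom (\<phi> \<circ> \<psi>)"
  by (simp add: ring_hom_def)

definition nmap :: "('a :: comm_ring_1 \<Rightarrow> 'b :: comm_ring_1) \<Rightarrow> 'a nilcox \<Rightarrow> 'b nilcox" where
  "nmap \<phi> F = mk_nilcox (\<lambda>Y w. \<phi> (ncoeff F Y w))"

lemma ncoeff_nmap: "ring_hom \<phi> \<Longrightarrow> ncoeff (nmap \<phi> F) Y w = \<phi> (ncoeff F Y w)"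
  by (simp add: nmap_def ncoeff_mk_nilcox ncoeff_outside ring_hom_zero)

lemma ring_hom_nmap: "ring_hom \<phi> \<Longrightarrow> ring_hom (nmap \<phi>)"
  unfolding ring_hom_def[of "nmap \<phi>"]
  by (auto intro!: nilcox_eqI sum.cong
      simp: ncoeff_nmap ncoeff_one ncoeff_times ring_hom_one ring_hom_zero ring_hom_add ring_hom_mult ring_hom_sum case_prod_unfold)

lemma nmap_h_elem: "ring_hom \<phi> \<Longrightarrow> nmap \<phi> (h_elem i a) = h_elem i (\<phi> a)"
  by (rule nilcox_eqI)
    (simp add: h_elem_def ncoeff_nmap ncoeff_one ncoeff_gen ring_hom_one ring_hom_zero ring_hom_add ring_hom_mult)

lemma nmap_comp: "ring_hom \<phi> \<Longrightarrow> ring_hom \<psi> \<Longrightarrow> nmap \<phi> (nmap \<psi> F) = nmap (\<phi> \<circ> \<psi>) F"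
  by (rule nilcox_eqI) (simp add: ncoeff_nmap ring_hom_comp)

text \<open>The substitution of \<open>a * u_i\<close> for every \<open>u_i\<close>; it isolates the
  homogeneous dependence of \<open>C(z)\<close> on \<open>z\<close>.\<close>

definition nscale :: "'a :: comm_ring_1 \<Rightarrow> 'a nilcox \<Rightarrow> 'a nilcox" where
  "nscale a F = mk_nilcox (\<lambda>Y w. a ^ len Y w * ncoeff F Y w)"

lemma ncoeff_nscale: "ncoeff (nscale a F) Y w = a ^ len Y w * ncoeff F Y w"
  by (simp add: nscale_def ncoeff_mk_nilcox ncoeff_outside)

lemma ring_hom_nscale: "ring_hom (nscale a)"
proof -
  have "nscale a (F * G) = nscale a F * nscale a G" for F G
  proof (rule nilcox_eqI)
    fix Y w assume w: "w \<in> Weyl_group Y"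
    have "a ^ len Y w * (ncoeff F Y u * ncoeff G Y v) = a ^ len Y u * ncoeff F Y u * (a ^ len Y v * ncoeff G Y v)"
      if "(u, v) \<in> factorizations Y w" for u v
    proof -
      have "len Y w = len Y u + len Y v" using that by (simp add: factorizations_def)
      then show ?thesis by (simp add: power_add mult_ac)
    qed
    then show "ncoeff (nscale a (F * G)) Y w = ncoeff (nscale a F * nscale a G) Y w"
      using w by (auto simp: ncoeff_nscale ncoeff_times sum_distrib_left case_prod_unfold intro!: sum.cong)
  qed
  then show ?thesis unfolding ring_hom_def
    by (auto intro!: nilcox_eqI simp: ncoeff_nscale ncoeff_one distrib_left)
qed

lemma nscale_h_elem: "nscale a (h_elem i b) = h_elem i (a * b)"
  by (rule nilcox_eqI) (auto simp: h_elem_def ncoeff_nscale ncoeff_one ncoeff_gen distrib_left len_reflection)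

text \<open>The anti-automorphism that reverses words. Together with \<open>omega\<close> it
  exchanges the two outer factors of the generating function.\<close>

definition nrev :: "'a :: comm_ring_1 nilcox \<Rightarrow> 'a nilcox" where
  "nrev F = mk_nilcox (\<lambda>Y w. ncoeff F Y (inv w))"

lemma ncoeff_nrev: "w \<in> Weyl_group Y \<Longrightarrow> ncoeff (nrev F) Y w = ncoeff F Y (inv w)"
  by (simp add: nrev_def)

lemma factorizations_inv:
  assumes "(u, v) \<in> factorizations Y w" shows "(inv v, inv u) \<in> factorizations Y (inv w)"
proof -
  have uv: "u \<in> Weyl_group Y" "v \<in> Weyl_group Y" "u \<circ> v = w" using assms by (auto simp: factorizations_def)
  then have "inv v \<circ> inv u = inv w" using bij_Weyl[of u Y] bij_Weyl[of v Y] o_inv_distrib by metis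
  moreover have "w \<in> Weyl_group Y" using uv comp_in_Weyl by blast
  ultimately show ?thesis using assms by (auto simp: factorizations_def inv_in_Weyl len_inv)
qed

lemma nrev_nrev [simp]: "nrev (nrev F) = F"
  by (rule nilcox_eqI) (simp add: ncoeff_nrev inv_in_Weyl bij_Weyl inv_inv_eq)

lemma nrev_mult: "nrev (F * G) = nrev G * nrev F"
proof (rule nilcox_eqI)
  fix Y w assume w: "w \<in> Weyl_group Y"
  then have iw: "inv (inv w) = w" by (simp add: bij_Weyl inv_inv_eq)
  have inv_inv: "inv (inv u) = u" "inv (inv v) = v" "u \<in> Weyl_group Y" "v \<in> Weyl_group Y"
    if "(u, v) \<in> factorizations Y x" for u v x
    using factsD[OF that] bij_Weyl inv_inv_eq by blast+
  have "(\<Sum>(u, v)\<in>factorizations Y (inv w). ncoeff F Y u * ncoeff G Y v)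
      = (\<Sum>(u, v)\<in>factorizations Y w. ncoeff (nrev G) Y u * ncoeff (nrev F) Y v)"
    by (rule sum.reindex_bij_witness[where i = "\<lambda>(u, v). (inv v, inv u)" and j = "\<lambda>(u, v). (inv v, inv u)"])
      (use w iw in \<open>auto dest: factorizations_inv simp: inv_inv inv_in_Weyl ncoeff_nrev mult.commute\<close>)
  then show "ncoeff (nrev (F * G)) Y w = ncoeff (nrev G * nrev F) Y w"
    using w by (simp add: ncoeff_times ncoeff_nrev inv_in_Weyl)
qed

lemma inv_reflection [simp]: "inv (reflection i) = reflection i"
  by (rule inv_unique_comp) simp_all

lemma nrev_one [simp]: "nrev 1 = 1"
proof (rule nilcox_eqI)
  fix Y w assume w: "w \<in> Weyl_group Y"
  then have "inv w = id \<longleftrightarrow> w = id" by (metis bij_Weyl inv_id inv_inv_eq)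
  with w show "ncoeff (nrev 1) Y w = ncoeff 1 Y w" by (simp add: ncoeff_nrev ncoeff_one)
qed

lemma nrev_h_elem [simp]: "nrev (h_elem i a) = h_elem i a"
proof (rule nilcox_eqI)
  fix Y w assume w: "w \<in> Weyl_group Y"
  then have "inv w = reflection i \<longleftrightarrow> w = reflection i" by (metis bij_Weyl inv_inv_eq inv_reflection)
  moreover from w have "inv w = id \<longleftrightarrow> w = id" by (metis bij_Weyl inv_id inv_inv_eq)
  ultimately show "ncoeff (nrev (h_elem i a)) Y w = ncoeff (h_elem i a) Y w"
    using w by (simp add: ncoeff_nrev ncoeff_one ncoeff_gen h_elem_def)
qed

lemma nrev_prod_list: "nrev (prod_list xs) = prod_list (map nrev (rev xs))"
  by (induction xs) (simp_all add: nrev_mult)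

lemma nmap_nrev: "ring_hom \<phi> \<Longrightarrow> nmap \<phi> (nrev F) = nrev (nmap \<phi> F)"
  by (rule nilcox_eqI) (simp add: ncoeff_nmap ncoeff_nrev)

subsection \<open>Truncation\<close>

text \<open>Every \<open>h_elem\<close> of level at least \<open>n\<close> is congruent to 1, so
  infinite products become finite under this congruence.\<close>

definition ncong :: "lie_type \<Rightarrow> nat \<Rightarrow> 'a :: comm_ring_1 nilcox \<Rightarrow> 'a nilcox \<Rightarrow> bool" where
  "ncong Y n F G \<longleftrightarrow> (\<forall>w \<in> parabolic Y n. ncoeff F Y w = ncoeff G Y w)"

lemma ncong_refl [simp, intro]: "ncong Y n F F"
  by (simp add: ncong_def)

lemma ncong_sym: "ncong Y n F G \<Longrightarrow> ncong Y n G F"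
  by (simp add: ncong_def)

lemma ncong_trans [trans]: "ncong Y n F G \<Longrightarrow> ncong Y n G H \<Longrightarrow> ncong Y n F H"
  by (simp add: ncong_def)

lemma ncong_mult:
  assumes "ncong Y n F F'" "ncong Y n G G'" shows "ncong Y n (F * G) (F' * G')"
  unfolding ncong_def
proof
  fix w assume w: "w \<in> parabolic Y n"
  then have "w \<in> Weyl_group Y" by (simp add: parabolic_def)
  then show "ncoeff (F * G) Y w = ncoeff (F' * G') Y w"
    using assms factorizations_parabolic[OF _ w] by (auto simp: ncoeff_times ncong_def intro!: sum.cong)
qed

lemma ncong_nmap: "ring_hom \<phi> \<Longrightarrow> ncong Y n F G \<Longrightarrow> ncong Y n (nmap \<phi> F) (nmap \<phi> G)"
  by (simp add: ncong_def ncoeff_nmap)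

lemma parabolic_inv:
  assumes "w \<in> parabolic Y n" shows "inv w \<in> parabolic Y n"
proof -
  have w: "w \<in> Weyl_group Y" using assms by (simp add: parabolic_def)
  have "\<forall>i \<in> set is. level i < n" if "reduced Y is" "wprod is = inv w" for "is"
  proof -
    have "wprod (rev is) = w" using that(2) w by (metis bij_Weyl inv_inv_eq inv_wprod)
    moreover have "reduced Y (rev is)"
      using that w \<open>wprod (rev is) = w\<close> by (simp add: reduced_def len_inv)
    ultimately show ?thesis using assms by (force simp: parabolic_def)
  qed
  then show ?thesis using w by (auto simp: parabolic_def inv_in_Weyl)
qed

lemma ncong_nrev: "ncong Y n F G \<Longrightarrow> ncong Y n (nrev F) (nrev G)"
  using parabolic_inv by (fastforce simp: ncong_def ncoeff_nrev parabolic_def)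

lemma id_in_parabolic [simp]: "id \<in> parabolic Y n"
  by (auto simp: parabolic_def reduced_def)

lemma ncong_h_elem: "n \<le> level i \<Longrightarrow> ncong Y n (h_elem i a) 1"
  unfolding ncong_def h_elem_def
proof
  fix w assume n: "n \<le> level i" and w: "w \<in> parabolic Y n"
  have "\<not> (i \<in> index_set Y \<and> w = reflection i)"
  proof
    assume a: "i \<in> index_set Y \<and> w = reflection i"
    then have "reduced Y [i]" "wprod [i] = w" by (auto simp: reduced_def len_reflection)
    with w have "\<forall>j \<in> set [i]. level j < n" unfolding parabolic_def by blast
    with n show False by simp
  qed
  then show "ncoeff (1 + smul a (gen i)) Y w = ncoeff 1 Y w" by (auto simp: ncoeff_gen)
qed

text \<open>Each coefficient is read off at the first truncation that sees it; for a coherent family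
  every later one gives the same value.\<close>

definition nlim :: "(lie_type \<Rightarrow> nat \<Rightarrow> 'a :: comm_ring_1 nilcox) \<Rightarrow> 'a nilcox" where
  "nlim F = mk_nilcox (\<lambda>Y w. ncoeff (F Y (LEAST n. w \<in> parabolic Y n)) Y w)"

lemma ncong_nlim:
  assumes "\<And>m n. m \<le> n \<Longrightarrow> ncong Y m (F Y n) (F Y m)"
  shows "ncong Y n (nlim F) (F Y n)"
  unfolding ncong_def
proof
  fix w assume w: "w \<in> parabolic Y n"
  let ?m = "LEAST n. w \<in> parabolic Y n"
  have "?m \<le> n" "w \<in> parabolic Y ?m" using w by (auto intro: Least_le LeastI)
  then have "ncoeff (F Y n) Y w = ncoeff (F Y ?m) Y w" using assms[of ?m n] by (simp add: ncong_def)
  moreover have "w \<in> Weyl_group Y" using w by (simp add: parabolic_def)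
  ultimately show "ncoeff (nlim F) Y w = ncoeff (F Y n) Y w" by (simp add: nlim_def)
qed

section \<open>Yang--Baxter identities\<close>

text \<open>The block \<open>h_{n-1}(z) ... h_i(z)\<close> of Fomin and Kirillov;
  \<open>up_prod\<close> is the same block with its letters in increasing order.\<close>

definition down_prod :: "nat \<Rightarrow> nat \<Rightarrow> 'a :: comm_ring_1 \<Rightarrow> 'a nilcox" where
  "down_prod i n z = prod_list (map (\<lambda>j. h_elem (Idx j) z) (rev [i..<n]))"

definition up_prod :: "nat \<Rightarrow> nat \<Rightarrow> 'a :: comm_ring_1 \<Rightarrow> 'a nilcox" where
  "up_prod i n z = prod_list (map (\<lambda>j. h_elem (Idx j) z) [i..<n])"

lemma mult_assoc2: "a * b = r \<Longrightarrow> a * (b * c) = r * (c :: 'a :: monoid_mult)"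
  by (simp only: mult.assoc[symmetric])

lemma mult_assoc3: "a * b * c = r \<Longrightarrow> a * (b * (c * d)) = r * (d :: 'a :: monoid_mult)"
  by (simp only: mult.assoc[symmetric])

lemma down_prod_ge [simp]: "n \<le> i \<Longrightarrow> down_prod i n z = 1" and up_prod_ge [simp]: "n \<le> i \<Longrightarrow> up_prod i n z = 1"
  by (simp_all add: down_prod_def up_prod_def)

lemma down_prod_step: "i < n \<Longrightarrow> down_prod i n z = down_prod (Suc i) n z * h_elem (Idx i) z"
  by (simp add: down_prod_def upt_conv_Cons)

lemma down_prod_Suc: "i \<le> n \<Longrightarrow> down_prod i (Suc n) z = h_elem (Idx n) z * down_prod i n z"
  by (simp add: down_prod_def)

lemma up_prod_Suc: "i \<le> n \<Longrightarrow> up_prod i (Suc n) z = up_prod i n z * h_elem (Idx n) z"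
  by (simp add: up_prod_def)

lemma nrev_down_prod: "nrev (down_prod i n z) = up_prod i n z"
  by (simp add: down_prod_def up_prod_def nrev_prod_list rev_map comp_def)

lemma up_prod_down_prod: "up_prod i n z * down_prod i n (- z) = 1"
proof (induction n)
  case (Suc n)
  show ?case
  proof (cases "i \<le> n")
    case True
    then show ?thesis using Suc by (simp add: up_prod_Suc down_prod_Suc mult.assoc h_elem_add_left)
  qed simp
qed simp

lemma down_prod_up_prod: "down_prod i n z * up_prod i n (- z) = 1"
proof (induction n)
  case (Suc n)
  show ?case
  proof (cases "i \<le> n")
    case True
    have "down_prod i (Suc n) z * up_prod i (Suc n) (- z) = h_elem (Idx n) z * (down_prod i n z * up_prod i n (- z)) * h_elem (Idx n) (- z)"
      by (simp add: True up_prod_Suc down_prod_Suc mult.assoc)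
    then show ?thesis by (simp add: Suc h_elem_add)
  qed simp
qed simp

lemma ring_hom_map_h_elem:
  assumes "ring_hom \<phi>" "\<And>i a. \<phi> (h_elem i a) = h_elem i (f a)"
  shows "\<phi> (down_prod i n z) = down_prod i n (f z)" "\<phi> (up_prod i n z) = up_prod i n (f z)"
  by (simp_all add: down_prod_def up_prod_def ring_hom_prod_list[OF assms(1)] assms(2) comp_def)

lemma commute_prod_list:
  fixes x :: "'a :: monoid_mult"
  assumes "\<And>y. y \<in> set ys \<Longrightarrow> x * y = y * x"
  shows "x * prod_list ys = prod_list ys * x"
  using assms by (induction ys) (simp_all, metis mult.assoc)

lemma h_elem_down_prod_commute:
  assumes "\<And>j. i \<le> j \<Longrightarrow> j < n \<Longrightarrow> braid2 k (Idx j)"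
  shows "h_elem k a * down_prod i n z = down_prod i n z * h_elem k a"
  unfolding down_prod_def by (rule commute_prod_list) (auto intro!: h_elem_commute assms)

lemma h_elem_up_prod_commute:
  assumes "\<And>j. i \<le> j \<Longrightarrow> j < n \<Longrightarrow> braid2 k (Idx j)"
  shows "h_elem k a * up_prod i n z = up_prod i n z * h_elem k a"
  unfolding up_prod_def by (rule commute_prod_list) (auto intro!: h_elem_commute assms)

lemma h_elem_cancel: "F * h_elem i a = G * h_elem i a \<Longrightarrow> F = G"
  by (metis add.right_inverse h_elem_add h_elem_zero mult.assoc mult.right_neutral)

text \<open>The induction step for both the commutation of the \<open>down_prod i n\<close> and its variant with the letter \<open>Hat1\<close>.\<close>

lemma down_prod_extend:
  fixes x y :: "'a :: comm_ring_1"
  assumes a: "braid3 k (Idx j)" "\<And>l. l > j \<Longrightarrow> braid2 k (Idx l)"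
    and swap: "\<And>(x :: 'a) (y :: 'a). j < n \<Longrightarrow> down_prod j n y * down_prod (Suc j) n x = down_prod j n x * down_prod (Suc j) n y * h_elem (Idx j) (y - x)"
  shows "down_prod j n y * h_elem k y * down_prod j n x = down_prod j n x * h_elem k x * down_prod j n y * h_elem k (y - x)"
proof (cases "j < n")
  case True
  let ?B = "down_prod (Suc j) n" and ?b = "h_elem (Idx j)" and ?a = "h_elem k"
  have B: "down_prod j n z = ?B z * ?b z" for z :: 'a by (rule down_prod_step[OF True])
  have aB: "?a u * ?B z = ?B z * ?a u" for u z :: 'a
    by (rule h_elem_down_prod_commute) (use a(2) in auto)
  have ybe: "?b (x - y) * ?a x * ?b y = ?a y * ?b x * ?a (x - y)" for x y :: 'a
    using h_elem_ybe[OF a(1), of y "x - y"] by simp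
  \<comment> \<open>After right multiplication by \<open>h_elem k x\<close> the claim becomes
    symmetric: the products \<open>down_prod j n x * h_elem k x\<close> commute for different
    parameters. This form is proved first, and the invertible factor is cancelled at the
    end.\<close>
  have "down_prod j n x * ?a x * down_prod j n y * ?a y = down_prod j n x * (?a x * ?B y) * ?b y * ?a y"
    by (simp only: B[of y] mult.assoc)
  also have "\<dots> = (down_prod j n x * ?B y) * ?a x * ?b y * ?a y"
    by (simp only: aB mult.assoc)
  also have "\<dots> = down_prod j n y * ?B x * (?b (x - y) * ?a x * ?b y) * ?a y"
    by (simp only: swap[OF True, of x y] mult.assoc)
  also have "\<dots> = down_prod j n y * (?a y * ?B x) * ?b x * (?a (x - y) * ?a y)"
    by (simp only: ybe) (simp only: mult_assoc2[OF aB] mult.assoc)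
  also have "\<dots> = down_prod j n y * ?a y * down_prod j n x * ?a x"
    by (simp only: B[of x] h_elem_add mult.assoc diff_add_cancel)
  finally have *: "down_prod j n x * ?a x * down_prod j n y * ?a y = down_prod j n y * ?a y * down_prod j n x * ?a x" .
  have "down_prod j n x * ?a x * down_prod j n y * ?a (y - x) * ?a x = down_prod j n y * ?a y * down_prod j n x * ?a x"
    using * by (simp add: mult.assoc h_elem_add)
  then show ?thesis by (metis h_elem_cancel)
next
  case False
  then show ?thesis by (simp add: h_elem_add)
qed

text \<open>The type A mechanism: exchanging the variables of two neighbouring blocks costs a right
  factor \<open>h_i(y - x)\<close>. The induction starts at the far end of the letters and moves
  down to \<open>i\<close>.\<close>

lemma down_prod_swap:
  fixes x y :: "'a :: comm_ring_1"
  assumes "1 \<le> i" "i < n"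
  shows "down_prod i n y * down_prod (Suc i) n x = down_prod i n x * down_prod (Suc i) n y * h_elem (Idx i) (y - x)"
  using assms
proof (induction "n - i" arbitrary: i x y rule: less_induct)
  case less
  have swap: "down_prod (Suc i) n v * down_prod (Suc (Suc i)) n u
      = down_prod (Suc i) n u * down_prod (Suc (Suc i)) n v * h_elem (Idx (Suc i)) (v - u)" if "Suc i < n" for u v :: 'a
    by (rule less.hyps) (use that in auto)
  have "down_prod (Suc i) n y * h_elem (Idx i) y * down_prod (Suc i) n x
      = down_prod (Suc i) n x * h_elem (Idx i) x * down_prod (Suc i) n y * h_elem (Idx i) (y - x)"
    by (rule down_prod_extend[OF braid3_Idx braid2_Idx swap]) (use less.prems in auto)
  then show ?case using less.prems by (simp only: down_prod_step[of i n])
qed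

text \<open>At the fork of the D diagram \<open>Hat1\<close> braids with the letter 2 and commutes
  with all later ones, just as the letter 1 does.\<close>

lemma down_prod_swap_hat:
  fixes x y :: "'a :: comm_ring_1"
  shows "down_prod 2 n y * h_elem Hat1 y * down_prod 2 n x = down_prod 2 n x * h_elem Hat1 x * down_prod 2 n y * h_elem Hat1 (y - x)"
  by (rule down_prod_extend[OF braid3_Hat1 braid2_Hat1 down_prod_swap]) auto

text \<open>For \<open>i = 1\<close> this is the Fomin-Kirillov product, whose coefficients are the
  type A Schubert polynomials in \<open>\<zeta>\<close>.\<close>

definition tri :: "nat \<Rightarrow> nat \<Rightarrow> (nat \<Rightarrow> 'a :: comm_ring_1) \<Rightarrow> 'a nilcox" where
  "tri i n \<zeta> = prod_list (map (\<lambda>j. down_prod j n (\<zeta> j)) [i..<n])"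

lemma tri_step: "i < n \<Longrightarrow> tri i n \<zeta> = down_prod i n (\<zeta> i) * tri (Suc i) n \<zeta>"
  by (simp add: tri_def upt_conv_Cons)

lemma tri_cong: "(\<And>j. i \<le> j \<Longrightarrow> \<zeta> j = \<xi> j) \<Longrightarrow> tri i n \<zeta> = tri i n \<xi>"
  unfolding tri_def by (intro arg_cong[where f = prod_list] map_cong) auto

lemma h_elem_tri_commute:
  assumes "\<And>j. i \<le> j \<Longrightarrow> braid2 k (Idx j)"
  shows "h_elem k a * tri i n \<zeta> = tri i n \<zeta> * h_elem k a"
  unfolding tri_def
proof (rule commute_prod_list)
  fix y assume "y \<in> set (map (\<lambda>j. down_prod j n (\<zeta> j)) [i..<n])"
  then obtain j where "i \<le> j" "y = down_prod j n (\<zeta> j)" by auto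
  then show "h_elem k a * y = y * h_elem k a" using assms by (auto intro!: h_elem_down_prod_commute)
qed

lemma ring_hom_map_tri:
  assumes "ring_hom \<phi>" "\<And>i a. \<phi> (h_elem i a) = h_elem i (f a)"
  shows "\<phi> (tri i n \<zeta>) = tri i n (\<lambda>j. f (\<zeta> j))"
  by (simp add: tri_def ring_hom_prod_list[OF assms(1)] ring_hom_map_h_elem[OF assms] comp_def)

text \<open>Only the factors \<open>i\<close> and \<open>i + 1\<close> see the exchange. The
  correction \<open>h_i\<close> arising there passes the remaining factors, whose letters start at
  \<open>i + 2\<close>.\<close>

lemma tri_transpose:
  assumes "1 \<le> i" "i + 2 \<le> n"
  shows "tri 1 n (\<lambda>j. \<zeta> (transpose i (i + 1) j)) = tri 1 n \<zeta> * h_elem (Idx i) (\<zeta> (i + 1) - \<zeta> i)"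
proof -
  let ?\<xi> = "\<lambda>j. \<zeta> (transpose i (i + 1) j)"
  have split: "tri 1 n \<xi> = prod_list (map (\<lambda>j. down_prod j n (\<xi> j)) [1..<i]) *
      (down_prod i n (\<xi> i) * down_prod (Suc i) n (\<xi> (Suc i))) * tri (i + 2) n \<xi>" for \<xi> :: "nat \<Rightarrow> 'a"
  proof -
    have "[1..<n] = [1..<i] @ [i..<n]" using assms upt_add_eq_append[of 1 i "n - i"] by simp
    moreover have "[i..<n] = i # Suc i # [i + 2..<n]" using assms by (simp add: upt_conv_Cons)
    ultimately show ?thesis by (simp add: tri_def mult.assoc)
  qed
  have 1: "map (\<lambda>j. down_prod j n (?\<xi> j)) [1..<i] = map (\<lambda>j. down_prod j n (\<zeta> j)) [1..<i]"
    by (simp add: transpose_def)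
  have 2: "tri (i + 2) n ?\<xi> = tri (i + 2) n \<zeta>"
    by (rule tri_cong) (simp add: transpose_def)
  have 3: "down_prod i n (?\<xi> i) * down_prod (Suc i) n (?\<xi> (Suc i))
      = down_prod i n (\<zeta> i) * down_prod (Suc i) n (\<zeta> (Suc i)) * h_elem (Idx i) (\<zeta> (i + 1) - \<zeta> i)"
    using down_prod_swap[of i n "\<zeta> (i + 1)" "\<zeta> i"] assms by simp
  have 4: "h_elem (Idx i) a * tri (i + 2) n \<zeta> = tri (i + 2) n \<zeta> * h_elem (Idx i) a" for a
    by (rule h_elem_tri_commute) (simp add: braid2_Idx)
  show ?thesis unfolding split 1 2 3 by (simp only: mult.assoc 4)
qed

subsection \<open>The generating function of the Stanley symmetric functions\<close>

text \<open>The part of \<open>C(z)\<close> at the end of the Dynkin diagram. The 2 in type C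
  matches the simple root \<open>2 * tvar 1\<close>; in type D both fork nodes contribute. The type
  A arm beyond it begins at the letter \<open>start Y\<close>.\<close>

fun base :: "lie_type \<Rightarrow> 'a :: comm_ring_1 \<Rightarrow> 'a nilcox" where
  "base TypeB z = h_elem (Idx 0) z"
| "base TypeC z = h_elem (Idx 0) (2 * z)"
| "base TypeD z = h_elem (Idx 1) z * h_elem Hat1 z"

fun start :: "lie_type \<Rightarrow> nat" where
  "start TypeB = 1"
| "start TypeC = 1"
| "start TypeD = 2"

definition C_prod :: "lie_type \<Rightarrow> nat \<Rightarrow> 'a :: comm_ring_1 \<Rightarrow> 'a nilcox" where
  "C_prod Y n z = down_prod (start Y) n z * base Y z * up_prod (start Y) n z"

lemma h1_hat_commute: "h_elem (Idx 1) a * h_elem Hat1 b = h_elem Hat1 b * h_elem (Idx 1) a"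
  by (metis braid2_Hat1_1 h_elem_commute)

lemma C_prod_start: "n \<le> start Y \<Longrightarrow> C_prod Y n z = base Y z"
  by (simp add: C_prod_def)

lemma C_prod_Suc: "start Y \<le> n \<Longrightarrow> C_prod Y (Suc n) z = h_elem (Idx n) z * C_prod Y n z * h_elem (Idx n) z"
  by (simp add: C_prod_def down_prod_Suc up_prod_Suc mult.assoc)

lemma base_inverse: "base Y z * base Y (- z) = 1"
proof (cases Y)
  case TypeD
  have "base Y z * base Y (- z) = h_elem (Idx 1) z * (h_elem Hat1 z * h_elem (Idx 1) (- z)) * h_elem Hat1 (- z)"
    by (simp add: TypeD mult.assoc)
  also have "\<dots> = h_elem (Idx 1) z * h_elem (Idx 1) (- z) * (h_elem Hat1 z * h_elem Hat1 (- z))"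
    by (simp only: h1_hat_commute[symmetric] mult.assoc)
  finally show ?thesis by (simp add: h_elem_add)
qed (simp_all add: h_elem_add)

lemma base_commute: "base Y x * base Y y = base Y y * base Y x"
proof (cases Y)
  case TypeD
  have "base Y x * base Y y = h_elem (Idx 1) (x + y) * h_elem Hat1 (x + y)" for x y :: 'a
  proof -
    have "base Y x * base Y y = h_elem (Idx 1) x * (h_elem Hat1 x * h_elem (Idx 1) y) * h_elem Hat1 y"
      by (simp add: TypeD mult.assoc)
    also have "\<dots> = (h_elem (Idx 1) x * h_elem (Idx 1) y) * (h_elem Hat1 x * h_elem Hat1 y)"
      by (simp only: h1_hat_commute[symmetric] mult.assoc)
    finally show ?thesis by (simp only: h_elem_add)
  qed
  then show ?thesis by (simp add: add.commute)
qed (simp_all add: h_elem_add add.commute)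

text \<open>Telescoping from the middle: the two inner arms cancel, then the two bases, then the
  outer arms.\<close>

lemma C_prod_inverse: "C_prod Y n z * C_prod Y n (- z) = 1"
proof -
  have b: "base Y z * (base Y (- z) * F) = F" for F by (simp add: mult.assoc[symmetric] base_inverse)
  have u: "up_prod i n z * (down_prod i n (- z) * F) = F" for i F by (simp add: mult.assoc[symmetric] up_prod_down_prod)
  show ?thesis unfolding C_prod_def by (simp add: mult.assoc b u down_prod_up_prod)
qed

lemma nrev_C_prod: "nrev (C_prod Y n z) = C_prod Y n z"
proof -
  have "nrev (up_prod i n z) = down_prod i n z" for i by (metis nrev_down_prod nrev_nrev)
  moreover have "nrev (base Y z) = base Y z" by (cases Y) (simp_all add: nrev_mult h1_hat_commute del: One_nat_def)
  ultimately show ?thesis by (simp add: C_prod_def nrev_mult nrev_down_prod mult.assoc)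
qed

lemma ring_hom_map_C_prod:
  assumes "ring_hom \<phi>" "\<And>i a. \<phi> (h_elem i a) = h_elem i (f a)" "\<And>a. f (2 * a) = 2 * f a"
  shows "\<phi> (C_prod Y n z) = C_prod Y n (f z)"
  by (cases Y) (simp_all add: C_prod_def ring_hom_mult[OF assms(1)] ring_hom_map_h_elem[OF assms(1,2)] assms(2,3))

lemma braid2_far: "i + 2 \<le> j \<or> j + 2 \<le> i \<Longrightarrow> braid2 (Idx i) (Idx j)"
  using braid2_Idx braid2_sym by blast

text \<open>The letters of the arm lie below \<open>m\<close>, hence at distance at least two from
  \<open>k\<close>; in type D the bound k >= 3 puts \<open>k\<close> out of reach of the fork as
  well.\<close>

lemma C_prod_h_elem_commute:
  assumes "start Y \<le> m" "m < k"
  shows "C_prod Y m z * h_elem (Idx k) a = h_elem (Idx k) a * C_prod Y m z"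
proof -
  have d: "h_elem (Idx k) a * down_prod (start Y) m z = down_prod (start Y) m z * h_elem (Idx k) a"
    by (rule h_elem_down_prod_commute) (use assms in \<open>auto intro!: braid2_far\<close>)
  have u: "h_elem (Idx k) a * up_prod (start Y) m z = up_prod (start Y) m z * h_elem (Idx k) a"
    by (rule h_elem_up_prod_commute) (use assms in \<open>auto intro!: braid2_far\<close>)
  have b: "h_elem (Idx k) a * base Y z = base Y z * h_elem (Idx k) a"
  proof (cases Y)
    case TypeD
    then have "braid2 (Idx k) (Idx 1)" "braid2 (Idx k) Hat1"
      using assms braid2_far[of k 1] braid2_sym[of "Idx k" Hat1] braid2_Hat1[of k] by auto
    then show ?thesis
      by (simp only: TypeD base.simps mult_assoc2[OF h_elem_commute] mult.assoc[symmetric])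
        (metis h_elem_commute mult.assoc)
  qed (use assms in \<open>auto intro!: h_elem_commute braid2_far\<close>)
  have "h_elem (Idx k) a * C_prod Y m z = (h_elem (Idx k) a * down_prod (start Y) m z) * base Y z * up_prod (start Y) m z"
    by (simp only: C_prod_def mult.assoc)
  also have "\<dots> = down_prod (start Y) m z * (h_elem (Idx k) a * base Y z) * up_prod (start Y) m z"
    by (simp only: d mult.assoc)
  also have "\<dots> = down_prod (start Y) m z * base Y z * (h_elem (Idx k) a * up_prod (start Y) m z)"
    by (simp only: b mult.assoc)
  also have "\<dots> = C_prod Y m z * h_elem (Idx k) a"
    by (simp only: u C_prod_def mult.assoc)
  finally show ?thesis by simp
qed

text \<open>In types B and C this is the four-factor Yang-Baxter equation at the double edge. In
  type D the letters 1, 2 and \<open>Hat1\<close> span a diagram A_3 with 2 in the middle, and four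
  applications of the A_2 equation suffice, as the two fork letters commute.\<close>

lemma reflection_equation_base:
  fixes x y :: "'a :: comm_ring_1"
  shows "base Y x * h_elem (Idx (start Y)) (x + y) * base Y y * h_elem (Idx (start Y)) (y - x)
    = h_elem (Idx (start Y)) (y - x) * base Y y * h_elem (Idx (start Y)) (x + y) * base Y x"
proof (cases Y)
  case TypeD
  let ?a = "h_elem (Idx 1)" and ?d = "h_elem Hat1" and ?b = "h_elem (Idx 2)"
  have ad: "?a u * ?d v = ?d v * ?a u" for u v :: 'a by (rule h1_hat_commute)
  have dbd: "?d u * ?b (u + v) * ?d v = ?b v * ?d (u + v) * ?b u" for u v :: 'a
    by (rule h_elem_ybe[OF braid3_Hat1])
  have aba: "?a u * ?b (u + v) * ?a v = ?b v * ?a (u + v) * ?b u" for u v :: 'a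
    by (rule h_elem_ybe[OF braid3_Idx[OF order_refl, unfolded Suc_1]])
  have bab: "?b x * ?a y * ?b (y - x) = ?a (y - x) * ?b y * ?a x"
    using aba[of "y - x" x] by simp
  have aba': "?a x * ?b y * ?a (y - x) = ?b (y - x) * ?a y * ?b x"
    using aba[of x "y - x"] by simp
  have "base Y x * ?b (x + y) * base Y y * ?b (y - x)
      = ?a x * (?d x * ?b (x + y) * ?d y) * ?a y * ?b (y - x)"
    by (simp only: TypeD base.simps) (simp only: ad[of y y] mult.assoc)
  also have "\<dots> = ?a x * ?b y * ?d (x + y) * (?b x * ?a y * ?b (y - x))"
    by (simp only: dbd) (simp only: mult.assoc)
  also have "\<dots> = ?a x * ?b y * (?a (y - x) * ?d (x + y)) * ?b y * ?a x"
    by (simp only: bab) (simp only: mult_assoc2[OF ad] mult.assoc)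
  also have "\<dots> = (?a x * ?b y * ?a (y - x)) * ?d (x + y) * ?b y * ?a x"
    by (simp only: mult.assoc)
  also have "\<dots> = ?b (y - x) * ?a y * (?b x * ?d (y + x) * ?b y) * ?a x"
    by (simp only: aba' add.commute[of x y]) (simp only: mult.assoc)
  also have "\<dots> = ?b (y - x) * ?a y * (?d y * ?b (y + x) * ?d x) * ?a x"
    by (simp only: dbd)
  also have "\<dots> = ?b (y - x) * base Y y * ?b (x + y) * base Y x"
    by (simp only: TypeD base.simps add.commute[of x y]) (simp only: ad[of x x] mult.assoc)
  finally show ?thesis by (simp add: TypeD)
next
  case TypeB
  then show ?thesis using h_elem_ybe4[OF braid4_01, of 1 x y] by simp
next
  case TypeC
  then show ?thesis using h_elem_ybe4[OF braid4_01, of 2 x y] by simp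
qed

text \<open>Sklyanin's reflection equation, with \<open>C_prod\<close> as the reflecting boundary.
  One more letter wraps \<open>C_prod Y m\<close> in two factors \<open>h_m\<close>; Yang-Baxter
  moves expose the inner equation, the induction hypothesis flips it, and further moves close it
  again.\<close>

lemma reflection_equation:
  fixes x y :: "'a :: comm_ring_1"
  assumes "start Y \<le> m"
  shows "C_prod Y m x * h_elem (Idx m) (x + y) * C_prod Y m y * h_elem (Idx m) (y - x)
    = h_elem (Idx m) (y - x) * C_prod Y m y * h_elem (Idx m) (x + y) * C_prod Y m x"
  using assms
proof (induction m rule: dec_induct)
  case base
  then show ?case by (simp only: C_prod_start order_refl reflection_equation_base)
next
  case (step m)
  let ?a = "h_elem (Idx m)" and ?b = "h_elem (Idx (Suc m))" and ?K = "C_prod Y m"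
  have "1 \<le> m" using step.hyps by (cases Y) auto
  then have ybe: "?a u * ?b (u + v) * ?a v = ?b v * ?a (u + v) * ?b u" for u v :: 'a
    by (rule h_elem_ybe[OF braid3_Idx])
  have Kb: "?K u * ?b v = ?b v * ?K u" for u v
    by (rule C_prod_h_elem_commute) (use step.hyps in auto)
  have y1: "?b x * ?a y * ?b (y - x) = ?a (y - x) * ?b y * ?a x"
    using ybe[of "y - x" x] by simp
  have y2: "?a x * ?b y * ?a (y - x) = ?b (y - x) * ?a y * ?b x"
    using ybe[of x "y - x"] by simp
  have "C_prod Y (Suc m) x * ?b (x + y) * C_prod Y (Suc m) y * ?b (y - x)
      = ?a x * ?K x * (?a x * ?b (x + y) * ?a y) * ?K y * ?a y * ?b (y - x)"
    using step.hyps by (simp only: C_prod_Suc mult.assoc)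
  also have "\<dots> = ?a x * (?K x * ?b y) * ?a (x + y) * (?b x * ?K y) * ?a y * ?b (y - x)"
    by (simp only: mult_assoc3[OF ybe] mult.assoc)
  also have "\<dots> = ?a x * ?b y * ?K x * ?a (x + y) * ?K y * (?b x * ?a y * ?b (y - x))"
    by (simp only: mult_assoc2[OF Kb[of x y]] mult_assoc2[OF Kb[of y x, symmetric]] mult.assoc)
  also have "\<dots> = ?a x * ?b y * (?K x * ?a (x + y) * ?K y * ?a (y - x)) * ?b y * ?a x"
    by (simp only: y1) (simp only: mult.assoc)
  also have "\<dots> = (?a x * ?b y * ?a (y - x)) * ?K y * ?a (x + y) * (?K x * ?b y) * ?a x"
    by (simp only: step.IH) (simp only: mult.assoc)
  also have "\<dots> = ?b (y - x) * ?a y * (?b x * ?K y) * ?a (x + y) * (?b y * ?K x) * ?a x"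
    by (simp only: y2 Kb[of x y]) (simp only: mult.assoc)
  also have "\<dots> = ?b (y - x) * ?a y * ?K y * (?b x * ?a (y + x) * ?b y) * ?K x * ?a x"
    by (simp only: Kb[of y x, symmetric] Kb[of x y] add.commute[of x y]) (simp only: mult.assoc)
  also have "\<dots> = ?b (y - x) * ?a y * ?K y * (?a y * ?b (y + x) * ?a x) * ?K x * ?a x"
    by (simp only: ybe)
  also have "\<dots> = ?b (y - x) * C_prod Y (Suc m) y * ?b (x + y) * C_prod Y (Suc m) x"
    using step.hyps by (simp only: C_prod_Suc add.commute[of x y] mult.assoc)
  finally show ?case .
qed

lemma C_prod_commute:
  fixes x y :: "'a :: comm_ring_1"
  shows "C_prod Y n x * C_prod Y n y = C_prod Y n y * C_prod Y n x"
proof (cases "n \<le> start Y")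
  case True
  then show ?thesis by (simp only: C_prod_start base_commute)
next
  case False
  then obtain m where n: "n = Suc m" "start Y \<le> m" by (cases n) auto
  let ?a = "h_elem (Idx m)" and ?K = "C_prod Y m"
  \<comment> \<open>The extra factor \<open>h_m(- x)\<close> turns the last letter into
    \<open>h_m(y - x)\<close>, which exposes the left side of the reflection equation.\<close>
  have "C_prod Y n x * C_prod Y n y * ?a (- x) = ?a x * ?K x * (?a x * ?a y) * ?K y * (?a y * ?a (- x))"
    by (simp only: n C_prod_Suc mult.assoc)
  also have "\<dots> = ?a x * (?K x * ?a (x + y) * ?K y * ?a (y - x))"
    by (simp add: h_elem_add mult.assoc)
  also have "\<dots> = (?a x * ?a (y - x)) * ?K y * ?a (x + y) * ?K x"
    by (simp only: reflection_equation[OF n(2)]) (simp only: mult.assoc)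
  also have "\<dots> = ?a y * ?K y * (?a y * ?a x) * ?K x * (?a x * ?a (- x))"
    by (simp add: h_elem_add add.commute)
  also have "\<dots> = C_prod Y n y * C_prod Y n x * ?a (- x)"
    by (simp only: n C_prod_Suc mult.assoc)
  finally show ?thesis by (rule h_elem_cancel)
qed

text \<open>Under \<open>s_0\<close> the variable \<open>z_1\<close> changes sign in
  \<open>tri\<close>, while \<open>F\<close> contributes \<open>C(z_1)\<close>. The right arm of
  \<open>C(z_1)\<close> cancels the first block of \<open>tri\<close> at \<open>- z_1\<close>; the
  base, built from \<open>s_0\<close> alone, commutes with the blocks that use letters from 2
  on.\<close>

lemma C_prod_tri:
  assumes "Y \<noteq> TypeD" "2 \<le> n"
  shows "C_prod Y n (\<zeta> 1) * tri 1 n (\<zeta>(1 := - \<zeta> 1)) = tri 1 n \<zeta> * base Y (\<zeta> 1)"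
proof -
  have s: "start Y = 1" using assms by (cases Y) auto
  have b: "base Y a * tri 2 n \<zeta> = tri 2 n \<zeta> * base Y a" for a
    using assms h_elem_tri_commute[of 2 "Idx 0"] by (cases Y) (auto simp: braid2_Idx)
  have "tri 1 n (\<zeta>(1 := - \<zeta> 1)) = down_prod 1 n (- \<zeta> 1) * tri 2 n \<zeta>"
    using assms tri_cong[of 2 "\<zeta>(1 := - \<zeta> 1)" \<zeta> n]
    by (simp add: tri_step[of 1 n, unfolded Suc_1] del: One_nat_def)
  then have "C_prod Y n (\<zeta> 1) * tri 1 n (\<zeta>(1 := - \<zeta> 1))
      = down_prod 1 n (\<zeta> 1) * base Y (\<zeta> 1) * (up_prod 1 n (\<zeta> 1) * down_prod 1 n (- \<zeta> 1)) * tri 2 n \<zeta>"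
    by (simp only: C_prod_def s mult.assoc)
  also have "\<dots> = down_prod 1 n (\<zeta> 1) * (base Y (\<zeta> 1) * tri 2 n \<zeta>)"
    by (simp only: up_prod_down_prod mult_1_right mult.assoc)
  also have "\<dots> = tri 1 n \<zeta> * base Y (\<zeta> 1)"
    using assms by (simp only: b) (simp add: tri_step[of 1 n, unfolded Suc_1] mult.assoc del: One_nat_def)
  finally show ?thesis .
qed

text \<open>The counterpart for \<open>Hat1\<close>, which sends \<open>z_1\<close>,
  \<open>z_2\<close> to \<open>- z_2\<close>, \<open>- z_1\<close>, while \<open>F\<close>
  contributes \<open>C(z_1)\<close> and \<open>C(z_2)\<close>.\<close>

lemma C_prod_tri_hat:
  assumes "3 \<le> n"
  shows "C_prod TypeD n (\<zeta> 1) * C_prod TypeD n (\<zeta> 2) * tri 1 n (\<zeta>(1 := - \<zeta> 2, 2 := - \<zeta> 1))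
    = tri 1 n \<zeta> * h_elem Hat1 (\<zeta> 1 + \<zeta> 2)"
proof -
  let ?x = "\<zeta> 1" and ?y = "\<zeta> 2" and ?T = "tri 3 n \<zeta>"
  have tri: "tri 1 n \<xi> = down_prod 2 n (\<xi> 1) * h_elem (Idx 1) (\<xi> 1) * down_prod 2 n (\<xi> 2) * tri 3 n \<xi>" for \<xi> :: "nat \<Rightarrow> 'a"
  proof -
    have "Suc 2 = (3 :: nat)" by simp
    then show ?thesis using assms tri_step[of 1 n \<xi>, unfolded Suc_1] tri_step[of 2 n \<xi>]
        down_prod_step[of 1 n "\<xi> 1", unfolded Suc_1] by (simp add: mult.assoc del: One_nat_def)
  qed
  have T: "tri 3 n (\<zeta>(1 := - ?y, 2 := - ?x)) = ?T" by (rule tri_cong) simp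
  have C_prod: "C_prod TypeD n z = down_prod 2 n z * h_elem (Idx 1) z * h_elem Hat1 z * up_prod 2 n z" for z :: 'a
    by (simp add: C_prod_def mult.assoc)
  have 1: "C_prod TypeD n ?y * (down_prod 2 n (- ?y) * h_elem (Idx 1) (- ?y)) = down_prod 2 n ?y * h_elem Hat1 ?y"
  proof -
    have "C_prod TypeD n ?y * (down_prod 2 n (- ?y) * h_elem (Idx 1) (- ?y))
        = down_prod 2 n ?y * (h_elem (Idx 1) ?y * h_elem Hat1 ?y) * (up_prod 2 n ?y * down_prod 2 n (- ?y)) * h_elem (Idx 1) (- ?y)"
      by (simp only: C_prod mult.assoc)
    also have "\<dots> = down_prod 2 n ?y * h_elem Hat1 ?y * (h_elem (Idx 1) ?y * h_elem (Idx 1) (- ?y))"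
      by (simp only: up_prod_down_prod h1_hat_commute mult_1_right mult.assoc)
    finally show ?thesis by (simp add: h_elem_add)
  qed
  \<comment> \<open>Exchanging the blocks at \<open>y\<close> and \<open>- x\<close> brings the
    block at \<open>- x\<close> to the left, where it meets the right arm of \<open>C(x)\<close> and
    cancels.\<close>
  have 2: "C_prod TypeD n ?x * (down_prod 2 n ?y * h_elem Hat1 ?y * down_prod 2 n (- ?x))
      = down_prod 2 n ?x * h_elem (Idx 1) ?x * down_prod 2 n ?y * h_elem Hat1 (?x + ?y)"
  proof -
    have "C_prod TypeD n ?x * (down_prod 2 n ?y * h_elem Hat1 ?y * down_prod 2 n (- ?x))
      = down_prod 2 n ?x * h_elem (Idx 1) ?x * h_elem Hat1 ?x * (up_prod 2 n ?x * down_prod 2 n (- ?x)) * h_elem Hat1 (- ?x) * down_prod 2 n ?y * h_elem Hat1 (?y - (- ?x))"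
      by (simp only: down_prod_swap_hat[of n ?y "- ?x"]) (simp only: C_prod mult.assoc)
    also have "\<dots> = down_prod 2 n ?x * h_elem (Idx 1) ?x * (h_elem Hat1 ?x * h_elem Hat1 (- ?x)) * down_prod 2 n ?y * h_elem Hat1 (?x + ?y)"
      by (simp add: up_prod_down_prod mult.assoc add.commute)
    finally show ?thesis by (simp add: h_elem_add)
  qed
  have T_comm: "h_elem Hat1 a * ?T = ?T * h_elem Hat1 a" for a
    by (rule h_elem_tri_commute) (simp add: braid2_Hat1)
  have "C_prod TypeD n ?x * C_prod TypeD n ?y * tri 1 n (\<zeta>(1 := - ?y, 2 := - ?x))
    = C_prod TypeD n ?x * (C_prod TypeD n ?y * (down_prod 2 n (- ?y) * h_elem (Idx 1) (- ?y))) * down_prod 2 n (- ?x) * ?T"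
    unfolding tri T by (simp add: mult.assoc)
  also have "\<dots> = (C_prod TypeD n ?x * (down_prod 2 n ?y * h_elem Hat1 ?y * down_prod 2 n (- ?x))) * ?T"
    by (simp only: 1 mult.assoc)
  also have "\<dots> = down_prod 2 n ?x * h_elem (Idx 1) ?x * down_prod 2 n ?y * (h_elem Hat1 (?x + ?y) * ?T)"
    by (simp only: 2) (simp only: mult.assoc)
  also have "\<dots> = tri 1 n \<zeta> * h_elem Hat1 (?x + ?y)"
    by (simp only: T_comm tri mult.assoc)
  finally show ?thesis .
qed

subsection \<open>Stability\<close>

lemma ncong_prod_list:
  assumes "\<And>j. j \<in> set js \<Longrightarrow> ncong Y m (f j) (g j)"
  shows "ncong Y m (prod_list (map f js)) (prod_list (map g js))"
  using assms by (induction js) (auto intro: ncong_mult)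

lemma ncong_down_prod: "m \<le> n \<Longrightarrow> ncong Y m (down_prod i n z) (down_prod i m z)"
proof (induction n rule: dec_induct)
  case (step n)
  show ?case
  proof (cases "i \<le> n")
    case True
    have "ncong Y m (h_elem (Idx n) z * down_prod i n z) (1 * down_prod i m z)"
      by (rule ncong_mult[OF ncong_h_elem step.IH]) (use step.hyps in simp)
    then show ?thesis by (simp add: down_prod_Suc True)
  qed (use step.hyps in simp)
qed simp

lemma ncong_up_prod: "m \<le> n \<Longrightarrow> ncong Y m (up_prod i n z) (up_prod i m z)"
  using ncong_nrev[OF ncong_down_prod] by (simp add: nrev_down_prod)

lemma ncong_C_prod: "m \<le> n \<Longrightarrow> ncong Y m (C_prod Y n z) (C_prod Y m z)"
  unfolding C_prod_def by (intro ncong_mult ncong_down_prod ncong_up_prod ncong_refl)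

lemma ncong_tri:
  assumes "m \<le> n" shows "ncong Y m (tri i n \<zeta>) (tri i m \<zeta>)"
proof -
  \<comment> \<open>Once the letters are cut off at \<open>m\<close>, the blocks with j >= m are
    empty.\<close>
  have "prod_list (map (\<lambda>j. down_prod j m (\<zeta> j)) [i..<n]) = tri i m \<zeta>"
    using assms
  proof (induction n rule: dec_induct)
    case (step n)
    then show ?case by (cases "i \<le> n") (auto simp: tri_def)
  qed (simp add: tri_def)
  moreover have "ncong Y m (tri i n \<zeta>) (prod_list (map (\<lambda>j. down_prod j m (\<zeta> j)) [i..<n]))"
    unfolding tri_def by (rule ncong_prod_list) (simp add: ncong_down_prod assms)
  ultimately show ?thesis by simp
qed

section \<open>Substitutions as ring homomorphisms\<close>

lemma coeff_zero [simp]: "coeff 0 m = 0"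
  and coeff_one: "coeff 1 m = (if m = 0 then 1 else 0)"
  and coeff_plus [simp]: "coeff (f + g) m = coeff f m + coeff g m"
  and coeff_minus [simp]: "coeff (f - g) m = coeff f m - coeff g m"
  and coeff_uminus [simp]: "coeff (- f) m = - coeff f m"
  and coeff_times: "coeff (f * g) m = (\<Sum>(a, b) | a + b = m. coeff f a * coeff g b)"
  by (simp_all add: zero_mseries_def one_mseries_def plus_mseries_def minus_mseries_def
      uminus_mseries_def times_mseries_def)

lemma coeff_sum [simp]: "coeff (sum f A) m = (\<Sum>x\<in>A. coeff (f x) m)"
  by (induction A rule: infinite_finite_induct) simp_all

lemma coeff_Var: "coeff (Var v) m = (if m = Poly_Mapping.single v 1 then 1 else 0)"
  by (simp add: Var_def)

lemma plus_eq_0_monomial: "a + b = (0 :: 'v monomial) \<longleftrightarrow> a = 0 \<and> b = 0"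
  by (auto simp: poly_mapping_eq_iff fun_eq_iff lookup_add)

lemma ring_hom_const_coeff: "ring_hom (\<lambda>f :: ('v, 'a :: comm_ring_1) mseries. coeff f 0)"
proof -
  have "{(a, b). a + b = (0 :: 'v monomial)} = {(0, 0)}" by (auto simp: plus_eq_0_monomial)
  then show ?thesis by (simp add: ring_hom_def coeff_one coeff_times)
qed

lemma coeff_of_int_mult: "coeff (of_int n * f) m = of_int n * coeff f m"
proof -
  have nat: "coeff (of_nat k * f) m = of_nat k * coeff f m" for k
    by (induction k) (simp_all add: distrib_right)
  show ?thesis by (cases n) (simp_all add: nat distrib_right left_diff_distrib)
qed

lemma keys_plus_monomial: "variables (a + b :: 'v monomial) = variables a \<union> variables b"
  by (auto simp: in_keys_iff lookup_add)

lemma rename_monomial_superset: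
  assumes "finite A" "variables m \<subseteq> A"
  shows "rename_monomial \<sigma> m = (\<Sum>v\<in>A. Poly_Mapping.single (\<sigma> v) (exponent m v))"
  unfolding rename_monomial_def
  by (rule sum.mono_neutral_left) (use assms in \<open>auto simp: in_keys_iff\<close>)

lemma rename_zero [simp]: "rename_monomial \<sigma> 0 = 0"
  by (simp add: rename_monomial_def)

lemma rename_add: "rename_monomial \<sigma> (a + b) = rename_monomial \<sigma> a + rename_monomial \<sigma> b"
  using rename_monomial_superset[of "variables a \<union> variables b" "a + b" \<sigma>]
    rename_monomial_superset[of "variables a \<union> variables b" a \<sigma>]
    rename_monomial_superset[of "variables a \<union> variables b" b \<sigma>]
  by (simp add: keys_plus_monomial sum.distrib[symmetric] lookup_add single_add)

lemma rename_single [simp]: "rename_monomial \<sigma> (Poly_Mapping.single v k) = Poly_Mapping.single (\<sigma> v) k"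
  using rename_monomial_superset[of "{v}" "Poly_Mapping.single v k" \<sigma>] by simp

lemma rename_sum: "rename_monomial \<sigma> (sum f A) = (\<Sum>x\<in>A. rename_monomial \<sigma> (f x))"
  by (induction A rule: infinite_finite_induct) (simp_all add: rename_add)

lemma rename_comp: "rename_monomial \<tau> (rename_monomial \<sigma> m) = rename_monomial (\<tau> \<circ> \<sigma>) m"
  by (simp add: rename_monomial_def[of \<sigma>] rename_monomial_def[of "\<tau> \<circ> \<sigma>"] rename_sum)

lemma monomial_decomp: "m = (\<Sum>v\<in>variables m. Poly_Mapping.single v (exponent m v))"
proof (rule poly_mapping_eqI)
  fix w
  have "exponent (\<Sum>v\<in>variables m. Poly_Mapping.single v (exponent m v)) w
    = (\<Sum>v\<in>variables m. if v = w then exponent m v else 0)"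
    by (simp add: lookup_sum lookup_single when_def)
  also have "\<dots> = exponent m w" by (simp add: in_keys_iff)
  finally show "exponent m w = exponent (\<Sum>v\<in>variables m. Poly_Mapping.single v (exponent m v)) w" by simp
qed

lemma rename_id: "(\<And>v. v \<in> variables m \<Longrightarrow> \<sigma> v = v) \<Longrightarrow> rename_monomial \<sigma> m = m"
  using monomial_decomp[of m] by (simp add: rename_monomial_def)

lemma exponent_rename: "exponent (rename_monomial \<sigma> m) w = (\<Sum>v | v \<in> variables m \<and> \<sigma> v = w. exponent m v)"
proof -
  have "exponent (rename_monomial \<sigma> m) w = (\<Sum>v\<in>variables m. if \<sigma> v = w then exponent m v else 0)"
    by (simp add: rename_monomial_def lookup_sum lookup_single when_def)
  also have "\<dots> = (\<Sum>v\<in>{v \<in> variables m. \<sigma> v = w}. exponent m v)"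
    by (rule sum.inter_filter[symmetric]) simp
  finally show ?thesis .
qed

lemma variables_rename: "variables (rename_monomial \<sigma> m) = \<sigma> ` variables m"
proof (rule set_eqI)
  fix w
  show "w \<in> variables (rename_monomial \<sigma> m) \<longleftrightarrow> w \<in> \<sigma> ` variables m"
    unfolding in_keys_iff[of w] exponent_rename
    by (subst sum_eq_0_iff) (auto simp: in_keys_iff)
qed

text \<open>Injectivity would be too much to ask: \<open>shift_to_z\<close> sends both
  \<open>Z_var 1\<close> and \<open>X_var 1\<close> to \<open>Z_var 1\<close>. Finite fibres still
  make each coefficient of a substituted series a finite sum.\<close>

definition finite_fibres :: "('v \<Rightarrow> 'w) \<Rightarrow> bool" where
  "finite_fibres \<sigma> \<longleftrightarrow> (\<forall>w. finite (\<sigma> -` {w}))"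

lemma finite_fibres_comp:
  assumes "finite_fibres \<sigma>" "finite_fibres \<tau>" shows "finite_fibres (\<tau> \<circ> \<sigma>)"
  unfolding finite_fibres_def
proof
  fix w
  have "(\<tau> \<circ> \<sigma>) -` {w} = (\<Union>u\<in>\<tau> -` {w}. \<sigma> -` {u})" by auto
  then show "finite ((\<tau> \<circ> \<sigma>) -` {w})" using assms by (auto simp: finite_fibres_def)
qed

lemma finite_fibres_inj: "inj \<sigma> \<Longrightarrow> finite_fibres \<sigma>"
  by (simp add: finite_fibres_def finite_vimageI)

lemma finite_rename_fibre:
  assumes "finite_fibres \<sigma>" shows "finite {m'. rename_monomial \<sigma> m' = m}"
proof -
  let ?V = "\<Union>w\<in>variables m. \<sigma> -` {w}"
  have fin: "finite ?V" using assms by (auto simp: finite_fibres_def)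
  \<comment> \<open>A monomial that dominates all preimages, since an exponent of a preimage at
    \<open>v\<close> is at most that of \<open>m\<close> at \<open>\<sigma> v\<close>.\<close>
  let ?M = "\<Sum>v\<in>?V. Poly_Mapping.single v (exponent m (\<sigma> v))"
  have M: "exponent ?M v = (if v \<in> ?V then exponent m (\<sigma> v) else 0)" for v
    using fin by (simp add: lookup_sum lookup_single when_def)
  have "{m'. rename_monomial \<sigma> m' = m} \<subseteq> {a. \<forall>v. exponent a v \<le> exponent ?M v}"
  proof (intro subsetI CollectI allI)
    fix m' v assume "m' \<in> {m'. rename_monomial \<sigma> m' = m}"
    then have m: "m = rename_monomial \<sigma> m'" by simp
    show "exponent m' v \<le> exponent ?M v"
    proof (cases "v \<in> variables m'")
      case True
      then have "v \<in> ?V" by (auto simp: m variables_rename)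
      moreover have "exponent m' v \<le> exponent m (\<sigma> v)"
        unfolding m exponent_rename using True by (intro member_le_sum) auto
      ultimately show ?thesis unfolding M by simp
    qed (simp add: in_keys_iff)
  qed
  then show ?thesis using finite_monomials_below by (rule finite_subset)
qed

definition sgn_monomial :: "('v \<Rightarrow> 'a :: comm_ring_1) \<Rightarrow> 'v monomial \<Rightarrow> 'a" where
  "sgn_monomial \<epsilon> m = (\<Prod>v\<in>variables m. \<epsilon> v ^ exponent m v)"

lemma sgn_superset:
  "finite A \<Longrightarrow> variables m \<subseteq> A \<Longrightarrow> sgn_monomial \<epsilon> m = (\<Prod>v\<in>A. \<epsilon> v ^ exponent m v)"
  unfolding sgn_monomial_def by (rule prod.mono_neutral_left) (auto simp: in_keys_iff)

lemma sgn_zero [simp]: "sgn_monomial \<epsilon> 0 = 1"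
  by (simp add: sgn_monomial_def)

lemma sgn_add: "sgn_monomial \<epsilon> (a + b) = sgn_monomial \<epsilon> a * sgn_monomial \<epsilon> b"
  using sgn_superset[of "variables a \<union> variables b" "a + b" \<epsilon>]
    sgn_superset[of "variables a \<union> variables b" a \<epsilon>]
    sgn_superset[of "variables a \<union> variables b" b \<epsilon>]
  by (simp add: keys_plus_monomial prod.distrib[symmetric] lookup_add power_add)

lemma sgn_single [simp]: "sgn_monomial \<epsilon> (Poly_Mapping.single v k) = \<epsilon> v ^ k"
  using sgn_superset[of "{v}" "Poly_Mapping.single v k" \<epsilon>] by simp

lemma sgn_sum: "sgn_monomial \<epsilon> (sum f A) = (\<Prod>x\<in>A. sgn_monomial \<epsilon> (f x))"
  by (induction A rule: infinite_finite_induct) (simp_all add: sgn_add)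

lemma sgn_rename: "sgn_monomial \<eta> (rename_monomial \<sigma> m) = sgn_monomial (\<lambda>v. \<eta> (\<sigma> v)) m"
  by (simp add: rename_monomial_def sgn_sum) (simp add: sgn_monomial_def)

lemma coeff_substitute:
  "coeff (substitute \<sigma> \<epsilon> f) m = (\<Sum>m' | rename_monomial \<sigma> m' = m. sgn_monomial \<epsilon> m' * coeff f m')"
  by (simp add: substitute_def sgn_monomial_def)

lemma ring_hom_substitute:
  fixes \<sigma> :: "'v \<Rightarrow> 'w" and \<epsilon> :: "'v \<Rightarrow> 'a :: comm_ring_1"
  assumes fin: "finite_fibres \<sigma>"
  shows "ring_hom (substitute \<sigma> \<epsilon>)"
  unfolding ring_hom_def
proof (intro conjI allI)
  note [simp] = finite_rename_fibre[OF fin]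
  have "rename_monomial \<sigma> m' = 0 \<longleftrightarrow> m' = 0" for m'
    by (metis image_is_empty keys_eq_empty variables_rename)
  then show "substitute \<sigma> \<epsilon> 1 = 1"
    by (intro mseries_eqI) (auto simp: coeff_substitute coeff_one if_distrib[of "\<lambda>x. _ * x"] cong: if_cong)
  fix f g :: "('v, 'a) mseries"
  show "substitute \<sigma> \<epsilon> (f + g) = substitute \<sigma> \<epsilon> f + substitute \<sigma> \<epsilon> g"
    by (rule mseries_eqI) (simp add: coeff_substitute distrib_left sum.distrib)
  show "substitute \<sigma> \<epsilon> (f * g) = substitute \<sigma> \<epsilon> f * substitute \<sigma> \<epsilon> g"
  proof (rule mseries_eqI)
    fix m :: "'w monomial"
    let ?F = "\<lambda>m. {m'. rename_monomial \<sigma> m' = m}" and ?S = "\<lambda>m. {(a, b). a + b = m}"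
    let ?t = "\<lambda>a b. sgn_monomial \<epsilon> a * coeff f a * (sgn_monomial \<epsilon> b * coeff g b)"
    have finS: "finite {(a, b). a + b = m'}" for m' :: "'v monomial" by simp
    have "coeff (substitute \<sigma> \<epsilon> (f * g)) m = (\<Sum>m'\<in>?F m. \<Sum>p\<in>?S m'. ?t (fst p) (snd p))"
      by (auto simp: coeff_substitute coeff_times sum_distrib_left sgn_add case_prod_unfold mult_ac intro!: sum.cong)
    also have "\<dots> = (\<Sum>(m', p)\<in>(SIGMA m' : ?F m. ?S m'). ?t (fst p) (snd p))"
      by (rule sum.Sigma) (use finS in auto)
    also have "\<dots> = (\<Sum>(q, p)\<in>(SIGMA q : ?S m. ?F (fst q) \<times> ?F (snd q)). ?t (fst p) (snd p))"
      by (rule sum.reindex_bij_witness[where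
            i = "\<lambda>(q, p). (fst p + snd p, p)" and
            j = "\<lambda>(m', p). ((rename_monomial \<sigma> (fst p), rename_monomial \<sigma> (snd p)), p)"])
        (auto simp: rename_add)
    also have "\<dots> = (\<Sum>q\<in>?S m. \<Sum>p\<in>?F (fst q) \<times> ?F (snd q). ?t (fst p) (snd p))"
      by (rule sum.Sigma[symmetric]) auto
    also have "\<dots> = (\<Sum>(a, b)\<in>?S m. coeff (substitute \<sigma> \<epsilon> f) a * coeff (substitute \<sigma> \<epsilon> g) b)"
      by (auto simp: coeff_substitute sum_product sum.cartesian_product case_prod_unfold intro!: sum.cong)
    finally show "coeff (substitute \<sigma> \<epsilon> (f * g)) m = coeff (substitute \<sigma> \<epsilon> f * substitute \<sigma> \<epsilon> g) m"
      by (simp add: coeff_times)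
  qed
qed

lemma substitute_comp:
  assumes "finite_fibres \<sigma>" "finite_fibres \<tau>"
  shows "substitute \<tau> \<eta> (substitute \<sigma> \<epsilon> f) = substitute (\<tau> \<circ> \<sigma>) (\<lambda>v. \<epsilon> v * \<eta> (\<sigma> v)) f"
proof (rule mseries_eqI)
  fix m
  note [simp] = finite_rename_fibre[OF assms(1)] finite_rename_fibre[OF assms(2)]
    finite_rename_fibre[OF finite_fibres_comp[OF assms]]
  let ?F = "\<lambda>m. {m'. rename_monomial \<sigma> m' = m}" and ?G = "\<lambda>m. {m'. rename_monomial \<tau> m' = m}"
  let ?t = "\<lambda>q. sgn_monomial \<eta> (rename_monomial \<sigma> q) * sgn_monomial \<epsilon> q * coeff f q"
  have sgn: "sgn_monomial \<eta> (rename_monomial \<sigma> q) * sgn_monomial \<epsilon> q = sgn_monomial (\<lambda>v. \<epsilon> v * \<eta> (\<sigma> v)) q" for q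
    unfolding sgn_rename by (simp add: sgn_monomial_def power_mult_distrib prod.distrib mult.commute)
  have "coeff (substitute \<tau> \<eta> (substitute \<sigma> \<epsilon> f)) m = (\<Sum>p\<in>?G m. \<Sum>q\<in>?F p. ?t q)"
    by (auto simp: coeff_substitute sum_distrib_left mult_ac intro!: sum.cong)
  also have "\<dots> = (\<Sum>(p, q)\<in>(SIGMA p : ?G m. ?F p). ?t q)"
    by (rule sum.Sigma) auto
  also have "\<dots> = (\<Sum>q | rename_monomial (\<tau> \<circ> \<sigma>) q = m. ?t q)"
    by (rule sum.reindex_bij_witness[where i = "\<lambda>q. (rename_monomial \<sigma> q, q)" and j = snd])
      (auto simp: rename_comp)
  also have "\<dots> = coeff (substitute (\<tau> \<circ> \<sigma>) (\<lambda>v. \<epsilon> v * \<eta> (\<sigma> v)) f) m"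
    by (simp add: coeff_substitute sgn)
  finally show "coeff (substitute \<tau> \<eta> (substitute \<sigma> \<epsilon> f)) m
    = coeff (substitute (\<tau> \<circ> \<sigma>) (\<lambda>v. \<epsilon> v * \<eta> (\<sigma> v)) f) m" .
qed

lemma substitute_Var:
  assumes "finite_fibres \<sigma>"
  shows "substitute \<sigma> \<epsilon> (Var v) = Series (\<lambda>m. if m = Poly_Mapping.single (\<sigma> v) 1 then \<epsilon> v else 0)"
proof (rule mseries_eqI)
  fix m
  note [simp] = finite_rename_fibre[OF assms]
  have "coeff (substitute \<sigma> \<epsilon> (Var v)) m
      = (\<Sum>m' | rename_monomial \<sigma> m' = m. if m' = Poly_Mapping.single v 1 then \<epsilon> v else 0)"
    unfolding coeff_substitute by (rule sum.cong) (auto simp: coeff_Var)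
  then show "coeff (substitute \<sigma> \<epsilon> (Var v)) m
      = coeff (Series (\<lambda>m. if m = Poly_Mapping.single (\<sigma> v) 1 then \<epsilon> v else 0)) m"
    by auto
qed

lemma substitute_Var_pos:
  "finite_fibres \<sigma> \<Longrightarrow> \<epsilon> v = 1 \<Longrightarrow> substitute \<sigma> \<epsilon> (Var v) = Var (\<sigma> v)"
  by (simp only: substitute_Var) (simp add: Var_def)

lemma substitute_Var_neg:
  "finite_fibres \<sigma> \<Longrightarrow> \<epsilon> v = - 1 \<Longrightarrow> substitute \<sigma> \<epsilon> (Var v) = - Var (\<sigma> v)"
  by (rule mseries_eqI) (simp add: substitute_Var coeff_Var)

section \<open>Series supported on a set of variables\<close>

definition supp_in :: "'v set \<Rightarrow> ('v, 'a :: comm_ring_1) mseries \<Rightarrow> bool" where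
  "supp_in V f \<longleftrightarrow> (\<forall>m. coeff f m \<noteq> 0 \<longrightarrow> variables m \<subseteq> V)"

lemma supp_in_mono: "supp_in V f \<Longrightarrow> V \<subseteq> V' \<Longrightarrow> supp_in V' f"
  by (auto simp: supp_in_def)

lemma supp_in_one: "supp_in V 1"
  by (simp add: supp_in_def coeff_one)

lemma supp_in_zero: "supp_in V 0"
  by (simp add: supp_in_def)

lemma supp_in_Var: "v \<in> V \<Longrightarrow> supp_in V (Var v)"
  by (simp add: supp_in_def coeff_Var)

lemma supp_in_plus: "supp_in V f \<Longrightarrow> supp_in V g \<Longrightarrow> supp_in V (f + g)"
  unfolding supp_in_def by (metis add.right_neutral coeff_plus)

lemma supp_in_minus: "supp_in V f \<Longrightarrow> supp_in V g \<Longrightarrow> supp_in V (f - g)"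
  unfolding supp_in_def by (metis coeff_minus diff_zero diff_self)

lemma supp_in_times:
  assumes "supp_in V f" "supp_in V g" shows "supp_in V (f * g)"
  unfolding supp_in_def
proof (intro allI impI)
  fix m assume "coeff (f * g) m \<noteq> 0"
  then obtain p where "p \<in> {(a, b). a + b = m}" "(case p of (a, b) \<Rightarrow> coeff f a * coeff g b) \<noteq> 0"
    unfolding coeff_times by (meson sum.not_neutral_contains_not_neutral)
  then obtain a b where "a + b = m" "coeff f a * coeff g b \<noteq> 0" by auto
  then have "a + b = m" "coeff f a \<noteq> 0" "coeff g b \<noteq> 0" by (auto dest: mult_not_zero)
  then show "variables m \<subseteq> V" using assms unfolding supp_in_def by (metis Un_least keys_plus_monomial)
qed

lemma supp_in_power: "supp_in V f \<Longrightarrow> supp_in V (f ^ n)"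
  by (induction n) (simp_all add: supp_in_one supp_in_times)

lemma supp_in_sum: "(\<And>x. x \<in> A \<Longrightarrow> supp_in V (f x)) \<Longrightarrow> supp_in V (sum f A)"
  by (induction A rule: infinite_finite_induct) (simp_all add: supp_in_zero supp_in_plus)

lemma supp_in_substitute:
  assumes "supp_in V f" "\<And>v. v \<in> V \<Longrightarrow> \<sigma> v \<in> V'" shows "supp_in V' (substitute \<sigma> \<epsilon> f)"
  unfolding supp_in_def
proof (intro allI impI)
  fix m assume "coeff (substitute \<sigma> \<epsilon> f) m \<noteq> 0"
  then obtain m' where "rename_monomial \<sigma> m' = m" "sgn_monomial \<epsilon> m' * coeff f m' \<noteq> 0"
    unfolding coeff_substitute by (metis (mono_tags, lifting) mem_Collect_eq sum.not_neutral_contains_not_neutral)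
  then have "variables m' \<subseteq> V" "variables m = \<sigma> ` variables m'"
    using assms(1) variables_rename[of \<sigma> m'] mult_zero_right[of "sgn_monomial \<epsilon> m'"]
    unfolding supp_in_def by metis+
  then show "variables m \<subseteq> V'" using assms(2) by auto
qed

text \<open>With \<open>\<sigma>\<close> invertible on the support, no summation remains and
  coefficients are merely moved. This covers the swaps of variables as well as the shift of the
  \<open>x_j\<close>.\<close>

lemma coeff_substitute_inverse:
  assumes fin: "finite_fibres \<sigma>" and f: "supp_in V f"
    and \<tau>: "\<And>v. v \<in> V \<Longrightarrow> \<tau> (\<sigma> v) = v \<and> \<epsilon> v = 1"
    and m: "\<And>w. w \<in> variables m \<Longrightarrow> \<sigma> (\<tau> w) = w"
  shows "coeff (substitute \<sigma> \<epsilon> f) m = coeff f (rename_monomial \<tau> m)"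
proof -
  note [simp] = finite_rename_fibre[OF fin]
  have rr: "rename_monomial \<sigma> (rename_monomial \<tau> m) = m"
    unfolding rename_comp by (rule rename_id) (simp add: m)
  have "coeff (substitute \<sigma> \<epsilon> f) m = (\<Sum>m'\<in>{rename_monomial \<tau> m}. sgn_monomial \<epsilon> m' * coeff f m')"
    unfolding coeff_substitute
  proof (rule sum.mono_neutral_right)
    show "\<forall>m'\<in>{m'. rename_monomial \<sigma> m' = m} - {rename_monomial \<tau> m}. sgn_monomial \<epsilon> m' * coeff f m' = 0"
    proof
      fix m' assume "m' \<in> {m'. rename_monomial \<sigma> m' = m} - {rename_monomial \<tau> m}"
      then have "rename_monomial (\<tau> \<circ> \<sigma>) m' \<noteq> m'" by (auto simp: rename_comp[symmetric])
      then have "\<not> variables m' \<subseteq> V" using \<tau> rename_id[of m' "\<tau> \<circ> \<sigma>"] by auto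
      then have "coeff f m' = 0" using f by (auto simp: supp_in_def)
      then show "sgn_monomial \<epsilon> m' * coeff f m' = 0" by simp
    qed
  qed (simp_all add: rr)
  also have "\<dots> = coeff f (rename_monomial \<tau> m)"
  proof (cases "coeff f (rename_monomial \<tau> m) = 0")
    case False
    then have "variables (rename_monomial \<tau> m) \<subseteq> V" using f by (auto simp: supp_in_def)
    then have "sgn_monomial \<epsilon> (rename_monomial \<tau> m) = 1"
      unfolding sgn_monomial_def using \<tau> by (intro prod.neutral) auto
    then show ?thesis by simp
  qed simp
  finally show ?thesis .
qed

lemma substitute_fix:
  assumes fin: "finite_fibres \<sigma>" and f: "supp_in V f" and \<sigma>: "\<And>v. v \<in> V \<Longrightarrow> \<sigma> v = v \<and> \<epsilon> v = 1"
  shows "substitute \<sigma> \<epsilon> f = f"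
proof (rule mseries_eqI)
  fix m
  show "coeff (substitute \<sigma> \<epsilon> f) m = coeff f m"
  proof (cases "variables m \<subseteq> V")
    case True
    then show ?thesis
      using coeff_substitute_inverse[OF fin f, of id \<epsilon> m] \<sigma> rename_id[of m id] by auto
  next
    case False
    have "supp_in V (substitute \<sigma> \<epsilon> f)" using f by (rule supp_in_substitute) (use \<sigma> in auto)
    then show ?thesis using False f by (metis supp_in_def)
  qed
qed

subsection \<open>Coefficients of powers of one variable\<close>

text \<open>The guard on the exponent makes the result free of the variable
  \<open>v\<close>.\<close>

definition var_coeff :: "'v \<Rightarrow> nat \<Rightarrow> ('v, 'a :: comm_ring_1) mseries \<Rightarrow> ('v, 'a) mseries" where
  "var_coeff v k g = Series (\<lambda>m. if exponent m v = 0 then coeff g (m + Poly_Mapping.single v k) else 0)"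

lemma coeff_var_coeff: "coeff (var_coeff v k g) m = (if exponent m v = 0 then coeff g (m + Poly_Mapping.single v k) else 0)"
  by (simp add: var_coeff_def)

lemma var_coeff_add: "var_coeff v k (f + g) = var_coeff v k f + var_coeff v k g"
  and var_coeff_diff: "var_coeff v k (f - g) = var_coeff v k f - var_coeff v k g"
  by (rule mseries_eqI; simp add: coeff_var_coeff)+

lemma var_coeff_mult:
  fixes f g :: "('v, 'a :: comm_ring_1) mseries"
  shows "var_coeff v k (f * g) = (\<Sum>i\<le>k. var_coeff v i f * var_coeff v (k - i) g)"
proof (rule mseries_eqI)
  fix m
  show "coeff (var_coeff v k (f * g)) m = coeff (\<Sum>i\<le>k. var_coeff v i f * var_coeff v (k - i) g) m"
  proof (cases "exponent m v = 0")
    case False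
    have "coeff (var_coeff v i f) a * coeff (var_coeff v j g) b = 0" if "a + b = m" for a b i j
    proof -
      have "exponent a v + exponent b v \<noteq> 0" using False that by (auto simp: lookup_add)
      then show ?thesis by (auto simp: coeff_var_coeff)
    qed
    then show ?thesis using False by (auto simp: coeff_var_coeff[of v k] coeff_times intro!: sum.neutral[symmetric] sum.neutral)
  next
    case True
    let ?s = "Poly_Mapping.single v"
    let ?S = "{(a, b). a + b = m}"
    have v0: "exponent a v = 0 \<and> exponent b v = 0" if "a + b = m" for a b
      using True that by (auto simp: lookup_add)
    have "coeff (\<Sum>i\<le>k. var_coeff v i f * var_coeff v (k - i) g) m
        = (\<Sum>i\<le>k. \<Sum>p\<in>?S. coeff f (fst p + ?s i) * coeff g (snd p + ?s (k - i)))"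
      using v0 by (auto simp: coeff_times coeff_var_coeff case_prod_unfold intro!: sum.cong)
    also have "\<dots> = (\<Sum>(i, p)\<in>{..k} \<times> ?S. coeff f (fst p + ?s i) * coeff g (snd p + ?s (k - i)))"
      by (rule sum.cartesian_product)
    also have "\<dots> = (\<Sum>p | fst p + snd p = m + ?s k. coeff f (fst p) * coeff g (snd p))"
    \<comment> \<open>The summation index \<open>i\<close> is recovered as the exponent of
      \<open>v\<close> in the first factor.\<close>
    proof (rule sum.reindex_bij_witness[where
          j = "\<lambda>(i, p). (fst p + ?s i, snd p + ?s (k - i))" and
          i = "\<lambda>p. (exponent (fst p) v, (fst p - ?s (exponent (fst p) v), snd p - ?s (exponent (snd p) v)))"])
      fix x assume x: "x \<in> {..k} \<times> ?S"
      then obtain i a b where [simp]: "x = (i, (a, b))" and i: "i \<le> k" and ab: "a + b = m" by auto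
      have e: "exponent a v = 0" "exponent b v = 0" using v0[OF ab] by auto
      show "(\<lambda>p. (exponent (fst p) v, (fst p - ?s (exponent (fst p) v), snd p - ?s (exponent (snd p) v))))
          ((\<lambda>(i, p). (fst p + ?s i, snd p + ?s (k - i))) x) = x"
        using e by (auto simp: lookup_add intro!: poly_mapping_eqI)
      have "a + ?s i + (b + ?s (k - i)) = m + ?s k"
        using ab i by (metis (no_types, lifting) add.assoc add.commute le_add_diff_inverse single_add)
      then show "(\<lambda>(i, p). (fst p + ?s i, snd p + ?s (k - i))) x \<in> {p. fst p + snd p = m + ?s k}" by simp
      show "(case (\<lambda>(i, p). (fst p + ?s i, snd p + ?s (k - i))) x of p \<Rightarrow> coeff f (fst p) * coeff g (snd p))
          = (case x of (i, p) \<Rightarrow> coeff f (fst p + ?s i) * coeff g (snd p + ?s (k - i)))" by simp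
    next
      fix p assume "p \<in> {p. fst p + snd p = m + ?s k}"
      then obtain a b where [simp]: "p = (a, b)" and ab: "a + b = m + ?s k" by (cases p) auto
      have e: "exponent a w + exponent b w = exponent m w + (if w = v then k else 0)" for w
        using arg_cong[OF ab, of "\<lambda>m. exponent m w"] by (simp add: lookup_add lookup_single when_def)
      have ev: "exponent a v + exponent b v = k" using e[of v] True by simp
      have a: "a - ?s (exponent a v) + ?s (exponent a v) = a"
        by (rule poly_mapping_eqI) (simp add: lookup_add lookup_minus lookup_single when_def)
      have b: "b - ?s (exponent b v) + ?s (exponent b v) = b"
        by (rule poly_mapping_eqI) (simp add: lookup_add lookup_minus lookup_single when_def)
      have kb: "k - exponent a v = exponent b v" using ev by simp
      show "(\<lambda>(i, p). (fst p + ?s i, snd p + ?s (k - i)))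
          ((\<lambda>p. (exponent (fst p) v, (fst p - ?s (exponent (fst p) v), snd p - ?s (exponent (snd p) v)))) p) = p"
        by (simp add: kb a b)
      have "exponent (a - ?s (exponent a v) + (b - ?s (exponent b v))) w = exponent m w" for w
        using e[of w] True by (cases "w = v") (simp_all add: lookup_add lookup_minus lookup_single when_def)
      then have "a - ?s (exponent a v) + (b - ?s (exponent b v)) = m" by (rule poly_mapping_eqI)
      then show "(\<lambda>p. (exponent (fst p) v, (fst p - ?s (exponent (fst p) v), snd p - ?s (exponent (snd p) v)))) p
          \<in> {..k} \<times> ?S" using ev by simp
    qed
    also have "\<dots> = coeff (var_coeff v k (f * g)) m"
      using True by (simp add: coeff_var_coeff coeff_times case_prod_unfold)
    finally show ?thesis by simp
  qed
qed

lemma coeff_Var_mult: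
  "coeff (Var v * g) m = (if exponent m v = 0 then 0 else coeff g (m - Poly_Mapping.single v 1))"
proof (cases "exponent m v = 0")
  case True
  have "coeff (Var v) a * coeff g b = 0" if "a + b = m" for a b
    using True that by (auto simp: coeff_Var lookup_add)
  then show ?thesis using True by (auto simp: coeff_times intro!: sum.neutral)
next
  case False
  let ?s = "Poly_Mapping.single v (1 :: nat)"
  have m: "?s + (m - ?s) = m"
    using False by (intro poly_mapping_eqI) (auto simp: lookup_add lookup_minus lookup_single when_def)
  have "coeff (Var v * g) m = (\<Sum>(a, b)\<in>{(?s, m - ?s)}. coeff (Var v) a * coeff g b)"
    unfolding coeff_times using m by (intro sum.mono_neutral_right) (auto simp: coeff_Var split: if_splits)
  then show ?thesis using False by (simp add: coeff_Var)
qed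

lemma coeff_Var_power_mult:
  "coeff (Var v ^ k * g) m = (if exponent m v < k then 0 else coeff g (m - Poly_Mapping.single v k))"
proof (induction k arbitrary: m)
  case (Suc k)
  have "coeff (Var v ^ Suc k * g) m = coeff (Var v * (Var v ^ k * g)) m" by (simp add: mult.assoc)
  also have "\<dots> = (if exponent m v < Suc k then 0 else coeff g (m - Poly_Mapping.single v 1 - Poly_Mapping.single v k))"
    by (auto simp: coeff_Var_mult Suc.IH lookup_minus)
  also have "m - Poly_Mapping.single v 1 - Poly_Mapping.single v k = m - Poly_Mapping.single v (Suc k)"
    by (rule poly_mapping_eqI) (simp add: lookup_minus lookup_single when_def)
  finally show ?case .
qed simp

lemma var_coeff_Var_power_mult:
  assumes "supp_in V g" "v \<notin> V"
  shows "var_coeff v k (Var v ^ j * g) = (if j = k then g else 0)"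
proof (rule mseries_eqI)
  fix m
  have 0: "coeff g m = 0" if "exponent m v \<noteq> 0" for m
    using assms that by (metis in_keys_iff subsetD supp_in_def)
  have ks: "m + Poly_Mapping.single v k - Poly_Mapping.single v k = m" by simp
  have "coeff g (m + Poly_Mapping.single v k - Poly_Mapping.single v j) = 0" if "j < k" "exponent m v = 0"
    by (rule 0) (use that in \<open>simp add: lookup_minus lookup_add\<close>)
  then show "coeff (var_coeff v k (Var v ^ j * g)) m = coeff (if j = k then g else 0) m"
    using 0[of m] by (auto simp: coeff_var_coeff coeff_Var_power_mult lookup_add)
qed

lemma var_coeff_expansion:
  assumes "\<And>k. k > N \<Longrightarrow> var_coeff v k g = 0"
  shows "g = (\<Sum>k\<le>N. Var v ^ k * var_coeff v k g)"
proof (rule mseries_eqI)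
  fix m
  let ?e = "exponent m v"
  let ?m = "m - Poly_Mapping.single v ?e"
  have m: "?m + Poly_Mapping.single v ?e = m" "exponent ?m v = 0"
    by (auto intro!: poly_mapping_eqI simp: lookup_add lookup_minus lookup_single when_def)
  have "coeff (Var v ^ k * var_coeff v k g) m = (if k = ?e then coeff g m else 0)" for k
    using m by (auto simp: coeff_Var_power_mult coeff_var_coeff lookup_minus)
  then have "coeff (\<Sum>k\<le>N. Var v ^ k * var_coeff v k g) m = (if ?e \<le> N then coeff g m else 0)" by simp
  moreover have "coeff g m = coeff (var_coeff v ?e g) ?m" using m by (simp add: coeff_var_coeff)
  ultimately show "coeff g m = coeff (\<Sum>k\<le>N. Var v ^ k * var_coeff v k g) m" using assms by auto
qed

text \<open>All that is used of the domain property of the power series ring for dividing by roots.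
  Comparing coefficients at \<open>m\<close> times \<open>v\<close> expresses
  \<open>a * coeff f m\<close> through a coefficient of \<open>f\<close> with a smaller exponent at
  \<open>v'\<close>.\<close>

lemma linear_form_cancel:
  fixes f :: "('v, int) mseries"
  assumes "v \<noteq> v'" "a \<noteq> 0" "(of_int a * Var v + of_int b * Var v') * f = 0"
  shows "f = 0"
proof (rule mseries_eqI)
  fix m
  show "coeff f m = coeff 0 m"
  proof (induction "exponent m v'" arbitrary: m rule: less_induct)
    case less
    let ?m = "m + Poly_Mapping.single v 1"
    have e: "exponent ?m v' = exponent m v'" using assms(1) by (simp add: lookup_add lookup_single)
    have "0 = coeff ((of_int a * Var v + of_int b * Var v') * f) ?m" using assms(3) by simp
    also have "\<dots> = a * coeff (Var v * f) ?m + b * coeff (Var v' * f) ?m"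
      using coeff_of_int_mult[of a "Var v * f" ?m] coeff_of_int_mult[of b "Var v' * f" ?m]
      by (simp add: distrib_right mult.assoc)
    also have "coeff (Var v * f) ?m = coeff f m" by (simp add: coeff_Var_mult lookup_add)
    also have "coeff (Var v' * f) ?m = 0"
    proof (cases "exponent m v' = 0")
      case False
      have "exponent (?m - Poly_Mapping.single v' 1) v' < exponent m v'"
        using e False by (simp add: lookup_minus)
      then have "coeff f (?m - Poly_Mapping.single v' 1) = 0" using less by fastforce
      then show ?thesis by (simp add: coeff_Var_mult)
    qed (simp only: coeff_Var_mult e, simp)
    finally show ?case using assms(2) by simp
  qed
qed

lemma of_int_cancel:
  fixes f :: "('v, int) mseries"
  assumes "a \<noteq> 0" "of_int a * f = of_int a * g" shows "f = g"
proof (rule mseries_eqI)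
  fix m
  have "a * coeff f m = a * coeff g m"
    using arg_cong[OF assms(2), of "\<lambda>f. coeff f m"] by (simp add: coeff_of_int_mult)
  then show "coeff f m = coeff g m" using assms(1) by simp
qed

section \<open>Subrings\<close>

lemma subring_zero: "0 \<in> generated_subring G"
  using generated_subring.diff[OF generated_subring.one generated_subring.one] by simp

lemma subring_uminus: "a \<in> generated_subring G \<Longrightarrow> - a \<in> generated_subring G"
  using generated_subring.diff[OF subring_zero, of a G] by simp

lemma subring_add: "a \<in> generated_subring G \<Longrightarrow> b \<in> generated_subring G \<Longrightarrow> a + b \<in> generated_subring G"
  using generated_subring.diff[of a G "- b"] subring_uminus by auto

lemma subring_sum: "(\<And>x. x \<in> A \<Longrightarrow> f x \<in> generated_subring G) \<Longrightarrow> sum f A \<in> generated_subring G"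
  by (induction A rule: infinite_finite_induct) (simp_all add: subring_zero subring_add)

lemma subring_power: "a \<in> generated_subring G \<Longrightarrow> a ^ n \<in> generated_subring G"
  by (induction n) (simp_all add: generated_subring.one generated_subring.mult)

lemma subring_of_nat: "of_nat n \<in> generated_subring G"
  by (induction n) (simp_all add: subring_zero subring_add generated_subring.one)

lemma subring_of_int: "of_int n \<in> generated_subring G"
proof (cases "n \<ge> 0")
  case True
  then show ?thesis using subring_of_nat[of "nat n" G] by simp
next
  case False
  then show ?thesis using subring_uminus[OF subring_of_nat[of "nat (- n)" G]] by simp
qed

lemma subring_ring_hom:
  assumes "ring_hom \<phi>" "\<And>g. g \<in> G \<Longrightarrow> \<phi> g \<in> generated_subring H" "a \<in> generated_subring G"
  shows "\<phi> a \<in> generated_subring H"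
  using assms(3)
  by induction (auto simp: assms ring_hom_one ring_hom_minus ring_hom_mult intro: generated_subring.intros)

lemma subring_subset:
  assumes "G \<subseteq> generated_subring H" shows "generated_subring G \<subseteq> generated_subring H"
proof
  fix a assume "a \<in> generated_subring G"
  then show "a \<in> generated_subring H" by induction (use assms in \<open>auto intro: generated_subring.intros\<close>)
qed

lemma subring_supp_in:
  assumes "\<And>g. g \<in> G \<Longrightarrow> supp_in V g" "a \<in> generated_subring G" shows "supp_in V a"
  using assms(2) by induction (auto simp: assms(1) supp_in_one supp_in_minus supp_in_times)

lemma subring_eqI:
  assumes "ring_hom \<phi>" "ring_hom \<psi>" "\<And>g. g \<in> G \<Longrightarrow> \<phi> g = \<psi> g" "a \<in> generated_subring G"
  shows "\<phi> a = \<psi> a"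
  using assms(4) by induction (auto simp: assms ring_hom_one ring_hom_minus ring_hom_mult)

section \<open>The actions on power series\<close>

lemma finite_fibres_transpose: "finite_fibres (transpose a b)"
  by (rule finite_fibres_inj) simp

lemma finite_fibres_shift_z: "finite_fibres shift_to_z"
  unfolding finite_fibres_def
proof
  fix w
  have "shift_to_z -` {w} \<subseteq> {w, X_var 0, X_var 1, X_var (Suc (case w of X_var j \<Rightarrow> j | _ \<Rightarrow> 0))}"
  proof
    fix v assume "v \<in> shift_to_z -` {w}"
    then show "v \<in> {w, X_var 0, X_var 1, X_var (Suc (case w of X_var j \<Rightarrow> j | _ \<Rightarrow> 0))}"
      by (cases v) (auto split: if_splits)
  qed
  then show "finite (shift_to_z -` {w})" by (rule finite_subset) simp
qed

lemma swap_tz_invol [simp]: "swap_tz (swap_tz v) = v"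
  by (cases v) auto

lemma finite_fibres_swap_tz: "finite_fibres swap_tz"
  by (rule finite_fibres_inj) (metis injI swap_tz_invol)

definition sub_z :: "nat \<Rightarrow> var \<Rightarrow> var" where
  "sub_z i = (if i = 0 then shift_to_z else transpose (Z_var i) (Z_var (i + 1)))"

definition sgn_z :: "nat \<Rightarrow> var \<Rightarrow> int" where
  "sgn_z i v = (if i = 0 \<and> v = Z_var 1 then - 1 else 1)"

lemma finite_fibres_sub_z: "finite_fibres (sub_z i)"
  by (simp add: sub_z_def finite_fibres_transpose finite_fibres_shift_z)

lemma s_z_eq: "s_z i = substitute (sub_z i) (sgn_z i)"
  unfolding s_z_def sub_z_def by (auto simp: sgn_z_def fun_eq_iff intro!: arg_cong2[where f = "\<lambda>\<epsilon>. substitute _ \<epsilon>"])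

lemma ring_hom_s_z: "ring_hom (s_z i)"
  unfolding s_z_eq by (rule ring_hom_substitute[OF finite_fibres_sub_z])

lemma ring_hom_omega: "ring_hom omega"
  unfolding omega_def by (rule ring_hom_substitute[OF finite_fibres_swap_tz])

lemma omega_tvar [simp]: "omega (tvar j) = - zvar j"
  and omega_zvar [simp]: "omega (zvar j) = - tvar j"
  unfolding omega_def by (simp_all add: substitute_Var_neg[OF finite_fibres_swap_tz])

lemma s_z_tvar [simp]: "s_z i (tvar j) = tvar j"
  unfolding s_z_eq
  by (subst substitute_Var_pos[OF finite_fibres_sub_z]) (auto simp: sgn_z_def sub_z_def transpose_def)

lemma s_z_zvar: "i \<noteq> 0 \<Longrightarrow> s_z i (zvar j) = zvar (transpose i (i + 1) j)"
  unfolding s_z_eq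
  by (subst substitute_Var_pos[OF finite_fibres_sub_z]) (auto simp: sgn_z_def sub_z_def transpose_def)

lemma s_z_0_zvar: "s_z 0 (zvar j) = (if j = 1 then - zvar 1 else zvar j)"
  unfolding s_z_eq
  by (auto simp: sgn_z_def sub_z_def substitute_Var_pos[OF finite_fibres_shift_z]
      substitute_Var_neg[OF finite_fibres_shift_z])

lemma s_z_0_xvar: "s_z 0 (xvar j) = (if j = 1 then zvar 1 else xvar (j - 1))"
  unfolding s_z_eq by (auto simp: sgn_z_def sub_z_def substitute_Var_pos[OF finite_fibres_shift_z])

lemma omega_omega [simp]: "omega (omega f) = f"
proof -
  have "omega (omega f) = substitute (swap_tz \<circ> swap_tz) (\<lambda>v. sign_tz v * sign_tz (swap_tz v)) f"
    unfolding omega_def by (rule substitute_comp[OF finite_fibres_swap_tz finite_fibres_swap_tz])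
  also have "\<dots> = f"
  proof (rule substitute_fix[of _ UNIV])
    show "(swap_tz \<circ> swap_tz) v = v \<and> sign_tz v * sign_tz (swap_tz v) = 1" for v
      by (cases v) auto
  qed (simp_all add: finite_fibres_comp finite_fibres_swap_tz supp_in_def)
  finally show ?thesis .
qed

text \<open>Makes the t-side a mirror of the z-side, so that only the action on the
  \<open>z_j\<close> has to be analysed.\<close>

lemma s_t_eq: "s_t i f = omega (s_z i (omega f))"
proof -
  let ?\<epsilon> = "\<lambda>v. sign_tz v * sgn_z i (swap_tz v) * sign_tz ((sub_z i \<circ> swap_tz) v)"
  have "omega (s_z i (omega f)) = substitute (swap_tz \<circ> (sub_z i \<circ> swap_tz)) ?\<epsilon> f"
    unfolding omega_def s_z_eq
    by (simp add: substitute_comp finite_fibres_swap_tz finite_fibres_sub_z finite_fibres_comp)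
  also have "swap_tz \<circ> (sub_z i \<circ> swap_tz)
      = (if i = 0 then shift_to_t else transpose (T_var i) (T_var (i + 1)))"
  proof
    fix v show "(swap_tz \<circ> (sub_z i \<circ> swap_tz)) v
      = (if i = 0 then shift_to_t else transpose (T_var i) (T_var (i + 1))) v"
      by (cases v) (auto simp: sub_z_def transpose_def)
  qed
  also have "?\<epsilon> = (if i = 0 then (\<lambda>v. if v = T_var 1 \<or> v = X_var 1 then - 1 else 1) else (\<lambda>_. 1))"
  proof
    fix v show "?\<epsilon> v = (if i = 0 then (\<lambda>v. if v = T_var 1 \<or> v = X_var 1 then - 1 else 1) else (\<lambda>_. 1)) v"
      by (cases v) (auto simp: sub_z_def sgn_z_def transpose_def)
  qed
  also have "substitute (if i = 0 then shift_to_t else transpose (T_var i) (T_var (i + 1)))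
      (if i = 0 then (\<lambda>v. if v = T_var 1 \<or> v = X_var 1 then - 1 else 1) else (\<lambda>_. 1)) f = s_t i f"
    by (simp add: s_t_def)
  finally show ?thesis by simp
qed

text \<open>Index 0 has to stay out: \<open>shift_to_z\<close> fixes \<open>X_var 0\<close>, so
  invariance under the shift would say nothing about it.\<close>

definition x_vars :: "var set" where
  "x_vars = X_var ` {1..}"

lemma x_vars_iff [simp]: "X_var j \<in> x_vars \<longleftrightarrow> j \<ge> 1" "Z_var j \<notin> x_vars" "T_var j \<notin> x_vars"
  by (auto simp: x_vars_def)

lemma x_varsE: assumes "v \<in> x_vars" obtains j where "j \<ge> 1" "v = X_var j"
  using assms by (auto simp: x_vars_def)

lemma s_z_fix_x: "i \<noteq> 0 \<Longrightarrow> supp_in x_vars f \<Longrightarrow> s_z i f = f"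
  unfolding s_z_eq
  by (rule substitute_fix[OF finite_fibres_sub_z]) (auto simp: sub_z_def sgn_z_def transpose_def elim!: x_varsE)

lemma omega_fix_x: "supp_in x_vars f \<Longrightarrow> omega f = f"
  unfolding omega_def by (rule substitute_fix[OF finite_fibres_swap_tz]) (auto elim!: x_varsE)

text \<open>
  If \<open>f\<close> in the \<open>x\<^sub>j\<close> is unchanged when the first \<open>r\<close> variables are made foreign and the others are
  shifted down by \<open>r\<close>, then every variable can be shifted until it is foreign.
\<close>

lemma shift_invariant_const:
  fixes f :: series
  assumes fin: "finite_fibres \<sigma>" and f: "supp_in x_vars f" and inv: "substitute \<sigma> \<epsilon> f = f"
    and inj: "inj_on \<sigma> x_vars" and \<epsilon>: "\<And>v. v \<in> x_vars \<Longrightarrow> \<epsilon> v = 1" and "r \<ge> 1"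
    and low: "\<And>j. 1 \<le> j \<Longrightarrow> j \<le> r \<Longrightarrow> \<sigma> (X_var j) \<notin> x_vars"
    and high: "\<And>j. j > r \<Longrightarrow> \<sigma> (X_var j) = X_var (j - r)"
    and "m \<noteq> 0"
  shows "coeff f m = 0"
proof -
  have shift: "coeff f m = coeff f (rename_monomial \<sigma> m)" if m: "variables m \<subseteq> x_vars" for m
  proof -
    let ?\<tau> = "inv_into x_vars \<sigma>"
    have bk: "rename_monomial ?\<tau> (rename_monomial \<sigma> m) = m"
      unfolding rename_comp by (rule rename_id) (use m inj in auto)
    have "coeff (substitute \<sigma> \<epsilon> f) (rename_monomial \<sigma> m) = coeff f (rename_monomial ?\<tau> (rename_monomial \<sigma> m))"
      by (rule coeff_substitute_inverse[OF fin f]) (use m inj \<epsilon> in \<open>auto simp: variables_rename\<close>)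
    then show ?thesis by (simp add: bk inv)
  qed
  have kill: "coeff f m = 0" if "variables m \<subseteq> x_vars" "X_var j \<in> variables m" for j m
    using that
  proof (induction j arbitrary: m rule: less_induct)
    case (less j)
    have "1 \<le> j" using less.prems x_vars_iff(1) by blast
    have mem: "\<sigma> (X_var j) \<in> variables (rename_monomial \<sigma> m)"
      using less.prems by (simp add: variables_rename)
    have "coeff f (rename_monomial \<sigma> m) = 0"
    proof (cases "variables (rename_monomial \<sigma> m) \<subseteq> x_vars")
      case True
      then have "j > r" using mem low[OF \<open>1 \<le> j\<close>] by (meson leI subsetD)
      with True mem high[of j] \<open>r \<ge> 1\<close> show ?thesis
        by (intro less.IH[of "j - r"]) auto
    next
      case False
      then show ?thesis using f by (auto simp: supp_in_def)
    qed
    then show ?case using shift[OF less.prems(1)] by simp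
  qed
  show ?thesis
  proof (rule ccontr)
    assume nz: "coeff f m \<noteq> 0"
    then have "variables m \<subseteq> x_vars" using f by (auto simp: supp_in_def)
    moreover obtain v where "v \<in> variables m" using \<open>m \<noteq> 0\<close> by (metis all_not_in_conv keys_eq_empty)
    ultimately show False using kill nz by (metis subsetD x_varsE)
  qed
qed

lemma s_z_0_invariant_const:
  assumes "supp_in x_vars f" "s_z 0 f = f" "m \<noteq> 0" shows "coeff f m = 0"
  by (rule shift_invariant_const[OF finite_fibres_sub_z[of 0] assms(1) assms(2)[unfolded s_z_eq], where r = 1])
    (use assms in \<open>auto simp: sub_z_def sgn_z_def inj_on_def elim!: x_varsE split: if_splits\<close>)

section \<open>The series \<open>Q\<^sub>k\<close> and \<open>P\<^sub>k\<close>\<close>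

definition fps_map :: "('a :: comm_ring_1 \<Rightarrow> 'b :: comm_ring_1) \<Rightarrow> 'a fps \<Rightarrow> 'b fps" where
  "fps_map \<phi> F = Abs_fps (\<lambda>k. \<phi> (fps_nth F k))"

lemma fps_map_nth [simp]: "fps_nth (fps_map \<phi> F) k = \<phi> (fps_nth F k)"
  by (simp add: fps_map_def)

lemma ring_hom_fps_map: "ring_hom \<phi> \<Longrightarrow> ring_hom (fps_map \<phi>)"
  unfolding ring_hom_def[of "fps_map \<phi>"]
  by (auto intro!: fps_ext simp: ring_hom_one ring_hom_zero ring_hom_add ring_hom_mult ring_hom_sum fps_mult_nth)

definition geo_fps :: "'a :: comm_ring_1 \<Rightarrow> 'a fps" where
  "geo_fps a = (1 + fps_const a * fps_X) * Abs_fps (\<lambda>k. a ^ k)"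

lemma geo_fps_nth: "fps_nth (geo_fps a) k = (if k = 0 then 1 else 2 * a ^ k)"
  by (cases k) (simp_all add: geo_fps_def distrib_right mult.assoc fps_mult_left_const_nth)

lemma fps_map_geo_fps: "ring_hom \<phi> \<Longrightarrow> fps_map \<phi> (geo_fps a) = geo_fps (\<phi> a)"
  by (rule fps_ext) (simp add: geo_fps_nth ring_hom_one ring_hom_mult ring_hom_power ring_hom_numeral)

lemma Q_product_geo_fps: "Q_product n = (\<Prod>i = 1..n. geo_fps (xvar i))"
  by (simp add: Q_product_def geo_fps_def)

definition Q_partial :: "nat \<Rightarrow> nat \<Rightarrow> series" where
  "Q_partial n k = fps_nth (Q_product n) k"

text \<open>The coefficients of \<open>(1 + u) / (1 - u)\<close>.\<close>

definition q_coeff :: "nat \<Rightarrow> int" where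
  "q_coeff i = (if i = 0 then 1 else 2)"

lemma geo_fps_nth_q_coeff: "fps_nth (geo_fps a) k = of_int (q_coeff k) * a ^ k"
  by (simp add: geo_fps_nth q_coeff_def)

lemma Q_partial_Suc: "Q_partial (Suc n) k = (\<Sum>i\<le>k. of_int (q_coeff i) * xvar (Suc n) ^ i * Q_partial n (k - i))"
  by (simp add: Q_partial_def Q_product_geo_fps mult.commute[of _ "geo_fps _"] fps_mult_nth geo_fps_nth_q_coeff atLeast0AtMost)

lemma Q_partial_0: "Q_partial 0 k = (if k = 0 then 1 else 0)"
  by (simp add: Q_partial_def Q_product_geo_fps)

lemma Q_partial_zero [simp]: "Q_partial n 0 = 1"
  by (induction n) (simp_all add: Q_partial_0 Q_partial_Suc q_coeff_def)

lemma Q_partial_stable_Suc: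
  assumes "X_var (Suc n) \<notin> variables m" shows "coeff (Q_partial (Suc n) k) m = coeff (Q_partial n k) m"
proof -
  have "exponent m (X_var (Suc n)) = 0" using assms by (simp add: in_keys_iff)
  then have "coeff (of_int (q_coeff i) * xvar (Suc n) ^ i * Q_partial n (k - i)) m = (if i = 0 then coeff (Q_partial n k) m else 0)" for i
    by (simp add: mult.assoc coeff_of_int_mult coeff_Var_power_mult q_coeff_def)
  then show ?thesis by (simp add: Q_partial_Suc)
qed

lemma Q_partial_stable:
  assumes "N \<le> n" "\<And>j. j > N \<Longrightarrow> X_var j \<notin> variables m"
  shows "coeff (Q_partial n k) m = coeff (Q_partial N k) m"
  using assms(1) by (induction n rule: dec_induct) (simp_all add: Q_partial_stable_Suc assms(2))

lemma variables_bound: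
  fixes m :: "var monomial"
  obtains N where "\<And>j. j > N \<Longrightarrow> T_var j \<notin> variables m \<and> Z_var j \<notin> variables m \<and> X_var j \<notin> variables m"
proof -
  let ?i = "\<lambda>v. case v of T_var j \<Rightarrow> j | Z_var j \<Rightarrow> j | X_var j \<Rightarrow> j"
  have "finite (?i ` variables m)" by simp
  then obtain N where N: "\<And>v. v \<in> variables m \<Longrightarrow> ?i v \<le> N"
    by (metis finite_nat_set_iff_bounded_le imageI)
  show ?thesis by (rule that[of N]) (use N in fastforce)
qed

text \<open>Only finitely many \<open>x_j\<close> occur in \<open>m\<close>, and later factors of
  the product contribute just their constant term 1; hence the limit named by \<open>THE\<close>
  exists.\<close>

lemma Q_fun_eventually: "\<forall>\<^sub>F n in sequentially. coeff (Q_partial n k) m = coeff (Q_fun k) m"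
proof -
  obtain N where N: "\<And>j. j > N \<Longrightarrow> X_var j \<notin> variables m" using variables_bound by metis
  have ev: "\<forall>\<^sub>F n in sequentially. coeff (Q_partial n k) m = coeff (Q_partial N k) m"
    using eventually_ge_at_top[of N] by eventually_elim (use Q_partial_stable N in blast)
  have "(THE c. \<forall>\<^sub>F n in sequentially. coeff (Q_partial n k) m = c) = coeff (Q_partial N k) m"
  proof (rule the_equality)
    show "\<forall>\<^sub>F n in sequentially. coeff (Q_partial n k) m = coeff (Q_partial N k) m" by (rule ev)
    fix c assume "\<forall>\<^sub>F n in sequentially. coeff (Q_partial n k) m = c"
    with ev have "\<forall>\<^sub>F n in sequentially. c = coeff (Q_partial N k) m" by eventually_elim simp
    then show "c = coeff (Q_partial N k) m" by simp
  qed
  then show ?thesis using ev by (simp add: Q_fun_def Q_partial_def)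
qed

lemma Q_fun_attained: "\<exists>n\<ge>N. coeff (Q_fun k) m = coeff (Q_partial n k) m"
  using eventually_conj[OF Q_fun_eventually[of k m] eventually_ge_at_top[of N]]
    eventually_happens'[OF sequentially_bot] by (metis (mono_tags, lifting))

lemma Q_fun_0 [simp]: "Q_fun 0 = 1"
  by (rule mseries_eqI) (metis Q_fun_attained Q_partial_zero)

lemma supp_in_of_int_mult: "supp_in V f \<Longrightarrow> supp_in V (of_int a * f)"
  unfolding supp_in_def coeff_of_int_mult by (metis mult_zero_right)

lemma supp_in_Q_partial: "supp_in x_vars (Q_partial n k)"
proof (induction n arbitrary: k)
  case (Suc n)
  then show ?case unfolding Q_partial_Suc
    by (intro supp_in_sum) (simp add: mult.assoc supp_in_of_int_mult supp_in_times supp_in_power supp_in_Var)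
qed (simp add: Q_partial_0 supp_in_one supp_in_zero)

lemma supp_in_Q: "supp_in x_vars (Q_fun k)"
  using supp_in_Q_partial Q_fun_attained[of 0 k] unfolding supp_in_def by metis

lemma Q_partial_even:
  assumes "k \<ge> 1" shows "even (coeff (Q_partial n k) m)"
  using assms
proof (induction n arbitrary: k m)
  case (Suc n)
  have "even (coeff (of_int (q_coeff i) * xvar (Suc n) ^ i * Q_partial n (k - i)) m)" if "i \<le> k" for i
  proof (cases "i = 0")
    case True
    then show ?thesis using Suc by (simp add: q_coeff_def)
  qed (simp add: mult.assoc coeff_of_int_mult[of 2, simplified] q_coeff_def)
  then show ?case by (auto simp: Q_partial_Suc intro!: dvd_sum)
qed (simp add: Q_partial_0)

lemma Q_fun_even: "k \<ge> 1 \<Longrightarrow> even (coeff (Q_fun k) m)"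
  by (metis Q_fun_attained Q_partial_even)

text \<open>Each factor of the product is 1 modulo 2, so the coefficients of \<open>Q_k\<close> are
  even for k >= 1. As 2 can be cancelled, the \<open>THE\<close> in \<open>P_fun\<close> is
  justified.\<close>

lemma double_P: assumes "k \<ge> 1" shows "2 * P_fun k = Q_fun k"
proof -
  let ?p = "Series (\<lambda>m. coeff (Q_fun k) m div 2)"
  have p: "2 * ?p = Q_fun k"
    using coeff_of_int_mult[of 2 ?p] Q_fun_even[OF assms] by (intro mseries_eqI) simp
  moreover have "q = ?p" if "2 * q = Q_fun k" for q
    using of_int_cancel[of 2 q ?p] that p by simp
  ultimately show ?thesis unfolding P_fun_def by (rule theI)
qed

lemma supp_in_P: assumes "k \<ge> 1" shows "supp_in x_vars (P_fun k)"
  using supp_in_Q[of k] coeff_of_int_mult[of 2 "P_fun k"] unfolding double_P[OF assms, symmetric]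
  by (simp add: supp_in_def)

text \<open>The first of the n + 1 factors becomes the factor of \<open>z_1\<close>, and the others
  shift down to the product of n factors.\<close>

lemma s_z_0_Q_partial: "s_z 0 (Q_partial (Suc n) k) = (\<Sum>i\<le>k. of_int (q_coeff i) * zvar 1 ^ i * Q_partial n (k - i))"
proof -
  have "fps_map (s_z 0) (Q_product (Suc n)) = (\<Prod>i = 1..Suc n. geo_fps (s_z 0 (xvar i)))"
    unfolding Q_product_geo_fps
    by (induction n) (simp_all add: ring_hom_mult[OF ring_hom_fps_map[OF ring_hom_s_z]] fps_map_geo_fps[OF ring_hom_s_z])
  also have "\<dots> = geo_fps (zvar 1) * (\<Prod>i = 2..Suc n. geo_fps (s_z 0 (xvar i)))"
    by (subst prod.atLeast_Suc_atMost) (auto simp: s_z_0_xvar numeral_2_eq_2)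
  also have "(\<Prod>i = 2..Suc n. geo_fps (s_z 0 (xvar i))) = Q_product n"
    unfolding Q_product_geo_fps
    by (rule prod.reindex_bij_witness[of _ Suc "\<lambda>i. i - 1"]) (auto simp: s_z_0_xvar)
  finally have "fps_nth (fps_map (s_z 0) (Q_product (Suc n))) k = fps_nth (geo_fps (zvar 1) * Q_product n) k"
    by simp
  then show ?thesis by (simp add: Q_partial_def fps_mult_nth geo_fps_nth_q_coeff atLeast0AtMost)
qed

text \<open>Passage to the limit: a coefficient of either side involves finitely many coefficients
  of partial products, and these are eventually constant together.\<close>

lemma s_z_0_Q: "s_z 0 (Q_fun k) = (\<Sum>i\<le>k. of_int (q_coeff i) * zvar 1 ^ i * Q_fun (k - i))"
proof (rule mseries_eqI)
  fix m
  note fin = finite_rename_fibre[OF finite_fibres_sub_z[of 0], of m]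
  have "\<forall>\<^sub>F n in sequentially. \<forall>m'\<in>{m'. rename_monomial (sub_z 0) m' = m}. coeff (Q_partial n k) m' = coeff (Q_fun k) m'"
    using fin by (rule eventually_ball_finite) (simp add: Q_fun_eventually)
  then have l: "\<forall>\<^sub>F n in sequentially. coeff (s_z 0 (Q_partial n k)) m = coeff (s_z 0 (Q_fun k)) m"
    by eventually_elim (simp add: s_z_eq coeff_substitute)
  have tm: "coeff (of_int a * zvar 1 ^ i * g) m = (if exponent m (Z_var 1) < i then 0
      else a * coeff g (m - Poly_Mapping.single (Z_var 1) i))" for a i g
    by (simp add: mult.assoc coeff_of_int_mult coeff_Var_power_mult)
  have "\<forall>\<^sub>F n in sequentially. \<forall>i\<in>{..k}. coeff (Q_partial n (k - i)) (m - Poly_Mapping.single (Z_var 1) i)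
      = coeff (Q_fun (k - i)) (m - Poly_Mapping.single (Z_var 1) i)"
    by (rule eventually_ball_finite) (simp_all add: Q_fun_eventually)
  then have r: "\<forall>\<^sub>F n in sequentially. coeff (s_z 0 (Q_partial (Suc n) k)) m
      = coeff (\<Sum>i\<le>k. of_int (q_coeff i) * zvar 1 ^ i * Q_fun (k - i)) m"
    by eventually_elim (auto simp: s_z_0_Q_partial tm simp del: One_nat_def intro!: sum.cong)
  have "\<forall>\<^sub>F n in sequentially. coeff (s_z 0 (Q_partial (Suc n) k)) m = coeff (s_z 0 (Q_fun k)) m"
    using l by (simp add: eventually_sequentially_Suc[of "\<lambda>n. coeff (s_z 0 (Q_partial n k)) m = _"])
  with r have "\<forall>\<^sub>F n :: nat in sequentially. coeff (s_z 0 (Q_fun k)) m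
      = coeff (\<Sum>i\<le>k. of_int (q_coeff i) * zvar 1 ^ i * Q_fun (k - i)) m"
    by eventually_elim simp
  then show "coeff (s_z 0 (Q_fun k)) m = coeff (\<Sum>i\<le>k. of_int (q_coeff i) * zvar 1 ^ i * Q_fun (k - i)) m"
    by simp
qed

section \<open>The operators \<open>D\<^sub>k\<close>\<close>

text \<open>\<open>D_op k f\<close> is the coefficient of \<open>z\<^sub>1\<^sup>k\<close> in \<open>f(z\<^sub>1, x\<^sub>1, x\<^sub>2, \<dots>)\<close>.\<close>

definition D_op :: "nat \<Rightarrow> series \<Rightarrow> series" where
  "D_op k f = var_coeff (Z_var 1) k (s_z 0 f)"

lemma D_op_add: "D_op k (f + g) = D_op k f + D_op k g"
  and D_op_minus: "D_op k (f - g) = D_op k f - D_op k g"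
  by (simp_all add: D_op_def ring_hom_add[OF ring_hom_s_z] ring_hom_minus[OF ring_hom_s_z] var_coeff_add var_coeff_diff)

lemma D_op_zero [simp]: "D_op k 0 = 0"
  using D_op_minus[of k 0 0] by simp

lemma D_op_uminus: "D_op k (- f) = - D_op k f"
  using D_op_minus[of k 0 f] by simp

lemma D_op_sum: "D_op k (sum f A) = (\<Sum>x\<in>A. D_op k (f x))"
  by (induction A rule: infinite_finite_induct) (simp_all add: D_op_add)

lemma D_op_of_int: "D_op k (of_int a * f) = of_int a * D_op k f"
proof -
  have nat: "D_op k (of_nat n * f) = of_nat n * D_op k f" for n
    by (induction n) (simp_all add: distrib_right D_op_add)
  show ?thesis by (cases a) (simp_all add: nat distrib_right left_diff_distrib D_op_minus D_op_uminus)
qed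

lemma D_op_mult: "D_op k (f * g) = (\<Sum>i\<le>k. D_op i f * D_op (k - i) g)"
  by (simp add: D_op_def ring_hom_mult[OF ring_hom_s_z] var_coeff_mult)

lemma D_op_one: "D_op k 1 = (if k = 0 then 1 else 0)"
  using var_coeff_Var_power_mult[of "{}" "1 :: series" "Z_var 1" k 0]
  by (simp add: D_op_def ring_hom_one[OF ring_hom_s_z] supp_in_one)

lemma var_coeff_sum: "var_coeff v k (sum f A) = (\<Sum>x\<in>A. var_coeff v k (f x))"
proof (induction A rule: infinite_finite_induct)
  case (insert x F)
  then show ?case by (simp add: var_coeff_add)
qed (auto intro!: mseries_eqI simp: coeff_var_coeff)

lemma D_op_Q: "D_op j (Q_fun l) = (if j \<le> l then of_int (q_coeff j) * Q_fun (l - j) else 0)"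
proof -
  have "var_coeff (Z_var 1) j (of_int (q_coeff i) * zvar 1 ^ i * Q_fun (l - i))
      = (if i = j then of_int (q_coeff j) * Q_fun (l - j) else 0)" for i
    using var_coeff_Var_power_mult[of x_vars "of_int (q_coeff i) * Q_fun (l - i)" "Z_var 1" j i]
    by (simp add: supp_in_Q supp_in_of_int_mult mult.left_commute[of "of_int _"] mult.assoc del: One_nat_def)
  then show ?thesis by (simp add: D_op_def s_z_0_Q var_coeff_sum)
qed

lemma Gamma'_induct [consumes 1, case_names P one minus mult]:
  assumes "f \<in> Gamma'" "\<And>k. k \<ge> 1 \<Longrightarrow> R (P_fun k)" "R 1"
    "\<And>f g. R f \<Longrightarrow> R g \<Longrightarrow> R (f - g)" "\<And>f g. R f \<Longrightarrow> R g \<Longrightarrow> R (f * g)"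
  shows "R f"
  using assms(1) unfolding Gamma'_def by induction (use assms in auto)

lemma Gamma'_supp_in: "f \<in> Gamma' \<Longrightarrow> supp_in x_vars f"
  unfolding Gamma'_def by (rule subring_supp_in) (auto simp: supp_in_P)

lemma double_cancel: "2 * f = 2 * g \<Longrightarrow> f = (g :: series)"
  using of_int_cancel[of 2 f g] by simp

lemma D_op_P: assumes "l \<ge> 1" shows "D_op j (P_fun l) = (if j = 0 then P_fun l else if j \<le> l then Q_fun (l - j) else 0)"
proof (rule double_cancel)
  have "2 * D_op j (P_fun l) = D_op j (Q_fun l)"
    using D_op_of_int[of j 2 "P_fun l"] double_P[OF assms] by simp
  then show "2 * D_op j (P_fun l) = 2 * (if j = 0 then P_fun l else if j \<le> l then Q_fun (l - j) else 0)"
    using double_P[OF assms] by (auto simp: D_op_Q q_coeff_def)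
qed

lemma D_op_0: "f \<in> Gamma' \<Longrightarrow> D_op 0 f = f"
  by (induction rule: Gamma'_induct) (simp_all add: D_op_P D_op_one D_op_minus D_op_mult)

lemma D_op_bound: "f \<in> Gamma' \<Longrightarrow> \<exists>N. \<forall>k>N. D_op k f = 0"
proof (induction rule: Gamma'_induct)
  case (P k)
  then show ?case by (intro exI[of _ k]) (auto simp: D_op_P)
next
  case one
  then show ?case by (intro exI[of _ 0]) (auto simp: D_op_one)
next
  case (minus f g)
  then obtain M N where "\<forall>k>M. D_op k f = 0" "\<forall>k>N. D_op k g = 0" by auto
  then show ?case by (intro exI[of _ "max M N"]) (auto simp: D_op_minus)
next
  case (mult f g)
  then obtain M N where MN: "\<forall>k>M. D_op k f = 0" "\<forall>k>N. D_op k g = 0" by auto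
  show ?case
  proof (intro exI[of _ "M + N"] allI impI)
    fix k assume k: "M + N < k"
    have "D_op i f * D_op (k - i) g = 0" for i
    proof (cases "i > M")
      case False
      then have "k - i > N" using k by simp
      then show ?thesis using MN by simp
    qed (use MN in simp)
    then show "D_op k (f * g) = 0" by (simp add: D_op_mult)
  qed
qed

lemma s_z_0_expansion:
  assumes "\<And>k. k > N \<Longrightarrow> D_op k f = 0" shows "s_z 0 f = (\<Sum>k\<le>N. zvar 1 ^ k * D_op k f)"
  unfolding D_op_def by (rule var_coeff_expansion) (use assms in \<open>simp add: D_op_def\<close>)

text \<open>With \<open>D_0 f = f\<close> and all higher \<open>D_k f\<close> zero, inserting
  \<open>z_1\<close> in front of the variables leaves \<open>f\<close> unchanged, so it cannot
  involve any of them.\<close>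

lemma D_op_kernel:
  assumes "f \<in> Gamma'" "\<And>k. k \<ge> 1 \<Longrightarrow> D_op k f = 0" "m \<noteq> 0" shows "coeff f m = 0"
proof (rule s_z_0_invariant_const)
  show "s_z 0 f = f"
    using s_z_0_expansion[of 0 f] assms D_op_0[of f] by simp
qed (use assms Gamma'_supp_in in auto)

lemma D_op_D_op_mult:
  "D_op j (D_op k (f * g)) = (\<Sum>i\<le>k. \<Sum>l\<le>j. D_op l (D_op i f) * D_op (j - l) (D_op (k - i) g))"
  by (simp add: D_op_mult D_op_sum)

lemma D_op_D_op_Q: "D_op j (D_op k (Q_fun l)) = (if j + k \<le> l then of_int (q_coeff j * q_coeff k) * Q_fun (l - j - k) else 0)"
proof -
  have "l - k - j = l - j - k" by simp
  then show ?thesis by (auto simp: D_op_Q D_op_of_int mult.assoc mult.left_commute)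
qed

text \<open>Behind this is the symmetry of \<open>f\<close> in two newly inserted variables. The
  argument checks it on generators and spreads it by the Cauchy product rule.\<close>

lemma D_op_commute: "f \<in> Gamma' \<Longrightarrow> D_op j (D_op k f) = D_op k (D_op j f)"
proof (induction arbitrary: j k rule: Gamma'_induct)
  case (P l)
  have 1: "2 * D_op j (D_op k (P_fun l)) = D_op j (D_op k (Q_fun l))" for j k
    using D_op_of_int[of k 2 "P_fun l"] D_op_of_int[of j 2 "D_op k (P_fun l)"] double_P[OF P] by simp
  have "D_op j (D_op k (Q_fun l)) = D_op k (D_op j (Q_fun l))"
    unfolding D_op_D_op_Q
    by (subst add.commute[of j k], subst mult.commute[of "q_coeff j" "q_coeff k"], subst diff_commute[of l j k]) (rule refl)
  then show ?case by (intro double_cancel[OF trans[OF 1 trans[OF _ 1[symmetric]]]])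
next
  case (mult f g)
  show ?case unfolding D_op_D_op_mult by (subst sum.swap) (intro sum.cong refl arg_cong2[where f = "(*)"] mult.IH)
qed (auto simp: D_op_one D_op_minus)

text \<open>The coefficient of \<open>u^m\<close> in \<open>f\<close> after inserting the two
  variables \<open>u\<close> and \<open>- u\<close>.\<close>

definition T_op :: "nat \<Rightarrow> series \<Rightarrow> series" where
  "T_op m f = (\<Sum>i\<le>m. (- 1) ^ i * D_op i (D_op (m - i) f))"

lemma T_op_mult_aux:
  fixes F G :: "nat \<Rightarrow> nat \<Rightarrow> 'a :: comm_ring_1"
  shows "(\<Sum>i\<le>m. (- 1) ^ i * (\<Sum>a\<le>m - i. \<Sum>b\<le>i. F b a * G (i - b) (m - i - a)))
    = (\<Sum>p\<le>m. (\<Sum>b\<le>p. (- 1) ^ b * F b (p - b)) * (\<Sum>d\<le>m - p. (- 1) ^ d * G d (m - p - d)))"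
proof -
  have "(\<Sum>i\<le>m. (- 1) ^ i * (\<Sum>a\<le>m - i. \<Sum>b\<le>i. F b a * G (i - b) (m - i - a)))
      = (\<Sum>(i, a, b)\<in>(SIGMA i : {..m}. {..m - i} \<times> {..i}). (- 1) ^ i * (F b a * G (i - b) (m - i - a)))"
    by (subst sum.Sigma[symmetric]) (simp_all add: sum.cartesian_product sum_distrib_left case_prod_unfold)
  also have "\<dots> = (\<Sum>(p, b, d)\<in>(SIGMA p : {..m}. {..p} \<times> {..m - p}).
      (- 1) ^ b * F b (p - b) * ((- 1) ^ d * G d (m - p - d)))"
  proof (rule sum.reindex_bij_witness[where i = "\<lambda>(p, b, d). (b + d, p - b, b)" and j = "\<lambda>(i, a, b). (a + b, b, i - b)"])
    fix x assume "x \<in> (SIGMA i : {..m}. {..m - i} \<times> {..i})"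
    then obtain i a b where [simp]: "x = (i, a, b)" "i \<le> m" "a \<le> m - i" "b \<le> i" by auto
    have "(- 1 :: 'a) ^ i = (- 1) ^ b * (- 1) ^ (i - b)" by (simp flip: power_add)
    moreover have "m - (a + b) - (i - b) = m - i - a" by simp
    ultimately show "(case (\<lambda>(i, a, b). (a + b, b, i - b)) x of (p, b, d) \<Rightarrow>
        (- 1) ^ b * F b (p - b) * ((- 1) ^ d * G d (m - p - d)))
      = (case x of (i, a, b) \<Rightarrow> (- 1) ^ i * (F b a * G (i - b) (m - i - a)))" by (simp add: mult_ac)
  qed auto
  also have "\<dots> = (\<Sum>p\<le>m. (\<Sum>b\<le>p. (- 1) ^ b * F b (p - b)) * (\<Sum>d\<le>m - p. (- 1) ^ d * G d (m - p - d)))"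
    by (subst sum.Sigma[symmetric]) (simp_all add: sum.cartesian_product sum_product case_prod_unfold)
  finally show ?thesis .
qed

lemma T_op_mult: "T_op m (f * g) = (\<Sum>p\<le>m. T_op p f * T_op (m - p) g)"
  unfolding T_op_def D_op_D_op_mult by (rule T_op_mult_aux)

text \<open>The series \<open>(1 + u) / (1 - u)\<close> times its value at \<open>- u\<close> is 1,
  read coefficientwise.\<close>

lemma q_coeff_alternating: "m \<ge> 1 \<Longrightarrow> (\<Sum>i\<le>m. (- 1) ^ i * (q_coeff i * q_coeff (m - i))) = 0"
proof -
  assume "m \<ge> 1"
  then obtain n where m: "m = Suc n" by (cases m) auto
  have "(\<Sum>i\<le>n. (- 1) ^ i * (q_coeff i * 2)) = 2 * (- 1) ^ n" for n
    by (induction n) (simp_all add: q_coeff_def)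
  then have "(\<Sum>i\<le>n. (- 1) ^ i * (q_coeff i * q_coeff (Suc n - i))) = 2 * (- 1) ^ n"
    by (subst sum.cong[OF refl, of _ _ "\<lambda>i. (- 1) ^ i * (q_coeff i * 2)"]) (auto simp: q_coeff_def)
  then show ?thesis by (simp add: m q_coeff_def)
qed

text \<open>The cancellation property characteristic of Schur Q-functions: inserting a pair
  \<open>u\<close>, \<open>- u\<close> has no effect, because the two new factors of the generating
  function are inverse to each other.\<close>

lemma T_op_vanish: "f \<in> Gamma' \<Longrightarrow> m \<ge> 1 \<Longrightarrow> T_op m f = 0"
proof (induction arbitrary: m rule: Gamma'_induct)
  case (P l)
  have 1: "D_op i (D_op j (Q_fun l)) = 2 * D_op i (D_op j (P_fun l))" for i j
    using D_op_of_int[of j 2 "P_fun l"] D_op_of_int[of i 2 "D_op j (P_fun l)"] double_P[OF P(1)] by simp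
  have "2 * T_op m (P_fun l) = T_op m (Q_fun l)"
    unfolding T_op_def 1 sum_distrib_left by (simp only: mult.left_commute)
  also have "T_op m (Q_fun l) = (if m \<le> l then of_int (\<Sum>i\<le>m. (- 1) ^ i * (q_coeff i * q_coeff (m - i))) * Q_fun (l - m) else 0)"
  proof -
    have "T_op m (Q_fun l) = (\<Sum>i\<le>m. if m \<le> l then of_int ((- 1) ^ i * (q_coeff i * q_coeff (m - i))) * Q_fun (l - m) else 0)"
      unfolding T_op_def D_op_D_op_Q by (rule sum.cong) (auto simp: mult.assoc)
    then show ?thesis by (simp add: sum_distrib_right)
  qed
  also have "\<dots> = 0" using q_coeff_alternating[OF P(2)] by simp
  finally show ?case using double_cancel[of "T_op m (P_fun l)" 0] by simp
next
  case one
  then show ?case by (auto simp: T_op_def D_op_one if_distrib[of "D_op _"] intro!: sum.neutral)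
next
  case (minus f g)
  have "T_op m (f - g) = T_op m f - T_op m g" by (simp add: T_op_def D_op_minus right_diff_distrib sum_subtractf)
  with minus show ?case by simp
next
  case (mult f g)
  have "T_op p f * T_op (m - p) g = 0" if "p \<le> m" for p
    using mult.IH(1)[of p] mult.IH(2)[of "m - p"] mult.prems that by (cases "p = 0") auto
  then show ?case by (simp add: T_op_mult)
qed

lemma T_op_0: "f \<in> Gamma' \<Longrightarrow> T_op 0 f = f"
  by (simp add: T_op_def D_op_0)

section \<open>Integration of compatible systems\<close>

text \<open>The factor by which \<open>D_j\<close> of a ring generator, j >= 1, differs from a
  \<open>Q_fun\<close>. In types B and C it is also the multiple of \<open>t_1\<close> in the root
  \<alpha>_0.\<close>

definition kappa :: "lie_type \<Rightarrow> int" where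
  "kappa Y = (if Y = TypeC then 2 else 1)"

definition Gam_gen :: "lie_type \<Rightarrow> nat \<Rightarrow> series" where
  "Gam_gen Y k = (if Y = TypeC then Q_fun k else P_fun k)"

definition Gam :: "lie_type \<Rightarrow> series set" where
  "Gam Y = generated_subring (Gam_gen Y ` {1..})"

lemma Gam_eq: "Gam Y = (if Y = TypeC then Gamma else Gamma')"
  by (simp add: Gam_def Gamma_def Gamma'_def Gam_gen_def image_def)

lemma ring_R_eq: "ring_R Y = generated_subring (tvar ` {1..} \<union> zvar ` {1..} \<union> Gam Y)"
  by (cases Y) (simp_all add: Gam_eq R_inf_def R_inf'_def)

lemma kappa_nonzero [simp]: "kappa Y \<noteq> 0"
  by (simp add: kappa_def)

lemma Gam_closed:
  "1 \<in> Gam Y" "0 \<in> Gam Y" "f \<in> Gam Y \<Longrightarrow> g \<in> Gam Y \<Longrightarrow> f - g \<in> Gam Y"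
  "f \<in> Gam Y \<Longrightarrow> g \<in> Gam Y \<Longrightarrow> f + g \<in> Gam Y" "f \<in> Gam Y \<Longrightarrow> g \<in> Gam Y \<Longrightarrow> f * g \<in> Gam Y"
  "of_int a \<in> Gam Y" "f \<in> Gam Y \<Longrightarrow> f ^ n \<in> Gam Y"
  unfolding Gam_def
  by (auto intro: generated_subring.intros subring_zero subring_add subring_of_int subring_power)

lemma Gam_sum: "(\<And>x. x \<in> A \<Longrightarrow> f x \<in> Gam Y) \<Longrightarrow> sum f A \<in> Gam Y"
  unfolding Gam_def by (rule subring_sum)

lemma Gam_gen_in_Gam: "k \<ge> 1 \<Longrightarrow> Gam_gen Y k \<in> Gam Y"
  unfolding Gam_def by (rule generated_subring.generator) auto

lemma Q_in_Gam: "Q_fun k \<in> Gam Y"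
proof (cases "k = 0")
  case False
  then have "Gam_gen Y k \<in> Gam Y" "Q_fun k = (if Y = TypeC then Gam_gen Y k else Gam_gen Y k + Gam_gen Y k)"
    using Gam_gen_in_Gam[of k Y] double_P[of k] by (simp_all add: Gam_gen_def)
  then show ?thesis using Gam_closed(4)[of "Gam_gen Y k" Y "Gam_gen Y k"] by (auto split: if_splits)
qed (simp add: Gam_closed)

lemma Gam_Gamma': "f \<in> Gam Y \<Longrightarrow> f \<in> Gamma'"
proof -
  have "Gam Y \<subseteq> generated_subring (Gam_gen TypeB ` {1..})"
    unfolding Gam_def[of Y]
    by (rule subring_subset) (use Q_in_Gam[of _ TypeB] Gam_gen_in_Gam[of _ TypeB] in \<open>auto simp: Gam_gen_def Gam_def\<close>)
  also have "\<dots> = Gamma'" using Gam_eq[of TypeB] by (simp add: Gam_def)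
  finally show "f \<in> Gam Y \<Longrightarrow> f \<in> Gamma'" by blast
qed

lemma D_op_Gam_gen:
  assumes "l \<ge> 1" "j \<ge> 1"
  shows "D_op j (Gam_gen Y l) = (if j \<le> l then of_int (kappa Y) * Q_fun (l - j) else 0)"
  using assms by (simp add: Gam_gen_def kappa_def D_op_P D_op_Q q_coeff_def)

text \<open>Divisibility is meant inside the ring, not just for coefficients, because integration
  has to continue with the quotient in \<open>Gam Y\<close>.\<close>

definition kappa_multiple :: "lie_type \<Rightarrow> series \<Rightarrow> bool" where
  "kappa_multiple Y f \<longleftrightarrow> (\<exists>g \<in> Gam Y. f = of_int (kappa Y) * g)"

lemma kappa_multiple_zero: "kappa_multiple Y 0"
  unfolding kappa_multiple_def using Gam_closed(2) by (metis mult_zero_right)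

lemma kappa_multiple_add: "kappa_multiple Y f \<Longrightarrow> kappa_multiple Y g \<Longrightarrow> kappa_multiple Y (f + g)"
  unfolding kappa_multiple_def using Gam_closed(4) by (metis distrib_left)

lemma kappa_multiple_minus: "kappa_multiple Y f \<Longrightarrow> kappa_multiple Y g \<Longrightarrow> kappa_multiple Y (f - g)"
  unfolding kappa_multiple_def using Gam_closed(3) by (metis right_diff_distrib)

lemma kappa_multiple_sum: "(\<And>x. x \<in> A \<Longrightarrow> kappa_multiple Y (f x)) \<Longrightarrow> kappa_multiple Y (sum f A)"
  by (induction A rule: infinite_finite_induct) (simp_all add: kappa_multiple_zero kappa_multiple_add)

lemma kappa_multiple_mult:
  "kappa_multiple Y f \<Longrightarrow> g \<in> Gam Y \<Longrightarrow> kappa_multiple Y (f * g)"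
  "kappa_multiple Y f \<Longrightarrow> g \<in> Gam Y \<Longrightarrow> kappa_multiple Y (g * f)"
  unfolding kappa_multiple_def using Gam_closed(5) by (metis mult.assoc, metis mult.left_commute)

text \<open>Stability and divisibility go together: in each term of the product rule one factor is
  divisible, and its cofactor must lie in the ring.\<close>

lemma D_op_Gam_aux: "f \<in> Gam Y \<Longrightarrow> (\<forall>k. D_op k f \<in> Gam Y) \<and> (\<forall>k\<ge>1. kappa_multiple Y (D_op k f))"
  unfolding Gam_def[of Y]
proof (induction rule: generated_subring.induct)
  case (generator g)
  then obtain l where l: "l \<ge> 1" "g = Gam_gen Y l" by auto
  have km: "kappa_multiple Y (D_op k g)" if "k \<ge> 1" for k
    unfolding l(2) D_op_Gam_gen[OF l(1) that] using Q_in_Gam kappa_multiple_zero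
    by (auto simp: kappa_multiple_def)
  moreover have "D_op k g \<in> Gam Y" for k
  proof (cases "k = 0")
    case True
    then show ?thesis using l Gam_gen_in_Gam[of l Y] D_op_0 Gam_Gamma' by metis
  next
    case False
    then show ?thesis using km[of k] by (auto simp: kappa_multiple_def Gam_closed)
  qed
  ultimately show ?case by (simp add: Gam_def)
next
  case one
  then show ?case using kappa_multiple_zero Gam_closed unfolding Gam_def by (auto simp: D_op_one)
next
  case (diff a b)
  then show ?case by (auto simp: D_op_minus intro!: kappa_multiple_minus generated_subring.diff)
next
  case (mult a b)
  have m: "D_op k a \<in> Gam Y" "D_op k b \<in> Gam Y" for k using mult.IH by (simp_all add: Gam_def)
  then have "D_op k (a * b) \<in> Gam Y" for k by (simp add: D_op_mult Gam_sum Gam_closed)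
  moreover have "kappa_multiple Y (D_op k (a * b))" if "k \<ge> 1" for k
    unfolding D_op_mult
  proof (rule kappa_multiple_sum)
    fix i assume "i \<in> {..k}"
    then show "kappa_multiple Y (D_op i a * D_op (k - i) b)"
      using that mult.IH m by (cases "i = 0") (auto intro: kappa_multiple_mult)
  qed
  ultimately show ?case by (simp add: Gam_def)
qed

lemma D_op_Gam: "f \<in> Gam Y \<Longrightarrow> D_op k f \<in> Gam Y"
  using D_op_Gam_aux by blast

lemma D_op_kappa_multiple: "f \<in> Gam Y \<Longrightarrow> k \<ge> 1 \<Longrightarrow> kappa_multiple Y (D_op k f)"
  using D_op_Gam_aux by blast

text \<open>
  The vertex operator of the Schur \<open>Q\<close>-functions: the coefficient of \<open>u\<^sup>k\<close> in \<open>Q(u) D(- 1 / u) h_elem\<close>.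
  It adds a new largest part \<open>k\<close>, that is, \<open>D\<^sub>k\<close> undoes it while \<open>D\<^sub>m\<close> for \<open>m > k\<close> kills the result.
\<close>

definition vertex_op :: "lie_type \<Rightarrow> nat \<Rightarrow> series \<Rightarrow> series" where
  "vertex_op Y k f = (\<Sum>i\<le>k. (- 1) ^ i * Gam_gen Y (k + i) * D_op i f)"

lemma vertex_op_in_Gam: "k \<ge> 1 \<Longrightarrow> f \<in> Gam Y \<Longrightarrow> vertex_op Y k f \<in> Gam Y"
  unfolding vertex_op_def using Gam_closed(6)[of "(- 1) ^ _" Y]
  by (intro Gam_sum) (auto intro!: Gam_closed(5) Gam_gen_in_Gam D_op_Gam simp del: One_nat_def)

lemma D_op_signed: "D_op k ((- 1) ^ i * f) = (- 1) ^ i * D_op k f"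
  using D_op_of_int[of k "(- 1) ^ i" f] by simp

lemma D_op_vertex_op:
  assumes k: "k \<ge> 1" and f: "f \<in> Gam Y" and top: "\<And>a. a \<ge> k \<Longrightarrow> D_op a f = 0" and m: "m \<ge> k"
  shows "D_op m (vertex_op Y k f) = (if m = k then of_int (kappa Y) * f else 0)"
proof -
  have f': "f \<in> Gamma'" using f by (rule Gam_Gamma')
  have "m \<ge> 1" using k m by simp
  \<comment> \<open>The term of the product rule in which \<open>D_j\<close> with j = m - a hits the
    generator. Its \<open>Q\<close> depends on \<open>i + a\<close> only, so summing along
    antidiagonals will produce \<open>T_op\<close>.\<close>
  define t where "t i a = (if m \<le> k + i + a then (- 1) ^ i * Q_fun (k + i + a - m) * D_op i (D_op a f) else 0)" for i a
  have t0: "t i a = 0" if "i \<ge> k \<or> a \<ge> k" for i a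
    using that top D_op_commute[OF f', of i a] by (auto simp: t_def)
  have "D_op m (Gam_gen Y (k + i) * D_op i f) = of_int (kappa Y) * ((- 1) ^ i * (\<Sum>a<m. t i a))" for i
  proof -
    have z: "Gam_gen Y (k + i) \<in> Gamma'" using k by (intro Gam_Gamma'[OF Gam_gen_in_Gam]) simp
    \<comment> \<open>The term j = 0 drops out because \<open>D_m f = 0\<close>; for the others
      \<open>D_op_Gam_gen\<close> gives \<open>kappa\<close> times a \<open>Q_fun\<close>.\<close>
    have "{..m} = insert 0 {1..m}" by auto
    then have "D_op m (Gam_gen Y (k + i) * D_op i f) = (\<Sum>j = 1..m. D_op j (Gam_gen Y (k + i)) * D_op (m - j) (D_op i f))"
      using D_op_commute[OF f', of m i] top[OF m] by (simp add: D_op_mult)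
    also have "\<dots> = (\<Sum>a<m. D_op (m - a) (Gam_gen Y (k + i)) * D_op a (D_op i f))"
      by (rule sum.reindex_bij_witness[of _ "\<lambda>a. m - a" "\<lambda>j. m - j"]) auto
    also have "\<dots> = (\<Sum>a<m. of_int (kappa Y) * ((- 1) ^ i * t i a))"
    proof (rule sum.cong)
      fix a assume "a \<in> {..<m}"
      then have "m - a \<ge> 1" "m - a \<le> k + i \<longleftrightarrow> m \<le> k + i + a" "k + i - (m - a) = k + i + a - m" by auto
      then have "D_op (m - a) (Gam_gen Y (k + i)) = (if m \<le> k + i + a then of_int (kappa Y) * Q_fun (k + i + a - m) else 0)"
        using D_op_Gam_gen[of "k + i" "m - a" Y] k by simp
      moreover have "(- 1) ^ i * ((- 1) ^ i * F) = (F :: series)" for F by (simp flip: mult.assoc power_add)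
      ultimately show "D_op (m - a) (Gam_gen Y (k + i)) * D_op a (D_op i f) = of_int (kappa Y) * ((- 1) ^ i * t i a)"
        using D_op_commute[OF f', of i a] by (simp add: t_def mult.assoc)
    qed simp
    finally show ?thesis by (simp add: sum_distrib_left)
  qed
  then have "D_op m (vertex_op Y k f) = (\<Sum>i\<le>k. (- 1) ^ i * (of_int (kappa Y) * ((- 1) ^ i * (\<Sum>a<m. t i a))))"
    by (simp add: vertex_op_def D_op_sum D_op_signed mult.assoc)
  also have "\<dots> = of_int (kappa Y) * (\<Sum>i\<le>k. \<Sum>a<m. t i a)"
  proof -
    have "(- 1) ^ i * (c * ((- 1) ^ i * F)) = c * (F :: series)" for i c F
    proof -
      have "(- 1) ^ i * (c * ((- 1) ^ i * F)) = c * ((- 1) ^ i * (- 1) ^ i * F)" by (simp only: mult_ac)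
      also have "(- 1) ^ i * (- 1) ^ i = (1 :: series)" by (simp flip: power_add)
      finally show ?thesis by simp
    qed
    then show ?thesis by (simp add: sum_distrib_left)
  qed
  also have "(\<Sum>i\<le>k. \<Sum>a<m. t i a) = (\<Sum>(i, a)\<in>{..k} \<times> {..<m}. t i a)"
    by (rule sum.cartesian_product)
  \<comment> \<open>Outside the rectangle one of the indices is at least \<open>k\<close>, and then
    the term vanishes; so the sum extends to a full triangle.\<close>
  also have "\<dots> = (\<Sum>(i, a)\<in>{(i, a). i + a \<le> k + m}. t i a)"
  proof (rule sum.mono_neutral_left)
    show "finite {(i, a). i + a \<le> k + m}"
      by (rule finite_subset[of _ "{..k + m} \<times> {..k + m}"]) auto
    show "\<forall>x\<in>{(i, a). i + a \<le> k + m} - {..k} \<times> {..<m}. (case x of (i, a) \<Rightarrow> t i a) = 0"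
    proof
      fix x assume "x \<in> {(i, a). i + a \<le> k + m} - {..k} \<times> {..<m}"
      then obtain i a where "x = (i, a)" "i > k \<or> a \<ge> m" by force
      then show "(case x of (i, a) \<Rightarrow> t i a) = 0" using t0[of i a] m by auto
    qed
  qed auto
  also have "\<dots> = (\<Sum>s\<le>k + m. \<Sum>i\<le>s. t i (s - i))"
    by (rule sum.triangle_reindex_eq)
  also have "\<dots> = (\<Sum>s\<le>k + m. if s = 0 then (if m = k then f else 0) else 0)"
  proof (rule sum.cong)
    fix s
    \<comment> \<open>An antidiagonal is a \<open>Q_fun\<close> times \<open>T_op s f\<close>, so
      only s = 0 survives; there the condition m <= k leaves just m = k.\<close>
    have "(\<Sum>i\<le>s. t i (s - i)) = (if m \<le> k + s then Q_fun (k + s - m) * T_op s f else 0)"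
      unfolding T_op_def by (auto simp: t_def sum_distrib_left mult_ac intro!: sum.cong)
    also have "\<dots> = (if s = 0 then (if m = k then f else 0) else 0)"
      using T_op_vanish[OF f'] T_op_0[OF f'] m by (cases "s = 0") auto
    finally show "(\<Sum>i\<le>s. t i (s - i)) = (if s = 0 then (if m = k then f else 0) else 0)" .
  qed simp
  finally show ?thesis by simp
qed

text \<open>The integrability conditions for \<open>D_j f = g j\<close>. The second is
  \<open>T_op m f = 0\<close> written in terms of \<open>g\<close>; its terms i = 0 and i = m stand
  apart because they contain \<open>D_0\<close>.\<close>

definition compatible :: "(nat \<Rightarrow> series) \<Rightarrow> bool" where
  "compatible g \<longleftrightarrow> (\<forall>i\<ge>1. \<forall>j\<ge>1. D_op i (g j) = D_op j (g i)) \<and>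
    (\<forall>m\<ge>1. g m + (- 1) ^ m * g m + (\<Sum>i = 1..<m. (- 1) ^ i * D_op i (g (m - i))) = 0)"

lemma compatible_commute: "compatible g \<Longrightarrow> i \<ge> 1 \<Longrightarrow> j \<ge> 1 \<Longrightarrow> D_op i (g j) = D_op j (g i)"
  unfolding compatible_def by blast

lemma compatible_relation:
  "compatible g \<Longrightarrow> m \<ge> 1 \<Longrightarrow> g m + (- 1) ^ m * g m + (\<Sum>i = 1..<m. (- 1) ^ i * D_op i (g (m - i))) = 0"
  unfolding compatible_def by blast

lemma compatible_D_op:
  assumes "f \<in> Gamma'" shows "compatible (\<lambda>j. D_op j f)"
proof -
  have "D_op m f + (- 1) ^ m * D_op m f + (\<Sum>i = 1..<m. (- 1) ^ i * D_op i (D_op (m - i) f)) = T_op m f"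
    if "m \<ge> 1" for m
  proof -
    have "{..m} = insert 0 (insert m {1..<m})" using that by auto
    moreover have "D_op 0 (D_op m f) = D_op m f"
      using D_op_commute[OF assms, of 0 m] D_op_0[OF assms] by simp
    ultimately show ?thesis using that by (simp add: T_op_def D_op_0[OF assms] add.assoc)
  qed
  then show ?thesis using D_op_commute[OF assms] T_op_vanish[OF assms] by (simp add: compatible_def)
qed

lemma compatible_minus:
  assumes "compatible g" "compatible g'" shows "compatible (\<lambda>j. g j - g' j)"
proof -
  have "g m - g' m + (- 1) ^ m * (g m - g' m) + (\<Sum>i = 1..<m. (- 1) ^ i * D_op i (g (m - i) - g' (m - i)))
      = (g m + (- 1) ^ m * g m + (\<Sum>i = 1..<m. (- 1) ^ i * D_op i (g (m - i))))
      - (g' m + (- 1) ^ m * g' m + (\<Sum>i = 1..<m. (- 1) ^ i * D_op i (g' (m - i))))" for m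
    by (simp add: D_op_minus right_diff_distrib sum_subtractf)
  then have "g m - g' m + (- 1) ^ m * (g m - g' m) + (\<Sum>i = 1..<m. (- 1) ^ i * D_op i (g (m - i) - g' (m - i))) = 0"
    if "m \<ge> 1" for m
    by (simp only: compatible_relation[OF assms(1) that] compatible_relation[OF assms(2) that] diff_zero)
  moreover have "D_op i (g j - g' j) = D_op j (g i - g' i)" if "i \<ge> 1" "j \<ge> 1" for i j
    using compatible_commute[OF assms(1) that] compatible_commute[OF assms(2) that] by (simp add: D_op_minus)
  ultimately show ?thesis unfolding compatible_def by blast
qed

text \<open>The largest \<open>k\<close> with \<open>g k \<noteq> 0\<close> is removed by subtracting a vertex operator.\<close>

lemma integrate:
  assumes "compatible g" "\<And>j. j \<ge> 1 \<Longrightarrow> kappa_multiple Y (g j)" "\<And>j. j > k \<Longrightarrow> g j = 0"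
  shows "\<exists>f \<in> Gam Y. \<forall>j\<ge>1. D_op j f = g j"
  using assms
proof (induction k arbitrary: g)
  case 0
  then show ?case using Gam_closed(2)[of Y] by (intro bexI[of _ 0]) auto
next
  case (Suc k)
  let ?k = "Suc k"
  have comm: "D_op i (g j) = D_op j (g i)" if "i \<ge> 1" "j \<ge> 1" for i j
    using Suc.prems(1) that by (rule compatible_commute)
  obtain f where f: "f \<in> Gam Y" "g ?k = of_int (kappa Y) * f"
    using Suc.prems(2)[of ?k] by (auto simp: kappa_multiple_def)
  \<comment> \<open>For j beyond the top index this is commutation with \<open>g j = 0\<close>. For
    j equal to it, the relation of twice that index has only its middle term left. These are the
    hypotheses under which \<open>vertex_op\<close> inverts \<open>D_op\<close>.\<close>
  have dzg: "D_op j (g ?k) = 0" if "j \<ge> ?k" for j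
  proof (cases "j = ?k")
    case False
    then show ?thesis using comm[of j ?k] Suc.prems(3)[of j] that by simp
  next
    case True
    have "(- 1) ^ i * D_op i (g (2 * ?k - i)) = (if i = ?k then (- 1) ^ ?k * D_op ?k (g ?k) else 0)"
      if "i \<in> {1..<2 * ?k}" for i
    proof -
      consider "i < ?k" | "i = ?k" | "i > ?k" by linarith
      then show ?thesis
      proof cases
        case 1
        then have "g (2 * ?k - i) = 0" by (intro Suc.prems) simp
        then show ?thesis using 1 by simp
      next
        case 2
        then show ?thesis by (simp add: mult_2)
      next
        case 3
        then have "g i = 0" by (rule Suc.prems)
        then show ?thesis using 3 that comm[of i "2 * ?k - i"] by simp
      qed
    qed
    then have "(\<Sum>i = 1..<2 * ?k. (- 1) ^ i * D_op i (g (2 * ?k - i)))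
        = (\<Sum>i = 1..<2 * ?k. if i = ?k then (- 1) ^ ?k * D_op ?k (g ?k) else 0)"
      by (rule sum.cong[OF refl])
    also have "\<dots> = (- 1) ^ ?k * D_op ?k (g ?k)" by simp
    finally have s: "(\<Sum>i = 1..<2 * ?k. (- 1) ^ i * D_op i (g (2 * ?k - i))) = (- 1) ^ ?k * D_op ?k (g ?k)" .
    have "g (2 * ?k) = 0" by (rule Suc.prems) simp
    then have "(- 1) ^ ?k * D_op ?k (g ?k) = 0"
using compatible_relation[OF Suc.prems(1), of "2 * ?k"] unfolding s by simp
    then have "(- 1) ^ ?k * ((- 1) ^ ?k * D_op ?k (g ?k)) = 0" by simp
    then show ?thesis using True by (simp del: power_Suc flip: mult.assoc power_add)
  qed
  have dzf: "D_op j f = 0" if "j \<ge> ?k" for j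
  proof (rule of_int_cancel[OF kappa_nonzero[of Y]])
    show "of_int (kappa Y) * D_op j f = of_int (kappa Y) * 0"
      using dzg[OF that] f(2) by (simp add: D_op_of_int)
  qed
  let ?b = "vertex_op Y ?k f"
  have b: "?b \<in> Gam Y" by (rule vertex_op_in_Gam) (simp_all add: f)
  have "\<exists>f' \<in> Gam Y. \<forall>j\<ge>1. D_op j f' = g j - D_op j ?b"
  proof (rule Suc.IH)
    show "compatible (\<lambda>j. g j - D_op j ?b)"
      using Suc.prems(1) compatible_D_op[OF Gam_Gamma'[OF b]] by (rule compatible_minus)
    show "kappa_multiple Y (g j - D_op j ?b)" if "j \<ge> 1" for j
      using Suc.prems(2)[OF that] D_op_kappa_multiple[OF b that] by (rule kappa_multiple_minus)
    show "g j - D_op j ?b = 0" if "j > k" for j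
      using D_op_vertex_op[of ?k f Y j] that f dzf Suc.prems(3)[of j] by (cases "j = ?k") auto
  qed
  then obtain f' where "f' \<in> Gam Y" "\<forall>j\<ge>1. D_op j f' = g j - D_op j ?b" by blast
  then show ?case using b by (intro bexI[of _ "f' + ?b"]) (simp_all add: D_op_add Gam_closed)
qed

section \<open>The coefficients of \<open>C(z)\<close>\<close>

text \<open>As \<open>z\<close> enters \<open>C(z)\<close> only through multiples of
  \<open>z * u_i\<close>, the value at 1 carries all the information, and the power of
  \<open>z\<close> is the length.\<close>

definition C_coeff :: "int nilcox" where
  "C_coeff = nlim (\<lambda>Y n. C_prod Y n 1)"

lemma ring_hom_of_int_map: "ring_hom (of_int :: int \<Rightarrow> 'a :: comm_ring_1)"
  by (simp add: ring_hom_def)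

lemma ncoeff_C_prod:
  assumes "w \<in> parabolic Y n" shows "ncoeff (C_prod Y n a) Y w = a ^ len Y w * of_int (ncoeff C_coeff Y w)"
proof -
  have "ncong Y n C_coeff (C_prod Y n 1)"
    unfolding C_coeff_def by (rule ncong_nlim) (simp add: ncong_C_prod)
  then have c: "ncoeff C_coeff Y w = ncoeff (C_prod Y n 1) Y w" using assms by (simp add: ncong_def)
  have "nscale a (nmap of_int (C_prod Y n (1 :: int))) = C_prod Y n (a * of_int 1)"
    using ring_hom_map_C_prod[of "nscale a \<circ> nmap of_int" "\<lambda>b :: int. a * of_int b" Y n 1]
    by (simp add: ring_hom_comp ring_hom_nscale ring_hom_nmap ring_hom_of_int_map nmap_h_elem nscale_h_elem mult.left_commute)
  then have "ncoeff (C_prod Y n a) Y w = ncoeff (nscale a (nmap of_int (C_prod Y n (1 :: int)))) Y w" by simp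
  then show ?thesis by (simp add: ncoeff_nscale ncoeff_nmap ring_hom_of_int_map c)
qed

lemma ncoeff_C_coeff_id: "ncoeff C_coeff Y id = 1"
proof -
  have "C_prod Y n (0 :: int) = 1" for n
    by (cases Y) (simp_all add: C_prod_def down_prod_def up_prod_def map_replicate_const)
  then show ?thesis using ncoeff_C_prod[of id Y 0 "0 :: int"] by (simp add: ncoeff_one)
qed

lemma ncoeff_C_coeff_inv: "w \<in> Weyl_group Y \<Longrightarrow> ncoeff C_coeff Y (inv w) = ncoeff C_coeff Y w"
proof -
  assume w: "w \<in> Weyl_group Y"
  then obtain n where n: "w \<in> parabolic Y n" using parabolic_exhaust by blast
  have "ncoeff (C_prod Y n (1 :: int)) Y (inv w) = ncoeff (C_prod Y n 1) Y w"
    using w ncoeff_nrev[OF w, of "C_prod Y n (1 :: int)"] by (simp add: nrev_C_prod)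
  then show ?thesis using ncoeff_C_prod[OF n, of "1 :: int"] ncoeff_C_prod[OF parabolic_inv[OF n], of "1 :: int"] by simp
qed

text \<open>Modulo 2 the base \<open>h_0(2)\<close> is 1, and wrapping 1 in two factors
  \<open>h_n(1)\<close> gives \<open>h_n(2)\<close>, again 1. This supplies the divisibility by
  \<open>kappa\<close> that integration demands.\<close>

lemma C_prod_TypeC_even: "\<exists>F. C_prod TypeC n (1 :: int) = 1 + (F + F)"
proof (induction n)
  case 0
  have "C_prod TypeC 0 (1 :: int) = 1 + (gen (Idx 0) + gen (Idx 0))"
    by (rule nilcox_eqI) (simp add: C_prod_start h_elem_def)
  then show ?case ..
next
  case (Suc n)
  show ?case
  proof (cases "start TypeC \<le> n")
    case True
    from Suc obtain F where F: "C_prod TypeC n (1 :: int) = 1 + (F + F)" ..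
    let ?h = "h_elem (Idx n) (1 :: int)"
    have "C_prod TypeC (Suc n) (1 :: int) = ?h * ?h + (?h * F * ?h + ?h * F * ?h)"
      using True by (simp add: C_prod_Suc F distrib_left distrib_right)
    also have "?h * ?h = 1 + (gen (Idx n) + gen (Idx n))"
      unfolding h_elem_add by (rule nilcox_eqI) (simp add: h_elem_def)
    finally have "C_prod TypeC (Suc n) (1 :: int) = 1 + ((gen (Idx n) + ?h * F * ?h) + (gen (Idx n) + ?h * F * ?h))"
      by (simp add: add_ac)
    then show ?thesis ..
  next
    case False
    then have "C_prod TypeC (Suc n) (1 :: int) = C_prod TypeC n 1" by (simp add: C_prod_start)
    then show ?thesis using Suc by simp
  qed
qed

lemma C_coeff_kappa: "w \<in> Weyl_group Y \<Longrightarrow> w \<noteq> id \<Longrightarrow> kappa Y dvd ncoeff C_coeff Y w"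
proof (cases "Y = TypeC")
  case True
  assume w: "w \<in> Weyl_group Y" "w \<noteq> id"
  then obtain n where n: "w \<in> parabolic Y n" using parabolic_exhaust by blast
  obtain F where "C_prod TypeC n (1 :: int) = 1 + (F + F)" using C_prod_TypeC_even by blast
  then have "ncoeff C_coeff Y w = ncoeff F Y w + ncoeff F Y w"
    using ncoeff_C_prod[OF n, of "1 :: int"] True w by (simp add: ncoeff_one)
  then show ?thesis by (simp add: kappa_def)
qed (simp add: kappa_def)

section \<open>Homogeneous parts of C(z)\<close>

definition C_part :: "nat \<Rightarrow> int nilcox" where
  "C_part k = mk_nilcox (\<lambda>Y w. if len Y w = k then ncoeff C_coeff Y w else 0)"

lemma ncoeff_C_part: "w \<in> Weyl_group Y \<Longrightarrow> ncoeff (C_part k) Y w = (if len Y w = k then ncoeff C_coeff Y w else 0)"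
  by (simp add: C_part_def)

lemma C_part_0: "C_part 0 = 1"
  by (rule nilcox_eqI) (auto simp: ncoeff_C_part ncoeff_one len_eq_0_iff ncoeff_C_coeff_id)

lemma ncoeff_C_part_mult:
  assumes w: "w \<in> Weyl_group Y"
  shows "ncoeff (C_part j * C_part k) Y w = (if j + k = len Y w then
    (\<Sum>(u, v)\<in>factorizations Y w. if len Y u = j then ncoeff C_coeff Y u * ncoeff C_coeff Y v else 0) else 0)"
  unfolding ncoeff_times[OF w]
  by (auto simp: ncoeff_C_part dest!: factsD intro!: sum.cong sum.neutral)

text \<open>\<open>C_prod_commute\<close> holds over every commutative ring. With parameters
  \<open>fps_X\<close> and 1, the exponent of \<open>fps_X\<close> records the length of one factor
  and separates the homogeneous parts.\<close>

lemma C_part_commute: "C_part j * C_part k = C_part k * C_part j"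
proof (rule nilcox_eqI)
  fix Y w assume w: "w \<in> Weyl_group Y"
  then obtain n where n: "w \<in> parabolic Y n" using parabolic_exhaust by blast
  let ?X = "fps_X :: int fps"
  let ?c = "ncoeff C_coeff Y"
  have X: "fps_nth (?X ^ i * of_int a * of_int b) j = (if i = j then a * b else 0)" for i j a b
  proof -
    have "?X ^ i * of_int a * of_int b = ?X ^ i * fps_const (a * b)"
      by (simp add: mult.assoc fps_of_int[symmetric])
    then show ?thesis by (auto simp: fps_X_power_mult_nth)
  qed
  have lhs: "ncoeff (C_prod Y n ?X * C_prod Y n 1) Y w = (\<Sum>(u, v)\<in>factorizations Y w. ?X ^ len Y u * of_int (?c u) * of_int (?c v))"
    unfolding ncoeff_times[OF w] by (rule sum.cong) (auto simp: ncoeff_C_prod factorizations_parabolic[OF _ n])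
  have rhs: "ncoeff (C_prod Y n 1 * C_prod Y n ?X) Y w = (\<Sum>(u, v)\<in>factorizations Y w. ?X ^ len Y v * of_int (?c u) * of_int (?c v))"
    unfolding ncoeff_times[OF w] by (rule sum.cong) (auto simp: ncoeff_C_prod factorizations_parabolic[OF _ n])
  have "fps_nth (ncoeff (C_prod Y n ?X * C_prod Y n 1) Y w) j = fps_nth (ncoeff (C_prod Y n 1 * C_prod Y n ?X) Y w) j"
    by (simp only: C_prod_commute)
  then have "(\<Sum>(u, v)\<in>factorizations Y w. if len Y u = j then ?c u * ?c v else 0)
      = (\<Sum>(u, v)\<in>factorizations Y w. if len Y v = j then ?c u * ?c v else 0)"
    unfolding lhs rhs by (simp only: fps_sum_nth case_prod_unfold X)
  moreover have "(\<Sum>(u, v)\<in>factorizations Y w. if len Y v = j then ?c u * ?c v else 0)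
      = (\<Sum>(u, v)\<in>factorizations Y w. if len Y u = k then ?c u * ?c v else 0)" if "j + k = len Y w"
    by (rule sum.cong) (use that in \<open>auto dest!: factsD\<close>)
  ultimately show "ncoeff (C_part j * C_part k) Y w = ncoeff (C_part k * C_part j) Y w"
    by (auto simp: ncoeff_C_part_mult[OF w] add.commute)
qed

text \<open>The part of length \<open>m\<close> in \<open>C(- 1) C(1) = 1\<close>; the sign records
  the length of the first factor.\<close>

lemma C_part_alternating:
  assumes "m \<ge> 1" shows "(\<Sum>i\<le>m. smul ((- 1) ^ i) (C_part i * C_part (m - i))) = 0"
proof (rule nilcox_eqI)
  fix Y w assume w: "w \<in> Weyl_group Y"
  then obtain n where n: "w \<in> parabolic Y n" using parabolic_exhaust by blast
  let ?c = "ncoeff C_coeff Y"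
  show "ncoeff (\<Sum>i\<le>m. smul ((- 1) ^ i) (C_part i * C_part (m - i))) Y w = ncoeff 0 Y w"
  proof (cases "len Y w = m")
    case True
    then have "w \<noteq> id" using assms by auto
    have "ncoeff (\<Sum>i\<le>m. smul ((- 1) ^ i) (C_part i * C_part (m - i))) Y w
        = (\<Sum>i\<le>m. \<Sum>(u, v)\<in>factorizations Y w. if len Y u = i then (- 1) ^ i * (?c u * ?c v) else 0)"
      using True by (auto simp: ncoeff_C_part_mult[OF w] sum_distrib_left case_prod_unfold intro!: sum.cong)
    also have "\<dots> = (\<Sum>(u, v)\<in>factorizations Y w. (- 1) ^ len Y u * (?c u * ?c v))"
      using True by (subst sum.swap) (auto simp: case_prod_unfold dest!: factsD intro!: sum.cong)
    also have "\<dots> = ncoeff (C_prod Y n (- 1) * C_prod Y n 1) Y w"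
      unfolding ncoeff_times[OF w]
      by (rule sum.cong) (auto simp: ncoeff_C_prod factorizations_parabolic[OF _ n] mult.assoc)
    also have "\<dots> = 0" using C_prod_inverse[of Y n "- 1 :: int"] \<open>w \<noteq> id\<close> by (simp add: ncoeff_one)
    finally show ?thesis by simp
  next
    case False
    then show ?thesis by (auto simp: ncoeff_C_part_mult[OF w] intro!: sum.neutral)
  qed
qed

lemma nrev_C_part: "nrev (C_part k) = C_part k"
  by (rule nilcox_eqI) (simp add: ncoeff_nrev ncoeff_C_part inv_in_Weyl len_inv ncoeff_C_coeff_inv)

definition C_part_series :: "nat \<Rightarrow> series nilcox" where
  "C_part_series k = nmap of_int (C_part k)"

lemma ncoeff_C_part_series: "w \<in> Weyl_group Y \<Longrightarrow> ncoeff (C_part_series k) Y w = (if len Y w = k then of_int (ncoeff C_coeff Y w) else 0)"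
  by (simp add: C_part_series_def ncoeff_nmap ring_hom_of_int_map ncoeff_C_part)

lemma C_part_series_0: "C_part_series 0 = 1"
  by (simp add: C_part_series_def C_part_0 ring_hom_one[OF ring_hom_nmap[OF ring_hom_of_int_map]])

lemma C_part_series_commute: "C_part_series j * C_part_series k = C_part_series k * C_part_series j"
  unfolding C_part_series_def by (simp only: ring_hom_mult[OF ring_hom_nmap[OF ring_hom_of_int_map], symmetric] C_part_commute)

lemma C_part_series_alternating:
  assumes "m \<ge> 1" shows "(\<Sum>i\<le>m. smul ((- 1) ^ i) (C_part_series i * C_part_series (m - i))) = 0"
proof -
  have smul: "nmap of_int (smul a F) = smul (of_int a) (nmap of_int F :: series nilcox)" for a :: int and F
    by (rule nilcox_eqI) (simp add: ncoeff_nmap ring_hom_of_int_map)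
  have "(\<Sum>i\<le>m. smul ((- 1) ^ i) (C_part_series i * C_part_series (m - i))) = nmap of_int (\<Sum>i\<le>m. smul ((- 1) ^ i) (C_part i * C_part (m - i)))"
    unfolding C_part_series_def
    by (simp add: ring_hom_sum[OF ring_hom_nmap[OF ring_hom_of_int_map]] smul ring_hom_mult[OF ring_hom_nmap[OF ring_hom_of_int_map]])
  then show ?thesis by (simp add: C_part_alternating[OF assms] ring_hom_zero[OF ring_hom_nmap[OF ring_hom_of_int_map]])
qed

lemma nrev_C_part_series: "nrev (C_part_series k) = C_part_series k"
  by (simp add: C_part_series_def nmap_nrev[OF ring_hom_of_int_map, symmetric] nrev_C_part)

section \<open>The Stanley symmetric functions\<close>

text \<open>One step of a recursion on length: for k >= 1 the prescribed \<open>D_k r\<close> only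
  involves \<open>f\<close> at shorter elements. The constant term is invisible to these operators
  and is fixed separately.\<close>

definition stanley_step :: "lie_type \<Rightarrow> ((int \<Rightarrow> int) \<Rightarrow> series) \<Rightarrow> (int \<Rightarrow> int) \<Rightarrow> series \<Rightarrow> bool" where
  "stanley_step Y f w r \<longleftrightarrow> (w \<in> Weyl_group Y \<longrightarrow> r \<in> Gam Y \<and> coeff r 0 = (if w = id then 1 else 0) \<and>
    (\<forall>k\<ge>1. D_op k r = ncoeff (C_part_series k * mk_nilcox (\<lambda>_. f)) Y w))"

lemma ncoeff_C_part_series_mult:
  assumes "w \<in> Weyl_group Y"
  shows "ncoeff (C_part_series k * F) Y w = (\<Sum>(u, v)\<in>factorizations Y w. if len Y u = k then of_int (ncoeff C_coeff Y u) * ncoeff F Y v else 0)"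
  unfolding ncoeff_times[OF assms] by (rule sum.cong) (auto simp: ncoeff_C_part_series dest!: factsD)

lemma ncoeff_C_part_series_mult_cong:
  assumes "w \<in> Weyl_group Y" "k \<ge> 1"
    "\<And>v. v \<in> Weyl_group Y \<Longrightarrow> len Y v < len Y w \<Longrightarrow> ncoeff F Y v = ncoeff G Y v"
  shows "ncoeff (C_part_series k * F) Y w = ncoeff (C_part_series k * G) Y w"
  unfolding ncoeff_C_part_series_mult[OF assms(1)]
proof (rule sum.cong[OF refl])
  fix x assume x: "x \<in> factorizations Y w"
  obtain u v where [simp]: "x = (u, v)" by (cases x)
  show "(case x of (u, v) \<Rightarrow> if len Y u = k then of_int (ncoeff C_coeff Y u) * ncoeff F Y v else 0)
    = (case x of (u, v) \<Rightarrow> if len Y u = k then of_int (ncoeff C_coeff Y u) * ncoeff G Y v else 0)"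
    using factsD[of u v Y w] x assms(2) assms(3)[of v] by auto
qed

text \<open>\<open>D_i\<close> acts on the shorter factor by the recursion and inserts a further
  \<open>C_i\<close>. Commuting parts then give the symmetric condition, the alternating sum gives
  the relation, and \<open>C_coeff_kappa\<close> gives divisibility.\<close>

lemma C_part_series_mult_integrable:
  assumes w: "w \<in> Weyl_group Y"
    and F: "\<And>v. v \<in> Weyl_group Y \<Longrightarrow> len Y v < len Y w \<Longrightarrow> ncoeff F Y v \<in> Gam Y \<and>
      (\<forall>k\<ge>1. D_op k (ncoeff F Y v) = ncoeff (C_part_series k * F) Y v)"
  shows "\<exists>f \<in> Gam Y. \<forall>k\<ge>1. D_op k f = ncoeff (C_part_series k * F) Y w"
proof -
  let ?g = "\<lambda>k. ncoeff (C_part_series k * F) Y w"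
  have smaller: "v \<in> Weyl_group Y \<and> len Y v < len Y w \<and> u \<in> Weyl_group Y \<and> u \<noteq> id"
    if "(u, v) \<in> factorizations Y w" "len Y u = k" "k \<ge> 1" for u v k
    using factsD[OF that(1)] that by auto
  have dzg: "D_op i (?g j) = ncoeff (C_part_series j * (C_part_series i * F)) Y w" if "i \<ge> 1" "j \<ge> 1" for i j
  proof -
    have "D_op i (?g j) = (\<Sum>(u, v)\<in>factorizations Y w. if len Y u = j then of_int (ncoeff C_coeff Y u) * D_op i (ncoeff F Y v) else 0)"
      by (simp add: ncoeff_C_part_series_mult[OF w] D_op_sum case_prod_unfold D_op_of_int if_distrib[of "D_op i"] cong: if_cong)
    also have "\<dots> = (\<Sum>(u, v)\<in>factorizations Y w. if len Y u = j then of_int (ncoeff C_coeff Y u) * ncoeff (C_part_series i * F) Y v else 0)"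
    proof (rule sum.cong[OF refl])
      fix x assume x: "x \<in> factorizations Y w"
      obtain u v where [simp]: "x = (u, v)" by (cases x)
      show "(case x of (u, v) \<Rightarrow> if len Y u = j then of_int (ncoeff C_coeff Y u) * D_op i (ncoeff F Y v) else 0)
        = (case x of (u, v) \<Rightarrow> if len Y u = j then of_int (ncoeff C_coeff Y u) * ncoeff (C_part_series i * F) Y v else 0)"
        using smaller[of u v j] x that F[of v] by auto
    qed
    finally show ?thesis by (simp only: ncoeff_C_part_series_mult[OF w, of j "C_part_series i * F"])
  qed
  have "compatible ?g"
    unfolding compatible_def
  proof (intro conjI allI impI)
    fix i j :: nat assume "i \<ge> 1" "j \<ge> 1"
    then show "D_op i (?g j) = D_op j (?g i)"
      using dzg[of i j] dzg[of j i] by (simp only: mult.assoc[symmetric] C_part_series_commute[of j i])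
  next
    fix m :: nat assume m: "m \<ge> 1"
    have s: "{..m} = insert 0 (insert m {1..<m})" using m by auto
    have "0 = ncoeff ((\<Sum>i\<le>m. smul ((- 1) ^ i) (C_part_series i * C_part_series (m - i))) * F) Y w"
      by (simp only: C_part_series_alternating[OF m] mult_zero_left ncoeff_zero)
    also have "\<dots> = (\<Sum>i\<le>m. (- 1) ^ i * ncoeff (C_part_series i * C_part_series (m - i) * F) Y w)"
      by (simp add: sum_distrib_right)
    also have "\<dots> = ?g m + ((- 1) ^ m * ?g m + (\<Sum>i = 1..<m. (- 1) ^ i * ncoeff (C_part_series i * C_part_series (m - i) * F) Y w))"
      unfolding s using m by (simp add: C_part_series_0)
    also have "(\<Sum>i = 1..<m. (- 1) ^ i * ncoeff (C_part_series i * C_part_series (m - i) * F) Y w)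
        = (\<Sum>i = 1..<m. (- 1) ^ i * D_op i (?g (m - i)))"
    proof (rule sum.cong)
      fix i assume "i \<in> {1..<m}"
      then show "(- 1) ^ i * ncoeff (C_part_series i * C_part_series (m - i) * F) Y w = (- 1) ^ i * D_op i (?g (m - i))"
        by (subst dzg) (auto simp: mult.assoc[symmetric] C_part_series_commute[of i])
    qed simp
    finally show "?g m + (- 1) ^ m * ?g m + (\<Sum>i = 1..<m. (- 1) ^ i * D_op i (?g (m - i))) = 0"
      by (simp add: add.assoc)
  qed
  moreover have "kappa_multiple Y (?g j)" if "j \<ge> 1" for j
    unfolding ncoeff_C_part_series_mult[OF w]
  proof (rule kappa_multiple_sum)
    fix x assume x: "x \<in> factorizations Y w"
    obtain u v where [simp]: "x = (u, v)" by (cases x)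
    show "kappa_multiple Y (case x of (u, v) \<Rightarrow> if len Y u = j then of_int (ncoeff C_coeff Y u) * ncoeff F Y v else 0)"
    proof (cases "len Y u = j")
      case True
      then have uv: "v \<in> Weyl_group Y" "len Y v < len Y w" "u \<in> Weyl_group Y" "u \<noteq> id"
        using smaller x that by auto
      obtain c where c: "ncoeff C_coeff Y u = kappa Y * c" using C_coeff_kappa[OF uv(3,4)] by (elim dvdE)
      have "of_int c * ncoeff F Y v \<in> Gam Y" using F[OF uv(1,2)] by (simp add: Gam_closed)
      then show ?thesis using True by (auto simp: c kappa_multiple_def mult.assoc)
    qed (simp add: kappa_multiple_zero)
  qed
  moreover have "?g j = 0" if "j > len Y w" for j
    unfolding ncoeff_C_part_series_mult[OF w] by (rule sum.neutral) (use that in \<open>auto dest!: factsD\<close>)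
  ultimately show ?thesis by (rule integrate)
qed

lemma stanley_exists: "\<exists>f. \<forall>w. stanley_step Y f w (f w)"
proof (rule dependent_wf_choice[where R = "measure (len Y)"])
  show "wf (measure (len Y))" by simp
next
  fix f g :: "(int \<Rightarrow> int) \<Rightarrow> series" and w r
  assume fg: "\<And>z. (z, w) \<in> measure (len Y) \<Longrightarrow> f z = g z"
  show "stanley_step Y f w r = stanley_step Y g w r"
  proof (cases "w \<in> Weyl_group Y")
    case True
    have "ncoeff (C_part_series k * mk_nilcox (\<lambda>_. f)) Y w = ncoeff (C_part_series k * mk_nilcox (\<lambda>_. g)) Y w" if "k \<ge> 1" for k
      using True that by (rule ncoeff_C_part_series_mult_cong) (simp add: fg)
    then show ?thesis by (auto simp: stanley_step_def)
  qed (simp add: stanley_step_def)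
next
  fix w and f :: "(int \<Rightarrow> int) \<Rightarrow> series"
  assume IH: "\<And>y. (y, w) \<in> measure (len Y) \<Longrightarrow> stanley_step Y f y (f y)"
  show "\<exists>r. stanley_step Y f w r"
  proof (cases "w \<in> Weyl_group Y")
    case True
    have "\<exists>r \<in> Gam Y. \<forall>k\<ge>1. D_op k r = ncoeff (C_part_series k * mk_nilcox (\<lambda>_. f)) Y w"
      by (rule C_part_series_mult_integrable[OF True]) (use IH in \<open>auto simp: stanley_step_def\<close>)
    then obtain r where r: "r \<in> Gam Y" "\<forall>k\<ge>1. D_op k r = ncoeff (C_part_series k * mk_nilcox (\<lambda>_. f)) Y w" by blast
    \<comment> \<open>Adding an integer corrects the constant term and changes no \<open>D_k\<close>
      with k >= 1.\<close>
    let ?c = "(if w = id then 1 else 0) - coeff r 0"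
    have "D_op k (of_int ?c) = 0" if "k \<ge> 1" for k
      using D_op_of_int[of k ?c 1] that by (simp add: D_op_one)
    moreover have "coeff (of_int ?c :: series) 0 = ?c"
      using coeff_of_int_mult[of ?c "1 :: series" 0] by (simp add: coeff_one)
    ultimately have "stanley_step Y f w (r + of_int ?c)"
      using r Gam_closed(6)[of ?c Y] by (simp add: stanley_step_def D_op_add Gam_closed)
    then show ?thesis ..
  qed (simp add: stanley_step_def)
qed

definition stanley :: "series nilcox" where
  "stanley = mk_nilcox (\<lambda>Y. SOME f. \<forall>w. stanley_step Y f w (f w))"

lemma stanley_props:
  assumes w: "w \<in> Weyl_group Y"
  shows stanley_in_Gam: "ncoeff stanley Y w \<in> Gam Y"
    and const_stanley: "coeff (ncoeff stanley Y w) 0 = (if w = id then 1 else 0)"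
    and D_op_stanley_pos: "k \<ge> 1 \<Longrightarrow> D_op k (ncoeff stanley Y w) = ncoeff (C_part_series k * stanley) Y w"
proof -
  let ?f = "SOME f. \<forall>w. stanley_step Y f w (f w)"
  have "\<forall>w. stanley_step Y ?f w (?f w)" by (rule someI_ex[OF stanley_exists])
  then have f: "stanley_step Y ?f w (?f w)" ..
  have st: "ncoeff stanley Y v = ?f v" if "v \<in> Weyl_group Y" for v using that by (simp add: stanley_def)
  have "ncoeff (C_part_series k * mk_nilcox (\<lambda>_. ?f)) Y w = ncoeff (C_part_series k * stanley) Y w" for k
    unfolding ncoeff_C_part_series_mult[OF w] by (rule sum.cong) (auto simp: st dest!: factsD)
  with f w st[OF w] show "ncoeff stanley Y w \<in> Gam Y" "coeff (ncoeff stanley Y w) 0 = (if w = id then 1 else 0)"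
    "k \<ge> 1 \<Longrightarrow> D_op k (ncoeff stanley Y w) = ncoeff (C_part_series k * stanley) Y w"
    by (simp_all add: stanley_step_def)
qed

lemma D_op_stanley:
  assumes "w \<in> Weyl_group Y" shows "D_op k (ncoeff stanley Y w) = ncoeff (C_part_series k * stanley) Y w"
  using D_op_stanley_pos[OF assms, of k] D_op_0[OF Gam_Gamma'[OF stanley_in_Gam[OF assms]]]
  by (cases "k = 0") (auto simp: C_part_series_0)

text \<open>The difference is killed by all \<open>D_k\<close> with k >= 1, hence constant.
  Identities among the coefficients of \<open>stanley\<close> are proved this way, by induction on
  the length.\<close>

lemma Gam_eqI:
  assumes "f \<in> Gam Y" "g \<in> Gam Y" "coeff f 0 = coeff g 0" "\<And>k. k \<ge> 1 \<Longrightarrow> D_op k f = D_op k g"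
  shows "f = g"
proof (rule mseries_eqI)
  fix m
  have "coeff (f - g) m = 0" if "m \<noteq> 0"
    by (rule D_op_kernel[OF Gam_Gamma'[OF Gam_closed(3)[OF assms(1,2)]]]) (use assms(4) that in \<open>simp_all add: D_op_minus\<close>)
  then show "coeff f m = coeff g m" using assms(3) by (cases "m = 0") auto
qed

lemma stanley_unique:
  assumes "\<And>Y w. w \<in> Weyl_group Y \<Longrightarrow> ncoeff G Y w \<in> Gam Y"
    and "\<And>Y w. w \<in> Weyl_group Y \<Longrightarrow> coeff (ncoeff G Y w) 0 = (if w = id then 1 else 0)"
    and "\<And>Y w k. w \<in> Weyl_group Y \<Longrightarrow> D_op k (ncoeff G Y w) = ncoeff (C_part_series k * G) Y w"
  shows "G = stanley"
proof (rule nilcox_eqI)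
  fix Y w assume "w \<in> Weyl_group Y"
  then show "ncoeff G Y w = ncoeff stanley Y w"
  proof (induction "len Y w" arbitrary: w rule: less_induct)
    case less
    show ?case
    proof (rule Gam_eqI[of _ Y])
      fix k :: nat assume "k \<ge> 1"
      with less show "D_op k (ncoeff G Y w) = D_op k (ncoeff stanley Y w)"
        using ncoeff_C_part_series_mult_cong[of w Y k G stanley] by (simp add: assms D_op_stanley)
    qed (use less.prems in \<open>simp_all add: assms stanley_in_Gam const_stanley\<close>)
  qed
qed

lemma D_op_ncoeff_mult_left:
  assumes "w \<in> Weyl_group Y"
  shows "D_op k (ncoeff (C_part_series j * stanley) Y w) = ncoeff (C_part_series j * (C_part_series k * stanley)) Y w"
proof -
  have "D_op k (ncoeff (C_part_series j * stanley) Y w)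
      = (\<Sum>(u, v)\<in>factorizations Y w. if len Y u = j then of_int (ncoeff C_coeff Y u) * D_op k (ncoeff stanley Y v) else 0)"
    by (simp add: ncoeff_C_part_series_mult[OF assms] D_op_sum case_prod_unfold D_op_of_int if_distrib[of "D_op k"] cong: if_cong)
  also have "\<dots> = ncoeff (C_part_series j * (C_part_series k * stanley)) Y w"
    unfolding ncoeff_C_part_series_mult[OF assms] by (rule sum.cong) (auto simp: D_op_stanley dest!: factsD)
  finally show ?thesis .
qed

lemma D_op_ncoeff_mult_right:
  assumes "w \<in> Weyl_group Y"
  shows "D_op k (ncoeff (stanley * C_part_series j) Y w) = ncoeff ((C_part_series k * stanley) * C_part_series j) Y w"
proof -
  have "D_op k (ncoeff stanley Y u * ncoeff (C_part_series j) Y v) = ncoeff (C_part_series k * stanley) Y u * ncoeff (C_part_series j) Y v"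
    if "(u, v) \<in> factorizations Y w" for u v
  proof -
    have "D_op k (f * of_int a) = D_op k f * of_int a" for a f
      using D_op_of_int[of k a f] by (simp only: mult.commute)
    then show ?thesis
      using factsD[OF that] by (auto simp: ncoeff_C_part_series D_op_stanley)
  qed
  then show ?thesis unfolding ncoeff_times[OF assms] D_op_sum by (intro sum.cong) auto
qed

lemma nmap_const_stanley: "nmap (\<lambda>f. coeff f 0) stanley = 1"
  by (rule nilcox_eqI) (simp add: ncoeff_nmap ring_hom_const_coeff const_stanley ncoeff_one)

lemma const_ncoeff: "coeff (ncoeff F Y w) 0 = ncoeff (nmap (\<lambda>f. coeff f 0) F) Y w"
  by (simp add: ncoeff_nmap ring_hom_const_coeff)

lemma C_part_series_stanley_in_Gam:
  assumes w: "w \<in> Weyl_group Y"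
  shows "ncoeff (C_part_series j * stanley) Y w \<in> Gam Y" "ncoeff (stanley * C_part_series j) Y w \<in> Gam Y"
proof -
  have "ncoeff (C_part_series j) Y u \<in> Gam Y" if "u \<in> Weyl_group Y" for u
    using that by (simp add: ncoeff_C_part_series Gam_closed)
  then show "ncoeff (C_part_series j * stanley) Y w \<in> Gam Y" "ncoeff (stanley * C_part_series j) Y w \<in> Gam Y"
    unfolding ncoeff_times[OF w] by (auto intro!: Gam_sum Gam_closed(5) stanley_in_Gam dest!: factsD)
qed

text \<open>Both sides solve the same recursion: \<open>D_k\<close> puts \<open>C_k\<close> in front
  of \<open>stanley\<close>, the parts of \<open>C\<close> commute, and the constant terms are those
  of \<open>C_j\<close> on both sides.\<close>

lemma C_part_series_stanley_commute: "C_part_series j * stanley = stanley * C_part_series j"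
proof (rule nilcox_eqI)
  fix Y w assume "w \<in> Weyl_group Y"
  then show "ncoeff (C_part_series j * stanley) Y w = ncoeff (stanley * C_part_series j) Y w"
  proof (induction "len Y w" arbitrary: w rule: less_induct)
    case less
    note w = less.prems
    show ?case
    proof (rule Gam_eqI[of _ Y])
      show "coeff (ncoeff (C_part_series j * stanley) Y w) 0 = coeff (ncoeff (stanley * C_part_series j) Y w) 0"
        by (simp add: const_ncoeff ring_hom_mult[OF ring_hom_nmap[OF ring_hom_const_coeff]] nmap_const_stanley)
      fix k :: nat assume "k \<ge> 1"
      have "D_op k (ncoeff (C_part_series j * stanley) Y w) = ncoeff (C_part_series k * (C_part_series j * stanley)) Y w"
        unfolding D_op_ncoeff_mult_left[OF w] by (simp only: mult.assoc[symmetric] C_part_series_commute)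
      also have "\<dots> = ncoeff (C_part_series k * (stanley * C_part_series j)) Y w"
        using w \<open>k \<ge> 1\<close> by (rule ncoeff_C_part_series_mult_cong) (use less.hyps in blast)
      also have "\<dots> = D_op k (ncoeff (stanley * C_part_series j) Y w)"
        by (simp only: D_op_ncoeff_mult_right[OF w] mult.assoc)
      finally show "D_op k (ncoeff (C_part_series j * stanley) Y w) = D_op k (ncoeff (stanley * C_part_series j) Y w)" .
    qed (simp_all add: C_part_series_stanley_in_Gam w)
  qed
qed

text \<open>Reversal fixes the parts of \<open>C\<close> and turns \<open>C_k F\<close> into
  \<open>F C_k\<close>, which commutation turns back; so the reversed element satisfies the same
  recursion. This is the source of the symmetry between \<open>w\<close> and its inverse.\<close>

lemma nrev_stanley: "nrev stanley = stanley"
proof (rule stanley_unique)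
  fix Y w assume w: "w \<in> Weyl_group Y"
  then have w': "inv w \<in> Weyl_group Y" by (rule inv_in_Weyl)
  have e: "inv w = id \<longleftrightarrow> w = id" using w by (metis bij_Weyl inv_id inv_inv_eq)
  show "ncoeff (nrev stanley) Y w \<in> Gam Y" "coeff (ncoeff (nrev stanley) Y w) 0 = (if w = id then 1 else 0)"
    using w' e by (simp_all add: ncoeff_nrev[OF w] stanley_in_Gam const_stanley)
  fix k
  have "D_op k (ncoeff (nrev stanley) Y w) = ncoeff (nrev (C_part_series k * stanley)) Y w"
    by (simp add: ncoeff_nrev[OF w] D_op_stanley[OF w'])
  then show "D_op k (ncoeff (nrev stanley) Y w) = ncoeff (C_part_series k * nrev stanley) Y w"
    by (simp only: C_part_series_stanley_commute nrev_mult nrev_C_part_series)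
qed

text \<open>The identity \<open>F(z_1, x) = F(x) C(z_1)\<close> for the coefficients visible at
  truncation \<open>n\<close>, obtained by summing the \<open>D_k\<close> with their powers of
  \<open>z_1\<close>.\<close>

lemma s_z_0_stanley:
  assumes "w \<in> parabolic Y n"
  shows "s_z 0 (ncoeff stanley Y w) = ncoeff (C_prod Y n (zvar 1) * stanley) Y w"
    and "s_z 0 (ncoeff stanley Y w) = ncoeff (stanley * C_prod Y n (zvar 1)) Y w"
proof -
  have w: "w \<in> Weyl_group Y" using assms by (simp add: parabolic_def)
  have "D_op k (ncoeff stanley Y w) = 0" if "k > len Y w" for k
    unfolding D_op_stanley[OF w] ncoeff_C_part_series_mult[OF w]
    by (rule sum.neutral) (use that in \<open>auto dest!: factsD\<close>)
  then have exp: "s_z 0 (ncoeff stanley Y w) = (\<Sum>k\<le>len Y w. zvar 1 ^ k * ncoeff (C_part_series k * stanley) Y w)"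
    using s_z_0_expansion[of "len Y w" "ncoeff stanley Y w"] by (simp add: D_op_stanley[OF w])
  have C_prod: "(\<Sum>k\<le>len Y w. zvar 1 ^ k * ncoeff (C_part_series k) Y u) = ncoeff (C_prod Y n (zvar 1)) Y u"
    if "u \<in> parabolic Y n" "len Y u \<le> len Y w" for u
  proof -
    have "u \<in> Weyl_group Y" using that by (simp add: parabolic_def)
    then have "(\<Sum>k\<le>len Y w. zvar 1 ^ k * ncoeff (C_part_series k) Y u)
        = (\<Sum>k\<le>len Y w. if k = len Y u then zvar 1 ^ len Y u * of_int (ncoeff C_coeff Y u) else 0)"
      by (intro sum.cong) (auto simp: ncoeff_C_part_series)
    also have "\<dots> = zvar 1 ^ len Y u * of_int (ncoeff C_coeff Y u)" using that by simp
    finally show ?thesis by (simp add: ncoeff_C_prod[OF that(1)])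
  qed
  have "(\<Sum>k\<le>len Y w. zvar 1 ^ k * ncoeff (C_part_series k * stanley) Y w)
      = (\<Sum>(u, v)\<in>factorizations Y w. (\<Sum>k\<le>len Y w. zvar 1 ^ k * ncoeff (C_part_series k) Y u) * ncoeff stanley Y v)"
    unfolding ncoeff_times[OF w] sum_distrib_left sum_distrib_right case_prod_unfold
    by (subst sum.swap) (simp add: mult.assoc)
  also have "\<dots> = ncoeff (C_prod Y n (zvar 1) * stanley) Y w"
    unfolding ncoeff_times[OF w]
  proof (rule sum.cong[OF refl], clarify)
    fix u v assume uv: "(u, v) \<in> factorizations Y w"
    have "len Y u \<le> len Y w" using factsD[OF uv] by simp
    then show "(\<Sum>k\<le>len Y w. zvar 1 ^ k * ncoeff (C_part_series k) Y u) * ncoeff stanley Y v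
        = ncoeff (C_prod Y n (zvar 1)) Y u * ncoeff stanley Y v"
      using C_prod[of u] factorizations_parabolic[OF uv assms] by simp
  qed
  finally show "s_z 0 (ncoeff stanley Y w) = ncoeff (C_prod Y n (zvar 1) * stanley) Y w" by (simp only: exp)
  have "(\<Sum>k\<le>len Y w. zvar 1 ^ k * ncoeff (stanley * C_part_series k) Y w)
      = (\<Sum>(u, v)\<in>factorizations Y w. ncoeff stanley Y u * (\<Sum>k\<le>len Y w. zvar 1 ^ k * ncoeff (C_part_series k) Y v))"
    unfolding ncoeff_times[OF w] sum_distrib_left case_prod_unfold
    by (subst sum.swap) (simp add: mult_ac)
  also have "\<dots> = ncoeff (stanley * C_prod Y n (zvar 1)) Y w"
    unfolding ncoeff_times[OF w]
  proof (rule sum.cong[OF refl], clarify)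
    fix u v assume uv: "(u, v) \<in> factorizations Y w"
    have "len Y v \<le> len Y w" using factsD[OF uv] by simp
    then show "ncoeff stanley Y u * (\<Sum>k\<le>len Y w. zvar 1 ^ k * ncoeff (C_part_series k) Y v)
        = ncoeff stanley Y u * ncoeff (C_prod Y n (zvar 1)) Y v"
      using C_prod[of v] factorizations_parabolic[OF uv assms] by simp
  qed
  finally show "s_z 0 (ncoeff stanley Y w) = ncoeff (stanley * C_prod Y n (zvar 1)) Y w"
    by (simp only: exp C_part_series_stanley_commute)
qed

lemma ncong_s_z_0_stanley: "ncong Y n (nmap (s_z 0) stanley) (stanley * C_prod Y n (zvar 1))"
  unfolding ncong_def using s_z_0_stanley(2) by (simp add: ncoeff_nmap ring_hom_s_z)

lemma s_z_stanley: "i \<noteq> 0 \<Longrightarrow> nmap (s_z i) stanley = stanley"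
  by (rule nilcox_eqI)
    (simp add: ncoeff_nmap ring_hom_s_z s_z_fix_x Gamma'_supp_in[OF Gam_Gamma'[OF stanley_in_Gam]])

lemma omega_stanley: "nmap omega stanley = stanley"
  by (rule nilcox_eqI)
    (simp add: ncoeff_nmap ring_hom_omega omega_fix_x Gamma'_supp_in[OF Gam_Gamma'[OF stanley_in_Gam]])

section \<open>The double Schubert polynomials\<close>

lemma ring_R_closed:
  "1 \<in> ring_R Y" "0 \<in> ring_R Y" "f \<in> ring_R Y \<Longrightarrow> g \<in> ring_R Y \<Longrightarrow> f - g \<in> ring_R Y"
  "f \<in> ring_R Y \<Longrightarrow> g \<in> ring_R Y \<Longrightarrow> f + g \<in> ring_R Y"
  "f \<in> ring_R Y \<Longrightarrow> g \<in> ring_R Y \<Longrightarrow> f * g \<in> ring_R Y"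
  "f \<in> ring_R Y \<Longrightarrow> - f \<in> ring_R Y" "of_int a \<in> ring_R Y" "f \<in> ring_R Y \<Longrightarrow> f ^ n \<in> ring_R Y"
  unfolding ring_R_eq
  by (auto intro: generated_subring.intros subring_zero subring_add subring_uminus subring_of_int subring_power)

lemma ring_R_sum: "(\<And>x. x \<in> A \<Longrightarrow> f x \<in> ring_R Y) \<Longrightarrow> sum f A \<in> ring_R Y"
  unfolding ring_R_eq by (rule subring_sum)

lemma ring_R_gens:
  "k \<ge> 1 \<Longrightarrow> tvar k \<in> ring_R Y" "k \<ge> 1 \<Longrightarrow> zvar k \<in> ring_R Y" "f \<in> Gam Y \<Longrightarrow> f \<in> ring_R Y"
  unfolding ring_R_eq by (auto intro: generated_subring.generator)

lemma ring_R_ring_hom: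
  assumes "ring_hom \<phi>" "\<And>k. k \<ge> 1 \<Longrightarrow> \<phi> (tvar k) \<in> ring_R Y" "\<And>k. k \<ge> 1 \<Longrightarrow> \<phi> (zvar k) \<in> ring_R Y"
    "\<And>f. f \<in> Gam Y \<Longrightarrow> \<phi> f \<in> ring_R Y" "f \<in> ring_R Y"
  shows "\<phi> f \<in> ring_R Y"
  using assms(5) unfolding ring_R_eq by (rule subring_ring_hom[OF assms(1), rotated]) (use assms in \<open>auto simp: ring_R_eq\<close>)

lemma Gam_supp_in: "f \<in> Gam Y \<Longrightarrow> supp_in x_vars f"
  by (rule Gamma'_supp_in[OF Gam_Gamma'])

lemma s_z_0_Gam:
  assumes "f \<in> Gam Y" obtains N where "s_z 0 f = (\<Sum>k\<le>N. zvar 1 ^ k * D_op k f)" "\<And>k. k > N \<Longrightarrow> D_op k f = 0"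
  using D_op_bound[OF Gam_Gamma'[OF assms]] s_z_0_expansion by metis

text \<open>For \<open>s_0\<close> this is not formal, as the substitution sends \<open>x_1\<close>
  to \<open>z_1\<close>; the finite expansion by the \<open>D_k\<close>, which preserve
  \<open>Gam Y\<close>, is what keeps the image in the ring.\<close>

lemma s_z_ring_R: "f \<in> ring_R Y \<Longrightarrow> s_z i f \<in> ring_R Y"
proof (rule ring_R_ring_hom[OF ring_hom_s_z])
  show "s_z i (zvar k) \<in> ring_R Y" if "k \<ge> 1" for k
    using that by (cases "i = 0") (auto simp: s_z_0_zvar s_z_zvar transpose_def ring_R_gens ring_R_closed)
  show "s_z i f \<in> ring_R Y" if f: "f \<in> Gam Y" for f
  proof (cases "i = 0")
    case True
    obtain N where "s_z 0 f = (\<Sum>k\<le>N. zvar 1 ^ k * D_op k f)" using s_z_0_Gam[OF f] by blast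
    moreover have "(\<Sum>k\<le>N. zvar 1 ^ k * D_op k f) \<in> ring_R Y"
      using f by (intro ring_R_sum ring_R_closed(5,8) ring_R_gens(2,3) D_op_Gam) simp_all
    ultimately show ?thesis using True by simp
  next
    case False
    then show ?thesis using f by (simp add: s_z_fix_x Gam_supp_in ring_R_gens)
  qed
qed (simp_all add: ring_R_gens)

lemma omega_ring_R: "f \<in> ring_R Y \<Longrightarrow> omega f \<in> ring_R Y"
  by (rule ring_R_ring_hom[OF ring_hom_omega]) (auto simp: omega_fix_x Gam_supp_in ring_R_gens ring_R_closed)

lemma act_z_simps [simp]: "act_z (Idx i) f = s_z i f" "act_z Hat1 f = s_z 0 (s_z 1 (s_z 0 f))"
  by (simp_all add: act_z_def)

lemma ring_hom_act_z: "ring_hom (act_z i)"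
  by (cases i) (simp_all add: act_z_def ring_hom_s_z ring_hom_comp)

lemma act_t_eq: "act_t i f = omega (act_z i (omega f))"
  by (cases i) (simp_all add: act_t_def s_t_eq)

text \<open>False for arbitrary series, where \<open>x_1\<close> would go to \<open>z_1\<close> and
  then to \<open>- z_1\<close>. On \<open>Gam Y\<close> the coefficient of \<open>z_1^s\<close> in
  the result is \<open>T_op s f\<close>, so the cancellation property makes \<open>s_0\<close> an
  involution.\<close>

lemma s_z_0_involution: "f \<in> ring_R Y \<Longrightarrow> s_z 0 (s_z 0 f) = f"
proof -
  have Gam: "s_z 0 (s_z 0 f) = f" if f: "f \<in> Gam Y" for f
  proof -
    note f' = Gam_Gamma'[OF f]
    obtain N where N: "s_z 0 f = (\<Sum>k\<le>N. zvar 1 ^ k * D_op k f)" "\<And>k. k > N \<Longrightarrow> D_op k f = 0"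
      using s_z_0_Gam[OF f] by blast
    have N': "D_op m (D_op k f) = 0" if "m > N" for m k
      using D_op_commute[OF f', of m k] N(2)[OF that] by simp
    let ?t = "\<lambda>k m. zvar 1 ^ (k + m) * ((- 1) ^ k * D_op m (D_op k f))"
    have "s_z 0 (s_z 0 f) = (\<Sum>k\<le>N. (- zvar 1) ^ k * (\<Sum>m\<le>N. zvar 1 ^ m * D_op m (D_op k f)))"
      unfolding N(1)
      by (simp add: ring_hom_sum[OF ring_hom_s_z] ring_hom_mult[OF ring_hom_s_z] ring_hom_power[OF ring_hom_s_z] s_z_0_zvar
          s_z_0_expansion[of N "D_op _ f", OF N'])
    also have "\<dots> = (\<Sum>(k, m)\<in>{..N} \<times> {..N}. ?t k m)"
      unfolding sum.cartesian_product[symmetric] sum_distrib_left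
      by (intro sum.cong refl) (simp add: power_add power_minus[of "zvar _"] mult_ac)
    also have "\<dots> = (\<Sum>(k, m)\<in>{(k, m). k + m \<le> N + N}. ?t k m)"
    proof (rule sum.mono_neutral_left)
      show "finite {(k, m). k + m \<le> N + N}"
        by (rule finite_subset[of _ "{..N + N} \<times> {..N + N}"]) auto
      show "\<forall>x\<in>{(k, m). k + m \<le> N + N} - {..N} \<times> {..N}. (case x of (k, m) \<Rightarrow> ?t k m) = 0"
      proof
        fix x assume "x \<in> {(k, m). k + m \<le> N + N} - {..N} \<times> {..N}"
        then obtain k m where "x = (k, m)" "k > N \<or> m > N" by force
        then show "(case x of (k, m) \<Rightarrow> ?t k m) = 0" using N(2)[of k] N'[of m k] by auto
      qed
    qed auto
    also have "\<dots> = (\<Sum>s\<le>N + N. \<Sum>k\<le>s. ?t k (s - k))" by (rule sum.triangle_reindex_eq)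
    also have "\<dots> = (\<Sum>s\<le>N + N. if s = 0 then f else 0)"
    proof (rule sum.cong[OF refl])
      fix s
      have "(\<Sum>k\<le>s. ?t k (s - k)) = zvar 1 ^ s * T_op s f"
        by (auto simp: T_op_def sum_distrib_left D_op_commute[OF f', of "s - _"] intro!: sum.cong)
      then show "(\<Sum>k\<le>s. ?t k (s - k)) = (if s = 0 then f else 0)"
        using T_op_vanish[OF f', of s] T_op_0[OF f'] by (cases "s = 0") auto
    qed
    finally show ?thesis by simp
  qed
  assume "f \<in> ring_R Y"
  then have "(s_z 0 \<circ> s_z 0) f = id f"
    unfolding ring_R_eq
    by (rule subring_eqI[OF ring_hom_comp[OF ring_hom_s_z ring_hom_s_z], rotated 2])
      (auto simp: Gam ring_hom_def s_z_0_zvar ring_hom_uminus[OF ring_hom_s_z])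
  then show ?thesis by simp
qed

section \<open>Roots, exact division and the divided differences\<close>

definition zroot :: "lie_type \<Rightarrow> index \<Rightarrow> series" where
  "zroot Y i = omega (simple_root Y i)"

lemma zroot_simps:
  "j \<noteq> 0 \<Longrightarrow> zroot Y (Idx j) = zvar j - zvar (j + 1)"
  "zroot Y (Idx 0) = - (of_int (kappa Y) * zvar 1)"
  "zroot Y Hat1 = - zvar 1 - zvar 2"
  by (simp_all add: zroot_def kappa_def ring_hom_minus[OF ring_hom_omega] ring_hom_add[OF ring_hom_omega]
      ring_hom_mult[OF ring_hom_omega] ring_hom_numeral[OF ring_hom_omega])

lemma simple_root_cancel:
  assumes "i \<in> index_set Y" "simple_root Y i * f = simple_root Y i * g" shows "f = g"
proof -
  have "\<exists>a v b v'. v \<noteq> v' \<and> a \<noteq> 0 \<and> simple_root Y i = of_int a * Var v + of_int b * Var v'"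
  proof (cases i)
    case (Idx j)
    show ?thesis
    proof (cases "j = 0")
      case True
      \<comment> \<open>A root with a single term is padded by 0 times another variable to fit
        \<open>linear_form_cancel\<close>.\<close>
      then show ?thesis
        using Idx by (intro exI[of _ "kappa Y"] exI[of _ "T_var 1"] exI[of _ 0] exI[of _ "T_var 2"]) (simp add: kappa_def)
    next
      case False
      then show ?thesis
        using Idx by (intro exI[of _ 1] exI[of _ "T_var (j + 1)"] exI[of _ "- 1"] exI[of _ "T_var j"]) simp
    qed
  next
    case Hat1
    then show ?thesis
      by (intro exI[of _ 1] exI[of _ "T_var 1"] exI[of _ 1] exI[of _ "T_var 2"]) simp
  qed
  then have "f - g = 0"
    using linear_form_cancel[of _ _ _ _ "f - g"] assms(2) by (metis right_diff_distrib right_minus_eq)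
  then show ?thesis by simp
qed

lemma zroot_cancel:
  assumes "i \<in> index_set Y" "zroot Y i * f = zroot Y i * g" shows "f = g"
proof -
  have "simple_root Y i * omega f = simple_root Y i * omega g"
    using arg_cong[OF assms(2), of omega] by (simp add: zroot_def ring_hom_mult[OF ring_hom_omega])
  then have "omega f = omega g" by (rule simple_root_cancel[OF assms(1)])
  then show ?thesis by (metis omega_omega)
qed

lemma quotient_in_eq:
  assumes "g \<in> A" "a * g = f" "\<And>g'. a * g' = a * g \<Longrightarrow> g' = g" shows "quotient_in A f a = g"
  unfolding quotient_in_def
proof (rule the_equality)
  show "g \<in> A \<and> a * g = f" using assms(1,2) by blast
  fix g' assume "g' \<in> A \<and> a * g' = f"
  then show "g' = g" using assms(2) by (intro assms(3)) simp
qed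

lemma del_eq:
  assumes "i \<in> index_set Y" "g \<in> ring_R Y" "zroot Y i * g = f - act_z i f" shows "del Y i f = g"
  unfolding del_def zroot_def[symmetric]
  by (rule quotient_in_eq[OF assms(2,3)]) (rule zroot_cancel[OF assms(1)])

lemma delta_eq:
  assumes "i \<in> index_set Y" "g \<in> ring_R Y" "simple_root Y i * g = f - act_t i f" shows "delta Y i f = g"
  unfolding delta_def
  by (rule quotient_in_eq[OF assms(2,3)]) (rule simple_root_cancel[OF assms(1)])

text \<open>Divisibility spreads from the generators by the twisted Leibniz rule \<open>a b - \<phi>
  (a b) = (a - \<phi> a) b + \<phi> a (b - \<phi> b)\<close>.\<close>

lemma divisible_induct:
  assumes hom: "ring_hom \<phi>" and pres: "\<And>f. f \<in> ring_R Y \<Longrightarrow> \<phi> f \<in> ring_R Y"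
    and t: "\<And>k. k \<ge> 1 \<Longrightarrow> \<exists>g \<in> ring_R Y. r * g = tvar k - \<phi> (tvar k)"
    and z: "\<And>k. k \<ge> 1 \<Longrightarrow> \<exists>g \<in> ring_R Y. r * g = zvar k - \<phi> (zvar k)"
    and Gam: "\<And>f. f \<in> Gam Y \<Longrightarrow> \<exists>g \<in> ring_R Y. r * g = f - \<phi> f"
    and f: "f \<in> ring_R Y"
  shows "\<exists>g \<in> ring_R Y. r * g = f - \<phi> f"
  using f unfolding ring_R_eq
proof induction
  case (generator g)
  then show ?case using t z Gam unfolding ring_R_eq by auto
next
  case one
  show ?case by (rule bexI[of _ 0]) (simp_all add: ring_hom_one[OF hom] subring_zero)
next
  case (diff a b)
  then obtain g g' where g: "g \<in> ring_R Y" "g' \<in> ring_R Y" "r * g = a - \<phi> a" "r * g' = b - \<phi> b"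
    unfolding ring_R_eq by blast
  then have "r * (g - g') = a - b - \<phi> (a - b)"
    by (simp add: right_diff_distrib ring_hom_minus[OF hom] algebra_simps)
  then show ?case using ring_R_closed(3)[OF g(1,2)] unfolding ring_R_eq by blast
next
  case (mult a b)
  then have ab: "a \<in> ring_R Y" "b \<in> ring_R Y" unfolding ring_R_eq by auto
  obtain g g' where g: "g \<in> ring_R Y" "g' \<in> ring_R Y" "r * g = a - \<phi> a" "r * g' = b - \<phi> b"
    using mult.IH unfolding ring_R_eq by blast
  have "r * (g * b + \<phi> a * g') = (r * g) * b + \<phi> a * (r * g')" by (simp add: algebra_simps)
  also have "\<dots> = a * b - \<phi> (a * b)" by (simp only: g ring_hom_mult[OF hom]) (simp add: algebra_simps)
  finally have "r * (g * b + \<phi> a * g') = a * b - \<phi> (a * b)" .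
  moreover have "g * b + \<phi> a * g' \<in> ring_R Y" using ab g by (intro ring_R_closed pres)
  ultimately show ?case unfolding ring_R_eq by blast
qed

lemma divisible_Idx:
  assumes "f \<in> ring_R Y" shows "\<exists>g \<in> ring_R Y. zroot Y (Idx j) * g = f - s_z j f"
  using ring_hom_s_z s_z_ring_R
proof (rule divisible_induct)
  show "\<exists>g \<in> ring_R Y. zroot Y (Idx j) * g = tvar k - s_z j (tvar k)" for k
    by (rule bexI[of _ 0]) (simp_all add: ring_R_closed)
  show "\<exists>g \<in> ring_R Y. zroot Y (Idx j) * g = zvar k - s_z j (zvar k)" if "k \<ge> 1" for k
  proof (cases "j = 0")
    case True
    \<comment> \<open>The difference is \<open>2 * zvar 1\<close> and the root is
      \<open>- kappa\<close> times \<open>zvar 1\<close>, hence this quotient.\<close>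
    have "of_int (- (2 div kappa Y)) \<in> ring_R Y" by (rule ring_R_closed)
    moreover have "zroot Y (Idx 0) * of_int (- (2 div kappa Y)) = zvar 1 - s_z 0 (zvar 1)"
      by (simp add: zroot_simps s_z_0_zvar kappa_def)
    ultimately have "\<exists>g \<in> ring_R Y. zroot Y (Idx j) * g = zvar k - s_z j (zvar k)" if "k = 1"
      unfolding True that by blast
    then show ?thesis
      using True ring_R_closed(2)[of Y] by (cases "k = 1") (auto simp: s_z_0_zvar intro!: bexI[of _ 0])
  next
    case False
    consider "k = j" | "k = j + 1" | "k \<noteq> j" "k \<noteq> j + 1" by blast
    then show ?thesis
    proof cases
      case 1
      then show ?thesis using False ring_R_closed(1) by (intro bexI[of _ 1]) (simp_all add: s_z_zvar zroot_simps)
    next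
      case 2
      then show ?thesis using False ring_R_closed(6)[OF ring_R_closed(1)]
        by (intro bexI[of _ "- 1"]) (simp_all add: s_z_zvar zroot_simps)
    next
      case 3
      then show ?thesis using False ring_R_closed(2)
        by (intro bexI[of _ 0]) (simp_all add: s_z_zvar transpose_def)
    qed
  qed
  show "\<exists>g \<in> ring_R Y. zroot Y (Idx j) * g = f - s_z j f" if f: "f \<in> Gam Y" for f
  proof (cases "j = 0")
    case False
    then show ?thesis using f ring_R_closed(2) by (intro bexI[of _ 0]) (simp_all add: s_z_fix_x Gam_supp_in)
  next
    case True
    obtain N where N: "s_z 0 f = (\<Sum>k\<le>N. zvar 1 ^ k * D_op k f)" using s_z_0_Gam[OF f] by blast
    \<comment> \<open>The expansion of \<open>s_0 f - f\<close> visibly has the factor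
      \<open>z_1\<close>; the factor \<open>kappa\<close> of the root comes from the
      \<open>D_k f\<close>.\<close>
    have "\<forall>k\<ge>1. \<exists>g. g \<in> Gam Y \<and> D_op k f = of_int (kappa Y) * g"
      using D_op_kappa_multiple[OF f] by (auto simp: kappa_multiple_def)
    then obtain g where g: "\<And>k. k \<ge> 1 \<Longrightarrow> g k \<in> Gam Y \<and> D_op k f = of_int (kappa Y) * g k" by metis
    let ?g = "\<Sum>k<N. zvar 1 ^ k * g (Suc k)"
    have "s_z 0 f = f + (\<Sum>k<N. zvar 1 ^ Suc k * D_op (Suc k) f)"
      unfolding N by (simp add: sum.atMost_shift D_op_0[OF Gam_Gamma'[OF f]])
    also have "(\<Sum>k<N. zvar 1 ^ Suc k * D_op (Suc k) f) = of_int (kappa Y) * zvar 1 * ?g"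
      by (simp add: g sum_distrib_left mult_ac)
    finally have "zroot Y (Idx 0) * ?g = f - s_z 0 f" by (simp add: zroot_simps)
    moreover have "?g \<in> ring_R Y" using g by (intro ring_R_sum ring_R_closed ring_R_gens) simp_all
    ultimately show ?thesis using True by blast
  qed
qed (use assms in auto)

lemma divisible:
  assumes f: "f \<in> ring_R Y" shows "\<exists>g \<in> ring_R Y. zroot Y i * g = f - act_z i f"
proof (cases i)
  case (Idx j)
  then show ?thesis using divisible_Idx[OF f] by simp
next
  case Hat1
  \<comment> \<open>The reflection is \<open>s_0 s_1 s_0\<close>: the quotient for
    \<open>s_1\<close> at \<open>s_0 f\<close> is transported by \<open>s_0\<close>, which takes
    \<open>z_1 - z_2\<close> to \<open>- z_1 - z_2\<close>.\<close>
  obtain g where g: "g \<in> ring_R Y" "zroot Y (Idx 1) * g = s_z 0 f - s_z 1 (s_z 0 f)"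
    using divisible_Idx[OF s_z_ring_R[OF f], of 1 0] by blast
  have "s_z 0 (zroot Y (Idx 1)) = zroot Y Hat1"
    by (simp add: zroot_simps ring_hom_minus[OF ring_hom_s_z] s_z_0_zvar numeral_2_eq_2)
  then have "zroot Y Hat1 * s_z 0 g = f - act_z Hat1 f"
    using arg_cong[OF g(2), of "s_z 0"]
    by (simp add: ring_hom_mult[OF ring_hom_s_z] ring_hom_minus[OF ring_hom_s_z] s_z_0_involution[OF f])
  then show ?thesis using Hat1 s_z_ring_R[OF g(1)] by blast
qed

text \<open>Replaces the definite description in \<open>del\<close> by an equation: the quotient
  exists by \<open>divisible\<close> and is unique by \<open>zroot_cancel\<close>.\<close>

lemma zroot_del:
  assumes "i \<in> index_set Y" "f \<in> ring_R Y" shows "zroot Y i * del Y i f = f - act_z i f"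
  using divisible[OF assms(2), of i] del_eq[OF assms(1)] by metis

lemma simple_root_delta:
  assumes "i \<in> index_set Y" "f \<in> ring_R Y" shows "simple_root Y i * delta Y i f = f - act_t i f"
proof -
  obtain g where g: "g \<in> ring_R Y" "zroot Y i * g = omega f - act_z i (omega f)"
    using divisible[OF omega_ring_R[OF assms(2)], of i] by blast
  have *: "simple_root Y i * omega g = f - act_t i f"
    using arg_cong[OF g(2), of omega] by (simp add: zroot_def ring_hom_mult[OF ring_hom_omega] ring_hom_minus[OF ring_hom_omega] act_t_eq)
  then show ?thesis using delta_eq[OF assms(1) omega_ring_R[OF g(1)] *] by simp
qed

subsection \<open>Uniqueness\<close>

definition tx_vars :: "var set" where
  "tx_vars = range T_var \<union> x_vars"

text \<open>An element of the ring involves only finitely many \<open>z_j\<close>, while invariance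
  would pass an occurrence of \<open>z_j\<close> on to the next index without end.\<close>

lemma z_symmetric_no_z:
  assumes f: "f \<in> ring_R Y" and inv: "\<And>j. j \<ge> 1 \<Longrightarrow> s_z j f = f"
  shows "supp_in tx_vars f"
proof -
  let ?V = "\<lambda>N. tx_vars \<union> Z_var ` {1..N}"
  have "\<exists>N. supp_in (?V N) f"
    using f unfolding ring_R_eq
  proof induction
    case (generator g)
    then consider k where "g = tvar k" | k where "k \<ge> 1" "g = zvar k" | "g \<in> Gam Y" by auto
    then show ?case
    proof cases
      case 1
      then show ?thesis by (auto simp: tx_vars_def intro!: supp_in_Var)
    next
      case 2
      then show ?thesis by (intro exI[of _ k]) (auto intro!: supp_in_Var)
    next
      case 3
      then show ?thesis by (intro exI[of _ 0] supp_in_mono[OF Gam_supp_in]) (auto simp: tx_vars_def)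
    qed
  next
    case one
    then show ?case by (auto simp: supp_in_one)
  next
    case (diff a b)
    then obtain M N where "supp_in (?V M) a" "supp_in (?V N) b" by blast
    then have "supp_in (?V (max M N)) a" "supp_in (?V (max M N)) b" by (auto elim!: supp_in_mono)
    then show ?case using supp_in_minus by blast
  next
    case (mult a b)
    then obtain M N where "supp_in (?V M) a" "supp_in (?V N) b" by blast
    then have "supp_in (?V (max M N)) a" "supp_in (?V (max M N)) b" by (auto elim!: supp_in_mono)
    then show ?case using supp_in_times by blast
  qed
  then obtain N where N: "supp_in (?V N) f" ..
  have kill: "coeff f m = 0" if "Z_var j \<in> variables m" for j m
    using that
  proof (induction "N + 1 - j" arbitrary: j m rule: less_induct)
    case less
    show ?case
    proof (cases "1 \<le> j \<and> j \<le> N")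
      case True
      let ?\<tau> = "transpose (Z_var j) (Z_var (j + 1))"
      have "coeff (s_z j f) m = coeff f (rename_monomial ?\<tau> m)"
        unfolding s_z_eq
        by (rule coeff_substitute_inverse[OF finite_fibres_sub_z, of UNIV])
          (use True in \<open>auto simp: supp_in_def sub_z_def sgn_z_def\<close>)
      moreover have "Z_var (j + 1) \<in> variables (rename_monomial ?\<tau> m)"
        using less.prems by (force simp: variables_rename image_iff)
      then have "coeff f (rename_monomial ?\<tau> m) = 0" by (rule less.hyps[rotated]) (use True in linarith)
      ultimately show ?thesis using inv[of j] True by simp
    next
      case False
      then have "Z_var j \<notin> ?V N" by (auto simp: tx_vars_def)
      then show ?thesis using N less.prems by (auto simp: supp_in_def)
    qed
  qed
  show ?thesis unfolding supp_in_def
  proof (intro allI impI subsetI)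
    fix m v assume m: "coeff f m \<noteq> 0" "v \<in> variables m"
    then have "v \<in> ?V N" using N by (auto simp: supp_in_def)
    moreover have "v \<notin> range Z_var" using kill m by auto
    ultimately show "v \<in> tx_vars" by auto
  qed
qed

text \<open>\<open>Hat1\<close> acts on the \<open>x_j\<close> as a shift by two that makes
  \<open>x_1\<close>, \<open>x_2\<close> into \<open>z_2\<close>, \<open>z_1\<close>.\<close>

lemma s_hat_invariant_const:
  assumes f: "supp_in x_vars f" and inv: "act_z Hat1 f = f" and "m \<noteq> 0"
  shows "coeff f m = 0"
proof -
  let ?\<sigma> = "sub_z 0 \<circ> (sub_z 1 \<circ> sub_z 0)"
  let ?\<epsilon> = "\<lambda>v. sgn_z 0 v * sgn_z 1 (sub_z 0 v) * sgn_z 0 ((sub_z 1 \<circ> sub_z 0) v)"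
  have fin: "finite_fibres (sub_z 1 \<circ> sub_z 0)" "finite_fibres ?\<sigma>"
    by (simp_all add: finite_fibres_comp finite_fibres_sub_z)
  have "act_z Hat1 f = substitute ?\<sigma> ?\<epsilon> f"
    by (simp add: s_z_eq substitute_comp finite_fibres_sub_z finite_fibres_comp)
  then have eq: "substitute ?\<sigma> ?\<epsilon> f = f" using inv by simp
  have 1: "?\<sigma> (X_var j) = (if j = 1 then Z_var 2 else if j = 2 then Z_var 1 else X_var (j - 2))" if "j \<ge> 1" for j
    using that by (auto simp: sub_z_def transpose_def numeral_2_eq_2)
  show ?thesis
  proof (rule shift_invariant_const[OF fin(2) f eq _ _ _ _ _ \<open>m \<noteq> 0\<close>, where r = 2])
    show "inj_on ?\<sigma> x_vars"
    proof (rule inj_onI)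
      fix v w assume "v \<in> x_vars" "w \<in> x_vars" and e: "?\<sigma> v = ?\<sigma> w"
      then obtain i j where ij: "v = X_var i" "w = X_var j" "i \<ge> 1" "j \<ge> 1" by (auto elim!: x_varsE)
      then show "v = w" using e unfolding ij 1[OF ij(3)] 1[OF ij(4)] by (auto split: if_splits)
    qed
    show "?\<epsilon> v = 1" if "v \<in> x_vars" for v
      using that by (auto elim!: x_varsE simp: sub_z_def sgn_z_def transpose_def split: if_splits)
    show "?\<sigma> (X_var j) \<notin> x_vars" if "1 \<le> j" "j \<le> 2" for j
      using that unfolding 1[OF that(1)] by auto
    show "?\<sigma> (X_var j) = X_var (j - 2)" if "2 < j" for j
      using that 1[of j] by simp
  qed simp
qed

text \<open>The reflections with j >= 1 on both sides rule out all \<open>z_j\<close> and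
  \<open>t_j\<close>. The reflection at the end of the diagram then acts on the remaining
  \<open>x_j\<close> as a shift and leaves only constants.\<close>

lemma invariant_const:
  assumes f: "f \<in> ring_R Y" and z: "\<And>i. i \<in> index_set Y \<Longrightarrow> act_z i f = f"
    and t: "\<And>i. i \<in> index_set Y \<Longrightarrow> act_t i f = f" and "m \<noteq> 0"
  shows "coeff f m = 0"
proof -
  have Idx: "Idx j \<in> index_set Y" if "j \<ge> 1" for j using that by (cases Y) auto
  have "supp_in tx_vars f"
    by (rule z_symmetric_no_z[OF f]) (use z[OF Idx] in simp)
  moreover have "supp_in tx_vars (omega f)"
  proof (rule z_symmetric_no_z[OF omega_ring_R[OF f]])
    fix j :: nat assume "j \<ge> 1"
    then have "omega (s_z j (omega f)) = f" using t[OF Idx] by (simp add: act_t_eq)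
    then show "s_z j (omega f) = omega f" by (metis omega_omega)
  qed
  then have "supp_in (range Z_var \<union> x_vars) (omega (omega f))"
    unfolding omega_def by (rule supp_in_substitute) (auto simp: tx_vars_def elim!: x_varsE)
  then have "supp_in (range Z_var \<union> x_vars) f" by simp
  ultimately have x: "supp_in x_vars f"
    unfolding supp_in_def tx_vars_def by blast
  show ?thesis
  proof (cases Y)
    case TypeD
    then have "act_z Hat1 f = f" by (intro z) simp
    with x show ?thesis using \<open>m \<noteq> 0\<close> by (rule s_hat_invariant_const)
  next
    case TypeB
    then have "s_z 0 f = f" using z[of "Idx 0"] by simp
    with x show ?thesis using \<open>m \<noteq> 0\<close> by (rule s_z_0_invariant_const)
  next
    case TypeC
    then have "s_z 0 f = f" using z[of "Idx 0"] by simp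
    with x show ?thesis using \<open>m \<noteq> 0\<close> by (rule s_z_0_invariant_const)
  qed
qed

lemma homogeneous_component_0_iff: "homogeneous_component 0 f = 0 \<longleftrightarrow> coeff f 0 = 0"
proof
  assume "homogeneous_component 0 f = 0"
  then have "coeff (homogeneous_component 0 f) 0 = 0" by simp
  then show "coeff f 0 = 0" by (simp add: homogeneous_component_def monomial_degree_def)
next
  assume "coeff f 0 = 0"
  moreover have "m = 0" if "monomial_degree m = 0" for m :: "'a monomial"
    using that by (metis monomial_degree_def finite_keys in_keys_iff sum_eq_0_iff all_not_in_conv keys_eq_empty)
  ultimately show "homogeneous_component 0 f = 0"
    by (intro mseries_eqI) (auto simp: homogeneous_component_def)
qed

subsection \<open>Existence\<close>

text \<open>The image of \<open>tri 1 n zvar\<close> under \<open>omega\<close> followed by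
  reversal, which makes the whole product symmetric.\<close>

definition left_factor :: "nat \<Rightarrow> series nilcox" where
  "left_factor n = nrev (tri 1 n (\<lambda>j. - tvar j))"

definition schubert_n :: "nat \<Rightarrow> series nilcox" where
  "schubert_n n = left_factor n * stanley * tri 1 n zvar"

definition schubert :: "series nilcox" where
  "schubert = nlim (\<lambda>Y n. schubert_n n)"

lemma ncong_schubert: "ncong Y n schubert (schubert_n n)"
  unfolding schubert_def
proof (rule ncong_nlim)
  fix m n :: nat assume "m \<le> n"
  then show "ncong Y m (schubert_n n) (schubert_n m)"
    unfolding schubert_n_def left_factor_def by (intro ncong_mult ncong_nrev ncong_tri ncong_refl)
qed

lemma parabolic_large:
  assumes "w \<in> Weyl_group Y" obtains n where "w \<in> parabolic Y n" "n \<ge> k"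
proof -
  obtain n where "w \<in> parabolic Y n" using parabolic_exhaust[OF assms] by blast
  then have "w \<in> parabolic Y (max n k)" by (rule parabolic_mono[rotated]) simp
  then show ?thesis by (rule that) simp
qed

lemma nmap_tri: "ring_hom \<phi> \<Longrightarrow> nmap \<phi> (tri i n \<zeta>) = tri i n (\<lambda>j. \<phi> (\<zeta> j))"
  by (rule ring_hom_map_tri[OF ring_hom_nmap]) (simp_all add: nmap_h_elem)

lemma nmap_mult: "ring_hom \<phi> \<Longrightarrow> nmap \<phi> (F * G) = nmap \<phi> F * nmap \<phi> G"
  by (rule ring_hom_mult[OF ring_hom_nmap])

lemma nmap_C_prod: "ring_hom \<phi> \<Longrightarrow> nmap \<phi> (C_prod Y n z) = C_prod Y n (\<phi> z)"
  by (rule ring_hom_map_C_prod[OF ring_hom_nmap]) (simp_all add: nmap_h_elem ring_hom_mult ring_hom_numeral)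

lemma s_z_left: "nmap (s_z i) (left_factor n) = left_factor n"
  by (simp add: left_factor_def nmap_nrev[OF ring_hom_s_z] nmap_tri[OF ring_hom_s_z] ring_hom_uminus[OF ring_hom_s_z])

lemma ncong_s_z_0_schubert_n:
  "ncong Y n (nmap (s_z 0) (left_factor n * stanley * F)) (left_factor n * (stanley * C_prod Y n (zvar 1)) * nmap (s_z 0) F)"
  unfolding nmap_mult[OF ring_hom_s_z] s_z_left
  by (intro ncong_mult ncong_refl ncong_s_z_0_stanley)

text \<open>The left factor contains neither \<open>z_j\<close> nor \<open>x_j\<close>, so only
  \<open>stanley\<close> and \<open>tri\<close> respond to the reflection. The bounds on
  \<open>n\<close> ensure that the blocks of \<open>tri\<close> involved are present.\<close>

lemma schubert_n_act:
  assumes i: "i \<in> index_set Y" and n: "n \<ge> 3" "n \<ge> level i + 2"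
  shows "ncong Y n (nmap (act_z i) (schubert_n n)) (schubert_n n * h_elem i (- zroot Y i))"
proof (cases i)
  case (Idx j)
  have nm: "nmap (act_z i) = nmap (s_z j)" by (rule ext) (simp add: Idx act_z_def)
  show ?thesis
  proof (cases "j = 0")
    case False
    have "nmap (s_z j) (schubert_n n) = left_factor n * stanley * tri 1 n (\<lambda>k. zvar (transpose j (j + 1) k))"
      using False by (simp add: schubert_n_def nmap_mult[OF ring_hom_s_z] s_z_left s_z_stanley nmap_tri[OF ring_hom_s_z] s_z_zvar)
    also have "\<dots> = left_factor n * stanley * (tri 1 n zvar * h_elem (Idx j) (zvar (j + 1) - zvar j))"
      using tri_transpose[of j n zvar] False n Idx by simp
    also have "\<dots> = schubert_n n * h_elem i (- zroot Y i)"
      using False by (simp add: schubert_n_def Idx zroot_simps mult.assoc)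
    finally show ?thesis by (simp add: nm)
  next
    case True
    then have Y: "Y \<noteq> TypeD" using i Idx by auto
    have "(\<lambda>k. s_z 0 (zvar k)) = zvar(1 := - zvar 1)" by (auto simp: s_z_0_zvar)
    then have tri: "nmap (s_z 0) (tri 1 n zvar) = tri 1 n (zvar(1 := - zvar 1))"
      by (simp add: nmap_tri[OF ring_hom_s_z])
    have "ncong Y n (nmap (s_z 0) (schubert_n n)) (left_factor n * (stanley * C_prod Y n (zvar 1)) * tri 1 n (zvar(1 := - zvar 1)))"
      unfolding schubert_n_def tri[symmetric] by (rule ncong_s_z_0_schubert_n)
    also have "left_factor n * (stanley * C_prod Y n (zvar 1)) * tri 1 n (zvar(1 := - zvar 1))
        = left_factor n * stanley * (C_prod Y n (zvar 1) * tri 1 n (zvar(1 := - zvar 1)))"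
      by (simp only: mult.assoc)
    also have "\<dots> = left_factor n * stanley * (tri 1 n zvar * base Y (zvar 1))"
      using C_prod_tri[of Y n zvar] Y n by simp
    also have "\<dots> = schubert_n n * h_elem i (- zroot Y i)"
      using Y by (cases Y) (simp_all add: schubert_n_def Idx True zroot_simps kappa_def mult.assoc)
    finally show ?thesis by (simp add: nm True)
  qed
next
  case Hat1
  then have Y: "Y = TypeD" using i by (cases Y) auto
  let ?L = "left_factor n" and ?F = stanley and ?c = "\<lambda>z. C_prod Y n z"
  \<comment> \<open>Under \<open>s_0\<close>, \<open>s_1\<close>, \<open>s_0\<close> in turn,
    \<open>F\<close> acquires \<open>C(z_1)\<close>, then \<open>C(z_2)\<close>, then
    \<open>C(z_1) C(z_2)\<close>, while the first two arguments of \<open>tri\<close> become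
    \<open>(- z_1, z_2)\<close>, \<open>(- z_2, z_1)\<close>, \<open>(- z_2, - z_1)\<close>.\<close>
  let ?\<zeta>1 = "zvar(1 := - zvar 1)" and ?\<zeta>2 = "zvar(1 := - zvar 2, 2 := zvar 1)"
    and ?\<zeta>3 = "zvar(1 := - zvar 2, 2 := - zvar 1)"
  have nm: "nmap (act_z Hat1) G = nmap (s_z 0) (nmap (s_z 1) (nmap (s_z 0) G))" for G
    by (simp add: nmap_comp ring_hom_s_z ring_hom_comp act_z_def comp_assoc)
  have t1: "nmap (s_z 0) (tri 1 n zvar) = tri 1 n ?\<zeta>1"
    unfolding nmap_tri[OF ring_hom_s_z] by (rule arg_cong[where f = "tri 1 n"]) (auto simp: s_z_0_zvar)
  have t2: "nmap (s_z 1) (tri 1 n ?\<zeta>1) = tri 1 n ?\<zeta>2"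
    unfolding nmap_tri[OF ring_hom_s_z]
    by (rule arg_cong[where f = "tri 1 n"])
      (auto simp: s_z_zvar ring_hom_uminus[OF ring_hom_s_z] transpose_def numeral_2_eq_2)
  have t3: "nmap (s_z 0) (tri 1 n ?\<zeta>2) = tri 1 n ?\<zeta>3"
    unfolding nmap_tri[OF ring_hom_s_z]
    by (rule arg_cong[where f = "tri 1 n"]) (auto simp: s_z_0_zvar ring_hom_uminus[OF ring_hom_s_z])
  have "ncong Y n (nmap (s_z 0) (schubert_n n)) (?L * (?F * ?c (zvar 1)) * tri 1 n ?\<zeta>1)"
    unfolding schubert_n_def t1[symmetric] by (rule ncong_s_z_0_schubert_n)
  then have "ncong Y n (nmap (s_z 1) (nmap (s_z 0) (schubert_n n)))
      (nmap (s_z 1) (?L * (?F * ?c (zvar 1)) * tri 1 n ?\<zeta>1))"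
    by (rule ncong_nmap[OF ring_hom_s_z])
  also have "nmap (s_z 1) (?L * (?F * ?c (zvar 1)) * tri 1 n ?\<zeta>1) = ?L * ?F * (?c (zvar 2) * tri 1 n ?\<zeta>2)"
    using s_z_zvar[of 1 1]
    by (simp add: nmap_mult[OF ring_hom_s_z] s_z_left s_z_stanley nmap_C_prod[OF ring_hom_s_z] t2 mult.assoc
        numeral_2_eq_2 del: One_nat_def)
  finally have "ncong Y n (nmap (s_z 0) (nmap (s_z 1) (nmap (s_z 0) (schubert_n n))))
      (nmap (s_z 0) (?L * ?F * (?c (zvar 2) * tri 1 n ?\<zeta>2)))"
    by (rule ncong_nmap[OF ring_hom_s_z])
  also have "ncong Y n (nmap (s_z 0) (?L * ?F * (?c (zvar 2) * tri 1 n ?\<zeta>2)))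
      (?L * (?F * ?c (zvar 1)) * nmap (s_z 0) (?c (zvar 2) * tri 1 n ?\<zeta>2))"
    by (rule ncong_s_z_0_schubert_n)
  also have "?L * (?F * ?c (zvar 1)) * nmap (s_z 0) (?c (zvar 2) * tri 1 n ?\<zeta>2)
      = ?L * ?F * (?c (zvar 1) * ?c (zvar 2) * tri 1 n ?\<zeta>3)"
    by (simp add: nmap_mult[OF ring_hom_s_z] nmap_C_prod[OF ring_hom_s_z] s_z_0_zvar t3 mult.assoc del: One_nat_def)
  also have "\<dots> = ?L * ?F * (tri 1 n zvar * h_elem Hat1 (zvar 1 + zvar 2))"
    unfolding Y using C_prod_tri_hat[OF n(1), of zvar] by simp
  also have "\<dots> = schubert_n n * h_elem i (- zroot Y i)"
    by (simp add: schubert_n_def Hat1 zroot_simps mult.assoc add.commute)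
  finally show ?thesis unfolding Hat1 nm .
qed

lemma schubert_act_z:
  assumes i: "i \<in> index_set Y" and w: "w \<in> Weyl_group Y"
  shows "act_z i (ncoeff schubert Y w) = ncoeff schubert Y w - zroot Y i * ncoeff (schubert * gen i) Y w"
proof -
  obtain n where n: "w \<in> parabolic Y n" "n \<ge> 3 + level i" using parabolic_large[OF w] by blast
  have "ncong Y n (nmap (act_z i) schubert) (nmap (act_z i) (schubert_n n))"
    by (rule ncong_nmap[OF ring_hom_act_z ncong_schubert])
  also have "ncong Y n \<dots> (schubert_n n * h_elem i (- zroot Y i))" by (rule schubert_n_act[OF i]) (use n in auto)
  also have "ncong Y n \<dots> (schubert * h_elem i (- zroot Y i))"
    by (rule ncong_mult[OF ncong_sym[OF ncong_schubert] ncong_refl])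
  finally have "ncoeff (nmap (act_z i) schubert) Y w = ncoeff (schubert * h_elem i (- zroot Y i)) Y w"
    using n by (simp add: ncong_def)
  then show ?thesis by (simp add: ncoeff_nmap ring_hom_act_z h_elem_def distrib_left)
qed

text \<open>Reversal combined with \<open>omega\<close> exchanges the outer factors, and each of the
  two fixes \<open>stanley\<close>.\<close>

lemma schubert_symmetric: "nrev (nmap omega schubert) = schubert"
proof (rule nilcox_eqI)
  fix Y w assume "w \<in> Weyl_group Y"
  then obtain n where n: "w \<in> parabolic Y n" using parabolic_exhaust by blast
  have l: "nmap omega (tri 1 n zvar) = tri 1 n (\<lambda>j. - tvar j)"
    by (simp add: nmap_tri[OF ring_hom_omega])
  have r: "nmap omega (left_factor n) = nrev (tri 1 n zvar)"
    by (simp add: left_factor_def nmap_nrev[OF ring_hom_omega] nmap_tri[OF ring_hom_omega] ring_hom_uminus[OF ring_hom_omega])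
  have "nrev (nmap omega (schubert_n n)) = schubert_n n"
    by (simp add: schubert_n_def nmap_mult[OF ring_hom_omega] nrev_mult omega_stanley nrev_stanley l r mult.assoc
        del: One_nat_def)
      (simp add: left_factor_def del: One_nat_def)
  moreover have "ncong Y n (nrev (nmap omega schubert)) (nrev (nmap omega (schubert_n n)))"
    by (intro ncong_nrev ncong_nmap ring_hom_omega ncong_schubert)
  ultimately have "ncong Y n (nrev (nmap omega schubert)) schubert"
    using ncong_trans ncong_sym ncong_schubert by metis
  then show "ncoeff (nrev (nmap omega schubert)) Y w = ncoeff schubert Y w" using n by (simp add: ncong_def)
qed

lemma omega_schubert: "w \<in> Weyl_group Y \<Longrightarrow> omega (ncoeff schubert Y (inv w)) = ncoeff schubert Y w"
  using ncoeff_nrev[of w Y "nmap omega schubert"] by (simp add: schubert_symmetric ncoeff_nmap ring_hom_omega)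

section \<open>Membership in R and the recursions\<close>

definition coeffs_in_R :: "lie_type \<Rightarrow> series nilcox \<Rightarrow> bool" where
  "coeffs_in_R Y F \<longleftrightarrow> (\<forall>w \<in> Weyl_group Y. ncoeff F Y w \<in> ring_R Y)"

lemma coeffs_in_R_mult: "coeffs_in_R Y F \<Longrightarrow> coeffs_in_R Y G \<Longrightarrow> coeffs_in_R Y (F * G)"
  unfolding coeffs_in_R_def by (auto simp: ncoeff_times intro!: ring_R_sum ring_R_closed dest!: factsD)

lemma coeffs_in_R_one: "coeffs_in_R Y 1"
  by (simp add: coeffs_in_R_def ncoeff_one ring_R_closed)

lemma coeffs_in_R_prod_list: "(\<And>F. F \<in> set Fs \<Longrightarrow> coeffs_in_R Y F) \<Longrightarrow> coeffs_in_R Y (prod_list Fs)"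
  by (induction Fs) (simp_all add: coeffs_in_R_one coeffs_in_R_mult)

lemma coeffs_in_R_h: "a \<in> ring_R Y \<Longrightarrow> coeffs_in_R Y (h_elem i a)"
  by (auto simp: coeffs_in_R_def h_elem_def ncoeff_one ncoeff_gen ring_R_closed)

lemma coeffs_in_R_nrev: "coeffs_in_R Y F \<Longrightarrow> coeffs_in_R Y (nrev F)"
  by (simp add: coeffs_in_R_def ncoeff_nrev inv_in_Weyl)

lemma coeffs_in_R_tri: "(\<And>j. j \<ge> 1 \<Longrightarrow> \<zeta> j \<in> ring_R Y) \<Longrightarrow> coeffs_in_R Y (tri 1 n \<zeta>)"
  unfolding tri_def down_prod_def by (auto intro!: coeffs_in_R_prod_list coeffs_in_R_h)

lemma schubert_in_ring_R:
  assumes w: "w \<in> Weyl_group Y" shows "ncoeff schubert Y w \<in> ring_R Y"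
proof -
  obtain n where n: "w \<in> parabolic Y n" using parabolic_exhaust[OF w] by blast
  have "coeffs_in_R Y stanley" by (simp add: coeffs_in_R_def stanley_in_Gam ring_R_gens)
  then have "coeffs_in_R Y (schubert_n n)"
    unfolding schubert_n_def left_factor_def
    by (intro coeffs_in_R_mult coeffs_in_R_nrev coeffs_in_R_tri) (auto intro!: ring_R_closed(6) ring_R_gens(1,2))
  then show ?thesis using ncong_schubert[of Y n] n w by (simp add: coeffs_in_R_def ncong_def)
qed

lemma schubert_mult_gen_in_ring_R: "w \<in> Weyl_group Y \<Longrightarrow> i \<in> index_set Y \<Longrightarrow> ncoeff (schubert * gen i) Y w \<in> ring_R Y"
  by (simp add: ncoeff_mult_gen schubert_in_ring_R comp_in_Weyl ring_R_closed)

lemma del_schubert: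
  assumes i: "i \<in> index_set Y" and w: "w \<in> Weyl_group Y"
  shows "del Y i (ncoeff schubert Y w) = (if len Y (w \<circ> reflection i) < len Y w then ncoeff schubert Y (w \<circ> reflection i) else 0)"
proof -
  have "del Y i (ncoeff schubert Y w) = ncoeff (schubert * gen i) Y w"
    by (rule del_eq[OF i schubert_mult_gen_in_ring_R[OF w i]]) (simp add: schubert_act_z[OF i w])
  then show ?thesis using i by (simp add: ncoeff_mult_gen[OF w])
qed

text \<open>The z-recursion at the inverse of \<open>w\<close>, transported by \<open>omega\<close>:
  inversion preserves lengths and turns right into left multiplication.\<close>

lemma delta_schubert:
  assumes i: "i \<in> index_set Y" and w: "w \<in> Weyl_group Y"
  shows "delta Y i (ncoeff schubert Y w) = (if len Y (reflection i \<circ> w) < len Y w then ncoeff schubert Y (reflection i \<circ> w) else 0)"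
proof -
  let ?v = "reflection i \<circ> w" and ?c = "ncoeff (schubert * gen i) Y (inv w)"
  have iw: "inv w \<in> Weyl_group Y" using w by (rule inv_in_Weyl)
  have v: "?v \<in> Weyl_group Y" using i w by (simp add: comp_in_Weyl)
  have inv: "inv ?v = inv w \<circ> reflection i"
    using o_inv_distrib[OF bij_reflection bij_Weyl[OF w]] by simp
  have "len Y (inv w \<circ> reflection i) = len Y ?v" "len Y (inv w) = len Y w"
    using len_inv[OF v] len_inv[OF w] by (simp_all only: inv)
  then have c: "omega ?c = (if len Y ?v < len Y w then ncoeff schubert Y ?v else 0)"
    using i omega_schubert[OF v] by (simp add: ncoeff_mult_gen[OF iw] inv ring_hom_zero[OF ring_hom_omega])
  have "delta Y i (ncoeff schubert Y w) = omega ?c"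
  proof (rule delta_eq[OF i omega_ring_R[OF schubert_mult_gen_in_ring_R[OF iw i]]])
    have e: "omega (ncoeff schubert Y w) = ncoeff schubert Y (inv w)" using omega_schubert[OF w] by (metis omega_omega)
    have "act_t i (ncoeff schubert Y w) = omega (ncoeff schubert Y (inv w) - zroot Y i * ?c)"
      unfolding act_t_eq e schubert_act_z[OF i iw] ..
    also have "\<dots> = ncoeff schubert Y w - simple_root Y i * omega ?c"
      by (simp add: ring_hom_minus[OF ring_hom_omega] ring_hom_mult[OF ring_hom_omega] omega_schubert[OF w] zroot_def)
    finally show "simple_root Y i * omega ?c = ncoeff schubert Y w - act_t i (ncoeff schubert Y w)" by simp
  qed
  then show ?thesis by (simp only: c)
qed

lemma ncoeff_stanley_id: "ncoeff stanley Y id = 1"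
proof (rule Gam_eqI[of _ Y])
  show "D_op k (ncoeff stanley Y id) = D_op k 1" if "k \<ge> 1" for k
    using that by (simp add: D_op_stanley ncoeff_times_id ncoeff_C_part_series D_op_one)
qed (simp_all add: stanley_in_Gam Gam_closed const_stanley coeff_one)

lemma schubert_id: "ncoeff schubert Y id = 1"
proof -
  have "ncoeff schubert Y id = ncoeff (schubert_n 0) Y id" using ncong_schubert[of Y 0] by (simp add: ncong_def)
  then show ?thesis by (simp add: schubert_n_def left_factor_def tri_def ncoeff_stanley_id)
qed

text \<open>With all variables set to 0 every factor \<open>h_elem\<close> of the outer products is
  1, and the constant terms of \<open>stanley\<close> are the coefficients of 1.\<close>

lemma const_schubert: "w \<in> Weyl_group Y \<Longrightarrow> w \<noteq> id \<Longrightarrow> coeff (ncoeff schubert Y w) 0 = 0"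
proof -
  assume w: "w \<in> Weyl_group Y" "w \<noteq> id"
  let ?\<phi> = "\<lambda>f :: series. coeff f 0"
  obtain n where n: "w \<in> parabolic Y n" using parabolic_exhaust[OF w(1)] by blast
  have one: "tri 1 n (\<lambda>_. 0 :: int) = 1"
    by (simp add: tri_def down_prod_def map_replicate_const)
  have V: "?\<phi> (Var v) = 0" for v
    by (auto simp: coeff_Var dest: arg_cong[where f = "\<lambda>m. exponent m v"])
  have "nmap ?\<phi> (schubert_n n) = 1"
    by (simp add: schubert_n_def left_factor_def nmap_mult[OF ring_hom_const_coeff] nmap_nrev[OF ring_hom_const_coeff]
        nmap_tri[OF ring_hom_const_coeff] nmap_const_stanley V one[simplified])
  then have "ncoeff (nmap ?\<phi> (schubert_n n)) Y w = 0" using w by (simp add: ncoeff_one)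
  then show ?thesis using ncong_schubert[of Y n] n by (simp add: ncoeff_nmap ring_hom_const_coeff ncong_def)
qed

theorem theorem1p1:
  fixes Y :: lie_type
  shows "\<exists>!S. S \<in> Weyl_group Y \<rightarrow>\<^sub>E ring_R Y \<and>
    (\<forall>i\<in>index_set Y. \<forall>w\<in>Weyl_group Y.
      del Y i (S w) = (if len Y (w \<circ> reflection i) < len Y w then S (w \<circ> reflection i) else 0) \<and>
      delta Y i (S w) = (if len Y (reflection i \<circ> w) < len Y w then S (reflection i \<circ> w) else 0)) \<and>
    S id = 1 \<and>
    (\<forall>w\<in>Weyl_group Y. w \<noteq> id \<longrightarrow> homogeneous_component 0 (S w) = 0)"
  (is "\<exists>!S. ?P S")
proof (rule ex1I)
  \<comment> \<open>The extensional function space prescribes \<open>undefined\<close> outside the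
    group, whereas \<open>ncoeff\<close> gives 0 there.\<close>
  let ?S = "restrict (ncoeff schubert Y) (Weyl_group Y)"
  have S: "?S w = ncoeff schubert Y w" if "w \<in> Weyl_group Y" for w using that by simp
  show "?P ?S"
  proof (intro conjI ballI impI)
    show "?S \<in> Weyl_group Y \<rightarrow>\<^sub>E ring_R Y" by (auto simp: schubert_in_ring_R)
    show "?S id = 1" by (simp add: schubert_id)
    fix w assume w: "w \<in> Weyl_group Y"
    show "homogeneous_component 0 (?S w) = 0" if "w \<noteq> id"
      using w that by (simp add: homogeneous_component_0_iff const_schubert)
    fix i assume i: "i \<in> index_set Y"
    then have "w \<circ> reflection i \<in> Weyl_group Y" "reflection i \<circ> w \<in> Weyl_group Y"
      using w by (simp_all add: comp_in_Weyl)
    note Ss = S[OF w] S[OF this(1)] S[OF this(2)]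
    show "del Y i (?S w) = (if len Y (w \<circ> reflection i) < len Y w then ?S (w \<circ> reflection i) else 0)"
      unfolding Ss by (rule del_schubert[OF i w])
    show "delta Y i (?S w) = (if len Y (reflection i \<circ> w) < len Y w then ?S (reflection i \<circ> w) else 0)"
      unfolding Ss by (rule delta_schubert[OF i w])
  qed
next
  fix S assume S: "?P S"
  let ?T = "restrict (ncoeff schubert Y) (Weyl_group Y)"
  have SR: "S w \<in> ring_R Y" if "w \<in> Weyl_group Y" for w using S that by (auto simp: PiE_def)
  have eq: "S w = ncoeff schubert Y w" if "w \<in> Weyl_group Y" for w
    using that
  proof (induction "len Y w" arbitrary: w rule: less_induct)
    case less
    note w = less.prems
    show ?case
    proof (cases "w = id")
      case True
      then show ?thesis using S schubert_id by simp
    next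
      case False
      let ?f = "S w - ncoeff schubert Y w"
      have f: "?f \<in> ring_R Y" using SR schubert_in_ring_R w by (intro ring_R_closed)
      have "coeff ?f m = 0" if "m \<noteq> 0" for m
      proof (rule invariant_const[OF f _ _ that])
        fix i assume i: "i \<in> index_set Y"
        let ?u = "w \<circ> reflection i" and ?v = "reflection i \<circ> w"
        have uv: "?u \<in> Weyl_group Y" "?v \<in> Weyl_group Y" using i w by (simp_all add: comp_in_Weyl)
        have u: "S ?u = ncoeff schubert Y ?u" if "len Y ?u < len Y w" using that uv by (intro less.hyps)
        have v: "S ?v = ncoeff schubert Y ?v" if "len Y ?v < len Y w" using that uv by (intro less.hyps)
        have "del Y i (S w) = (if len Y ?u < len Y w then S ?u else 0)"
          "delta Y i (S w) = (if len Y ?v < len Y w then S ?v else 0)" using S i w by blast+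
        \<comment> \<open>By induction both families agree at all shorter elements, so their divided
          differences at \<open>w\<close> coincide. Multiplying by the roots shows that
          \<open>S w - ncoeff schubert Y w\<close> is invariant under both actions, hence
          constant.\<close>
        then have d: "del Y i (S w) = del Y i (ncoeff schubert Y w)" "delta Y i (S w) = delta Y i (ncoeff schubert Y w)"
          using u v by (simp_all only: del_schubert[OF i w] delta_schubert[OF i w] cong: if_cong)
        have "S w - act_z i (S w) = ncoeff schubert Y w - act_z i (ncoeff schubert Y w)"
          by (simp only: zroot_del[OF i SR[OF w], symmetric] zroot_del[OF i schubert_in_ring_R[OF w], symmetric] d)
        then show "act_z i ?f = ?f" by (simp add: ring_hom_minus[OF ring_hom_act_z] algebra_simps)
        have "S w - act_t i (S w) = ncoeff schubert Y w - act_t i (ncoeff schubert Y w)"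
          by (simp only: simple_root_delta[OF i SR[OF w], symmetric] simple_root_delta[OF i schubert_in_ring_R[OF w], symmetric] d)
        then have "act_t i (S w) - act_t i (ncoeff schubert Y w) = ?f" by (simp add: algebra_simps)
        moreover have "act_t i ?f = act_t i (S w) - act_t i (ncoeff schubert Y w)"
          by (simp add: act_t_eq ring_hom_minus[OF ring_hom_omega] ring_hom_minus[OF ring_hom_act_z])
        ultimately show "act_t i ?f = ?f" by (simp only:)
      qed
      moreover have "coeff ?f 0 = 0"
        using S w False const_schubert[OF w False] by (auto simp: homogeneous_component_0_iff)
      ultimately have "?f = 0" by (intro mseries_eqI) (metis coeff_zero)
      then show ?thesis by simp
    qed
  qed
  show "S = ?T"
  proof
    fix w show "S w = ?T w"
      using eq[of w] S by (cases "w \<in> Weyl_group Y") (auto simp: PiE_def extensional_def)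
  qed
qed

end
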